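(* Every properly supported weight function $w$ on $\mathbb R^d$ has a quadrature domain; that is, there exists a bounded open set $Q\subseteq\mathbb R^d$ such that $w\equiv 0$ outside $Q$ and $\int hw\,dx\le\int_Q h\,dx$ for every integrable subharmonic function $h$ on $Q$.
   Context: A weight function is a bounded, nonnegative, measurable function on $\mathbb R^d$. A weight function $w$ is properly supported if there is a bounded open set $U$ with $w\ge1$ on $U$ and $w=0$ outside $U$. For $\Omega\subseteq\mathbb R^d$ open and $h:\Omega\to\mathbb R\cup\{\pm\infty\}$ locally integrable, let $A_h(x;r)=\frac1{\lambda(B_r(x))}\int_{B_r(x)}h(y)\,dy$, where $\lambda$ is Lebesgue measure and $B_r(x)$ is the open ball. Such an $h$ is subharmonic at $x\in\Omega$ if (a) $\limsup_{y\to x}h(y)\le h(x)$, and (b) $h(x)\le A_h(x;r)$ for all sufficiently small $r>0$. It is subharmonic on $\Omega$ if it is subharmonic at every point of $\Omega$. The integral $\int hw\,dx$ is over $Q$, since $w$ vanishes outside $Q$. *)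

theory Defs
  imports "HOL-Analysis.Analysis"
begin

definition weight_function :: "('a::euclidean_space \<Rightarrow> real) \<Rightarrow> bool" where
  "weight_function w \<longleftrightarrow>
     w \<in> borel_measurable lebesgue \<and> bounded (range w) \<and> (\<forall>x. 0 \<le> w x)"

definition properly_supported :: "('a::euclidean_space \<Rightarrow> real) \<Rightarrow> bool" where
  "properly_supported w \<longleftrightarrow>
     (\<exists>U. open U \<and> bounded U \<and> (\<forall>x\<in>U. 1 \<le> w x) \<and> (\<forall>x. x \<notin> U \<longrightarrow> w x = 0))"

text \<open>A function on a set \<open>S\<close> with values in the extended reals is represented by a total
  function whose values outside \<open>S\<close> are never used. The Bochner integral is not available for
  such functions, so integrals are differences of integrals of the positive and the negative
  part; note that \<^const>\<open>e2ennreal\<close> maps negative values to \<open>0\<close>. The difference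
  is only meaningful when the function is integrable.\<close>

definition ereal_integrable_on :: "('a::euclidean_space \<Rightarrow> ereal) \<Rightarrow> 'a set \<Rightarrow> bool" where
  "ereal_integrable_on h S \<longleftrightarrow>
     h \<in> borel_measurable (lebesgue_on S) \<and> (\<integral>\<^sup>+ x. e2ennreal \<bar>h x\<bar> \<partial>lebesgue_on S) < \<infinity>"

definition ereal_integral :: "'a set \<Rightarrow> ('a::euclidean_space \<Rightarrow> ereal) \<Rightarrow> ereal" where
  "ereal_integral S h =
     enn2ereal (\<integral>\<^sup>+ x. e2ennreal (h x) \<partial>lebesgue_on S)
     - enn2ereal (\<integral>\<^sup>+ x. e2ennreal (- h x) \<partial>lebesgue_on S)"

definition ereal_locally_integrable_on ::
    "('a::euclidean_space \<Rightarrow> ereal) \<Rightarrow> 'a set \<Rightarrow> bool" where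
  "ereal_locally_integrable_on h \<Omega> \<longleftrightarrow>
     (\<forall>K. compact K \<and> K \<subseteq> \<Omega> \<longrightarrow> ereal_integrable_on h K)"

definition ball_average :: "('a::euclidean_space \<Rightarrow> ereal) \<Rightarrow> 'a \<Rightarrow> real \<Rightarrow> ereal" where
  "ball_average h x r = ereal_integral (ball x r) h / ereal (measure lebesgue (ball x r))"

text \<open>The upper limit below is over the punctured neighbourhoods of \<open>x\<close>; including the value at
  \<open>x\<close> itself gives the same condition. For \<open>x\<close> in the open set \<open>\<Omega>\<close>, small balls around
  \<open>x\<close> lie in \<open>\<Omega>\<close>, so the averages use only values of \<open>h\<close> on \<open>\<Omega>\<close>.\<close>

definition subharmonic_at ::
    "'a::euclidean_space set \<Rightarrow> ('a \<Rightarrow> ereal) \<Rightarrow> 'a \<Rightarrow> bool" where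
  "subharmonic_at \<Omega> h x \<longleftrightarrow>
     Limsup (at x within \<Omega>) h \<le> h x \<and>
     (\<forall>\<^sub>F r in at_right 0. h x \<le> ball_average h x r)"

definition subharmonic_on :: "('a::euclidean_space \<Rightarrow> ereal) \<Rightarrow> 'a set \<Rightarrow> bool" where
  "subharmonic_on h \<Omega> \<longleftrightarrow>
     open \<Omega> \<and> ereal_locally_integrable_on h \<Omega> \<and> (\<forall>x\<in>\<Omega>. subharmonic_at \<Omega> h x)"

definition quadrature_domain ::
    "('a::euclidean_space \<Rightarrow> real) \<Rightarrow> 'a set \<Rightarrow> bool" where
  "quadrature_domain w Q \<longleftrightarrow>
     open Q \<and> bounded Q \<and> (\<forall>x. x \<notin> Q \<longrightarrow> w x = 0) \<and>
     (\<forall>h. subharmonic_on h Q \<and> ereal_integrable_on h Q \<longrightarrow>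
        ereal_integral Q (\<lambda>x. h x * ereal (w x)) \<le> ereal_integral Q h)"

end

theory Submission
  imports Defs "HOL-Complex_Analysis.Great_Picard"
begin

text \<open>
  Think of \<open>w\<close> as a distribution of mass that is to be spread until it has density one on an open set. Let \<open>u\<close> be
  the least nonnegative function whose Laplacian is at most \<open>1 - w\<close>, and let \<open>Q\<close> be the union of the set where \<open>u\<close> is
  positive with the set \<open>U\<close> on which \<open>w \<ge> 1\<close>. Where \<open>u\<close> is positive, minimality forces the Laplacian of \<open>u\<close> to equal
  \<open>1 - w\<close>. At a zero of \<open>u\<close> in \<open>U\<close> the Laplacian is nonnegative and \<open>1 - w\<close> is nonpositive, so again the two agree
  almost everywhere. Hence, for \<open>h\<close> subharmonic on \<open>Q\<close>, the difference of the integral of \<open>h\<close> over \<open>Q\<close> and of the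
  integral of \<open>h w\<close> is the integral of \<open>h\<close> times the Laplacian of \<open>u\<close>. By Green's formula it equals the integral of
  \<open>u\<close> times the Laplacian of \<open>h\<close>, which is nonnegative.

  The proof carries this out without derivatives. Write \<open>A r\<close> for the average over the ball of radius \<open>r\<close> and \<open>E r\<close> for
  the average with a second radial law, called \<open>dome\<close>. For smooth \<open>f\<close> the difference \<open>A r f - f\<close> is a constant times
  \<open>r\<^sup>2 * E r\<close> of the Laplacian of \<open>f\<close>; so the statement that the Laplacian of \<open>u\<close> is \<open>g\<close> is read, up to that constant, as
  \<open>A r u - u = r\<^sup>2 * E r g\<close>. All that is needed about this reading is lemma \<open>cocycle\<close>, the identity
  \<open>s\<^sup>2 * (A r - 1) (E s f) = r\<^sup>2 * (A s - 1) (E r f)\<close>, which is verified on exponentials and then holds for all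
  bounded Borel functions. It transfers relations from one radius to another, and it is used for three purposes. First,
  the sub-mean value inequality of a subharmonic function, which is assumed only for radii that are small depending on
  the point, holds for all balls inside \<open>Q\<close> (\<open>local_submean_imp_submean\<close>). Second, potentials with known Laplacian are
  available, which give a barrier and a Lipschitz bound for the obstacle problem discretised at scale \<open>\<epsilon>\<close>
  (\<open>barrier_exists\<close>, \<open>odometer_lipschitz\<close>). Third, the discrete solutions converge to a solution of the continuous
  obstacle problem (\<open>obstacle_solution_exists\<close>).

  Green's formula is delicate because \<open>h\<close> is merely integrable near the boundary of \<open>Q\<close>. It is applied to truncations
  \<open>v\<close> of \<open>u\<close> that vanish where \<open>u\<close> is at most a multiple of \<open>r\<close>. There the formula is the symmetry of \<open>A r\<close>
  (\<open>submean_pairing_nonneg\<close>). The quotients \<open>(A r v - v) / r\<^sup>2\<close> tend to \<open>1 - w\<close> almost everywhere on \<open>Q\<close> along a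
  sequence of radii, and they are bounded uniformly in \<open>r\<close> because the square of the gradient of \<open>u\<close> is at most a multiple
  of \<open>u\<close> (\<open>obstacle_gradient_bound\<close>, \<open>truncated_odometer\<close>). So dominated convergence, with a multiple of the absolute
  value of \<open>h\<close> as the bound, yields the inequality.
\<close>

section \<open>Averages over dilates of a law on the unit ball\<close>

text \<open>The averaging operators below map this class to itself, so they can be composed and interchanged without
integrability side conditions.\<close>

definition bdd_borel :: "('a::euclidean_space \<Rightarrow> real) \<Rightarrow> bool" where
  "bdd_borel f \<longleftrightarrow> f \<in> borel_measurable borel \<and> (\<exists>C. \<forall>x. \<bar>f x\<bar> \<le> C)"

lemma bdd_borelI: "f \<in> borel_measurable borel \<Longrightarrow> (\<And>x. \<bar>f x\<bar> \<le> C) \<Longrightarrow> bdd_borel f"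
  unfolding bdd_borel_def by blast

lemma bdd_borel_measurable: "bdd_borel f \<Longrightarrow> f \<in> borel_measurable borel"
  unfolding bdd_borel_def by blast

lemma bdd_borel_bound:
  assumes "bdd_borel f" obtains C where "C \<ge> 0" "\<And>x. \<bar>f x\<bar> \<le> C"
proof -
  obtain C where "\<forall>x. \<bar>f x\<bar> \<le> C" using assms unfolding bdd_borel_def by blast
  then show ?thesis using that[of C] by (meson abs_ge_zero order_trans)
qed

lemma bdd_borel_const: "bdd_borel (\<lambda>x. c)"
  by (rule bdd_borelI[where C="\<bar>c\<bar>"]) auto

lemma bdd_borel_add:
  assumes "bdd_borel f" "bdd_borel g" shows "bdd_borel (\<lambda>x. f x + g x)"
proof -
  obtain C D where "\<And>x. \<bar>f x\<bar> \<le> C" "\<And>x. \<bar>g x\<bar> \<le> D"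
    using assms by (metis bdd_borel_bound)
  then show ?thesis
    using assms[THEN bdd_borel_measurable]
    by (intro bdd_borelI[where C="C+D"]) (auto intro: order_trans[OF abs_triangle_ineq] add_mono)
qed

lemma bdd_borel_cmult:
  assumes "bdd_borel f" shows "bdd_borel (\<lambda>x. c * f x)"
proof -
  obtain C where "\<And>x. \<bar>f x\<bar> \<le> C"
    using assms by (metis bdd_borel_bound)
  then show ?thesis
    using assms[THEN bdd_borel_measurable]
    by (intro bdd_borelI[where C="\<bar>c\<bar>*C"]) (auto simp: abs_mult intro: mult_left_mono)
qed

lemma bdd_borel_diff:
  assumes "bdd_borel f" "bdd_borel g" shows "bdd_borel (\<lambda>x. f x - g x)"
  using bdd_borel_add[OF assms(1) bdd_borel_cmult[OF assms(2), of "-1"]] by simp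

lemma bdd_borel_max:
  assumes "bdd_borel f" "bdd_borel g" shows "bdd_borel (\<lambda>x. max (f x) (g x))"
proof -
  obtain C D where "\<And>x. \<bar>f x\<bar> \<le> C" "\<And>x. \<bar>g x\<bar> \<le> D"
    using assms by (metis bdd_borel_bound)
  then have "\<bar>max (f x) (g x)\<bar> \<le> max C D" for x
    by (smt (verit))
  then show ?thesis
    using assms[THEN bdd_borel_measurable]
    by (intro bdd_borelI[where C="max C D"]) auto
qed

lemma bdd_borel_translate:
  assumes "bdd_borel f" shows "bdd_borel (\<lambda>x. f (x + a))"
proof -
  have [measurable]: "f \<in> borel_measurable borel" using assms by (rule bdd_borel_measurable)
  have "(\<lambda>x. f (x + a)) \<in> borel_measurable borel" by measurable
  then show ?thesis using assms unfolding bdd_borel_def by blast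
qed

lemmas bdd_borel_intros = bdd_borel_const bdd_borel_add bdd_borel_cmult bdd_borel_diff
  bdd_borel_max bdd_borel_translate

text \<open>An average is given by one law dilated by \<open>r\<close>, and not by a separate measure for each radius, so that the
same kind of average can be compared at different scales.\<close>

definition smear :: "'a::euclidean_space measure \<Rightarrow> real \<Rightarrow> ('a \<Rightarrow> real) \<Rightarrow> 'a \<Rightarrow> real" where
  "smear \<mu> r f x = (\<integral>y. f (x + r *\<^sub>R y) \<partial>\<mu>)"

text \<open>The support condition makes the averages local: the value at \<open>x\<close> depends only on the function on
\<open>cball x r\<close>. Locality is what allows the operators to be applied near the boundary of an open set.\<close>

locale ball_law = finite_measure \<mu> for \<mu> :: "'a::euclidean_space measure" +
  assumes sets_eq [measurable_cong]: "sets \<mu> = sets borel"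
    and mass: "measure \<mu> UNIV = 1"
    and supp: "AE y in \<mu>. norm y \<le> 1"
begin

lemma space_eq: "space \<mu> = UNIV"
  using sets_eq_imp_space_eq[OF sets_eq] by simp

lemma integrable_smear:
  assumes "bdd_borel f" shows "integrable \<mu> (\<lambda>y. f (x + r *\<^sub>R y))"
proof -
  obtain C where C: "\<And>x. \<bar>f x\<bar> \<le> C" using assms by (metis bdd_borel_bound)
  have [measurable]: "f \<in> borel_measurable borel" using assms by (rule bdd_borel_measurable)
  show ?thesis
    by (rule integrable_const_bound[where B=C]) (use C in auto)
qed

lemma smear_const: "smear \<mu> r (\<lambda>x. c) x = c"
  by (simp add: smear_def space_eq mass)

lemma smear_add:
  "bdd_borel f \<Longrightarrow> bdd_borel g \<Longrightarrow> smear \<mu> r (\<lambda>x. f x + g x) x = smear \<mu> r f x + smear \<mu> r g x"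
  unfolding smear_def by (intro Bochner_Integration.integral_add integrable_smear)

lemma smear_diff:
  "bdd_borel f \<Longrightarrow> bdd_borel g \<Longrightarrow> smear \<mu> r (\<lambda>x. f x - g x) x = smear \<mu> r f x - smear \<mu> r g x"
  unfolding smear_def by (intro Bochner_Integration.integral_diff integrable_smear)

lemma smear_cmult: "smear \<mu> r (\<lambda>x. c * f x) x = c * smear \<mu> r f x"
  unfolding smear_def by simp

lemma smear_translate: "smear \<mu> r (\<lambda>x. f (x + a)) x = smear \<mu> r f (x + a)"
  unfolding smear_def by (simp add: algebra_simps)

lemma AE_in_cball: "0 \<le> r \<Longrightarrow> AE y in \<mu>. x + r *\<^sub>R y \<in> cball x r"
  using supp by eventually_elim (auto simp: dist_norm mult_left_le)

lemma smear_mono: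
  assumes "bdd_borel f" "bdd_borel g" "0 \<le> r" "\<And>y. y \<in> cball x r \<Longrightarrow> f y \<le> g y"
  shows "smear \<mu> r f x \<le> smear \<mu> r g x"
  unfolding smear_def
proof (rule integral_mono_AE)
  show "AE y in \<mu>. f (x + r *\<^sub>R y) \<le> g (x + r *\<^sub>R y)"
    using AE_in_cball[OF assms(3)] by eventually_elim (rule assms(4))
qed (use assms in \<open>auto intro: integrable_smear\<close>)

lemma smear_cong:
  assumes "bdd_borel f" "bdd_borel g" "0 \<le> r" "\<And>y. y \<in> cball x r \<Longrightarrow> f y = g y"
  shows "smear \<mu> r f x = smear \<mu> r g x"
  using assms by (intro antisym smear_mono) auto

lemma smear_le_const:
  assumes "bdd_borel f" "0 \<le> r" "\<And>y. y \<in> cball x r \<Longrightarrow> f y \<le> c"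
  shows "smear \<mu> r f x \<le> c"
  using smear_mono[OF assms(1) bdd_borel_const assms(2,3)] smear_const by simp

lemma smear_ge_const:
  assumes "bdd_borel f" "0 \<le> r" "\<And>y. y \<in> cball x r \<Longrightarrow> c \<le> f y"
  shows "c \<le> smear \<mu> r f x"
  using smear_mono[OF bdd_borel_const assms(1,2,3)] smear_const by simp

lemma smear_abs_le:
  assumes "bdd_borel f" "0 \<le> r" "\<And>y. y \<in> cball x r \<Longrightarrow> \<bar>f y\<bar> \<le> c"
  shows "\<bar>smear \<mu> r f x\<bar> \<le> c"
  using smear_le_const[OF assms(1,2), of x c] smear_ge_const[OF assms(1,2), of x "-c"] assms(3)
  by (simp add: abs_le_iff) (smt (verit))

lemma borel_smear:
  assumes "f \<in> borel_measurable borel" shows "smear \<mu> r f \<in> borel_measurable borel"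
proof -
  have [measurable]: "f \<in> borel_measurable borel" by fact
  have "(\<lambda>x. \<integral>y. f (x + r *\<^sub>R y) \<partial>\<mu>) \<in> borel_measurable borel"
    by (intro borel_measurable_lebesgue_integral) (simp add: split_beta')
  then show ?thesis by (simp add: smear_def[abs_def])
qed

lemma bdd_borel_smear:
  assumes "bdd_borel f" shows "bdd_borel (smear \<mu> r f)"
proof -
  obtain C where C: "C \<ge> 0" "\<And>x. \<bar>f x\<bar> \<le> C" using assms by (metis bdd_borel_bound)
  have "\<bar>smear \<mu> r f x\<bar> \<le> C" for x
  proof -
    have "\<bar>smear \<mu> r f x\<bar> \<le> (\<integral>y. \<bar>f (x + r *\<^sub>R y)\<bar> \<partial>\<mu>)"
      unfolding smear_def by (rule integral_abs_bound)
    also have "\<dots> \<le> (\<integral>y. C \<partial>\<mu>)"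
      by (rule integral_mono[OF integrable_abs[OF integrable_smear[OF assms]]]) (use C in auto)
    finally show ?thesis by (simp add: space_eq mass)
  qed
  then show ?thesis
    by (rule bdd_borelI[OF borel_smear[OF bdd_borel_measurable[OF assms]]])
qed

text \<open>The function may vary together with the radius. Since the radii shrink, closeness to the limit value is only
needed near the point.\<close>

lemma smear_tendsto:
  assumes f: "\<And>n. bdd_borel (f n)" and r: "(r \<longlongrightarrow> 0) F" "\<forall>\<^sub>F n in F. 0 \<le> r n"
    and near: "\<And>e. 0 < e \<Longrightarrow> \<exists>d>0. \<forall>\<^sub>F n in F. \<forall>y\<in>cball x d. \<bar>f n y - l\<bar> \<le> e"
  shows "((\<lambda>n. smear \<mu> (r n) (f n) x) \<longlongrightarrow> l) F"
proof (rule tendstoI)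
  fix e :: real assume "0 < e"
  then obtain d where d: "d > 0" "\<forall>\<^sub>F n in F. \<forall>y\<in>cball x d. \<bar>f n y - l\<bar> \<le> e / 2"
    using near[of "e/2"] by auto
  have "\<forall>\<^sub>F n in F. r n < d" using r(1) d(1) by (rule order_tendstoD)
  with d(2) r(2) show "\<forall>\<^sub>F n in F. dist (smear \<mu> (r n) (f n) x) l < e"
  proof eventually_elim
    case (elim n)
    have "\<bar>smear \<mu> (r n) (\<lambda>y. f n y - l) x\<bar> \<le> e / 2"
      using elim by (intro smear_abs_le bdd_borel_intros f) auto
    then show ?case
      using \<open>0 < e\<close> smear_diff[OF f bdd_borel_const, of "r n" n l x] smear_const[of "r n" l x]
      by (simp add: dist_real_def)
  qed
qed

lemma smear_tendsto_cont:
  assumes "bdd_borel f" "isCont f x" "(r \<longlongrightarrow> 0) F" "\<forall>\<^sub>F n in F. 0 \<le> r n"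
  shows "((\<lambda>n. smear \<mu> (r n) f x) \<longlongrightarrow> f x) F"
proof (rule smear_tendsto[OF _ assms(3,4)])
  fix e :: real assume "0 < e"
  then obtain d where d: "d > 0" "\<forall>y. dist y x < d \<longrightarrow> dist (f y) (f x) < e"
    using assms(2) unfolding continuous_at_eps_delta by auto
  have "\<bar>f y - f x\<bar> \<le> e" if "y \<in> cball x (d/2)" for y
    proof -
    have "dist y x < d" using that d(1) by (simp add: dist_commute)
    then show ?thesis using d(2) by (simp add: dist_real_def less_imp_le)
  qed
  then show "\<exists>d>0. \<forall>\<^sub>F n in F. \<forall>y\<in>cball x d. \<bar>f y - f x\<bar> \<le> e"
    using d by (intro exI[of _ "d/2"]) auto
qed (rule assms)

lemma smear_dominated:
  assumes "\<And>n. bdd_borel (f n)" "bdd_borel g" "0 \<le> r"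
    and "\<And>n y. y \<in> cball x r \<Longrightarrow> \<bar>f n y\<bar> \<le> C"
    and "\<And>y. y \<in> cball x r \<Longrightarrow> (\<lambda>n. f n y) \<longlonglongrightarrow> g y"
  shows "(\<lambda>n. smear \<mu> r (f n) x) \<longlonglongrightarrow> smear \<mu> r g x"
  unfolding smear_def
proof (rule integral_dominated_convergence[where w="\<lambda>_. C"])
  show "(\<lambda>y. g (x + r *\<^sub>R y)) \<in> borel_measurable \<mu>"
       "(\<lambda>y. f n (x + r *\<^sub>R y)) \<in> borel_measurable \<mu>" for n
    using assms(1,2) integrable_smear by auto
  show "integrable \<mu> (\<lambda>_. C)" by simp
  show "AE y in \<mu>. (\<lambda>n. f n (x + r *\<^sub>R y)) \<longlonglongrightarrow> g (x + r *\<^sub>R y)"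
    using AE_in_cball[OF assms(3)] by eventually_elim (rule assms(5))
  show "AE y in \<mu>. norm (f n (x + r *\<^sub>R y)) \<le> C" for n
    using AE_in_cball[OF assms(3), of x] by eventually_elim (simp add: assms(4))
qed

lemma smear_continuous:
  assumes "bdd_borel f" "continuous_on UNIV f"
  shows "continuous_on UNIV (smear \<mu> r f)"
  unfolding continuous_on_sequentially
proof (intro allI impI ballI, elim conjE)
  fix X a assume X: "X \<longlonglongrightarrow> (a::'a)"
  obtain C where C: "\<And>x. \<bar>f x\<bar> \<le> C" using assms by (metis bdd_borel_bound)
  have "(\<lambda>n. smear \<mu> r f (X n)) \<longlonglongrightarrow> smear \<mu> r f a"
    unfolding smear_def
  proof (rule integral_dominated_convergence[where w="\<lambda>_. C"])
    show "(\<lambda>y. f (a + r *\<^sub>R y)) \<in> borel_measurable \<mu>"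
         "(\<lambda>y. f (X n + r *\<^sub>R y)) \<in> borel_measurable \<mu>" for n
      using assms(1) integrable_smear by auto
    show "AE y in \<mu>. (\<lambda>n. f (X n + r *\<^sub>R y)) \<longlonglongrightarrow> f (a + r *\<^sub>R y)"
    proof (rule AE_I2)
      fix y
      have "isCont f (a + r *\<^sub>R y)" using assms(2) by (simp add: continuous_on_eq_continuous_at)
      then show "(\<lambda>n. f (X n + r *\<^sub>R y)) \<longlonglongrightarrow> f (a + r *\<^sub>R y)"
        by (rule isCont_tendsto_compose) (intro tendsto_intros X)
    qed
  qed (use C in auto)
  then show "(smear \<mu> r f \<circ> X) \<longlonglongrightarrow> smear \<mu> r f a" by (simp add: o_def)
qed

end

text \<open>Averages are convolutions, and convolutions commute.\<close>

lemma smear_commute: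
  assumes "ball_law \<mu>" "ball_law \<nu>" "bdd_borel f"
  shows "smear \<mu> r (smear \<nu> s f) x = smear \<nu> s (smear \<mu> r f) x"
proof -
  interpret M: ball_law \<mu> by fact
  interpret N: ball_law \<nu> by fact
  interpret P: pair_sigma_finite \<mu> \<nu> ..
  interpret PF: finite_measure "\<mu> \<Otimes>\<^sub>M \<nu>"
    by (rule finite_measure_pair_measure) unfold_locales
  have [measurable]: "f \<in> borel_measurable borel" using assms(3) by (rule bdd_borel_measurable)
  obtain C where C: "\<And>x. \<bar>f x\<bar> \<le> C" using assms(3) by (metis bdd_borel_bound)
  have "integrable (\<mu> \<Otimes>\<^sub>M \<nu>) (\<lambda>(y, z). f (x + r *\<^sub>R y + s *\<^sub>R z))"
    by (rule PF.integrable_const_bound[where B=C]) (use C in auto)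
  from P.Fubini_integral[OF this]
  show ?thesis by (simp add: smear_def algebra_simps)
qed

section \<open>Affine substitutions\<close>

lemma lborel_integral_affine:
  fixes f :: "'a::euclidean_space \<Rightarrow> real"
  assumes [measurable]: "f \<in> borel_measurable borel" and "c \<noteq> 0"
  shows "(\<integral>y. f y \<partial>lborel) = \<bar>c\<bar> ^ DIM('a) * (\<integral>z. f (x + c *\<^sub>R z) \<partial>lborel)"
proof -
  have "(\<integral>y. f y \<partial>lborel) = (\<integral>y. f y \<partial>density (distr lborel borel (\<lambda>z. x + c *\<^sub>R z)) (\<lambda>_. \<bar>c\<bar> ^ DIM('a)))"
    using lborel_affine[of c x] assms(2) by simp
  also have "\<dots> = (\<integral>y. \<bar>c\<bar> ^ DIM('a) * f y \<partial>distr lborel borel (\<lambda>z. x + c *\<^sub>R z))"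
    using assms(2) by (subst integral_density) auto
  also have "\<dots> = (\<integral>z. \<bar>c\<bar> ^ DIM('a) * f (x + c *\<^sub>R z) \<partial>lborel)"
    by (subst integral_distr) auto
  finally show ?thesis by simp
qed

lemma lborel_integrable_translate:
  fixes f :: "'a::euclidean_space \<Rightarrow> real"
  assumes "integrable lborel f"
  shows "integrable lborel (\<lambda>z. f (z + a))"
proof -
  have "integrable (distr lborel borel ((+) a)) f"
    using assms by (subst lborel_distr_plus) auto
  then show ?thesis
    using borel_measurable_integrable[OF assms]
    by (subst (asm) integrable_distr_eq) (auto simp: add.commute)
qed

lemma lborel_integral_translate:
  fixes f :: "'a::euclidean_space \<Rightarrow> real"
  assumes "f \<in> borel_measurable borel"
  shows "(\<integral>z. f (z + a) \<partial>lborel) = (\<integral>z. f z \<partial>lborel)"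
  using lborel_integral_affine[OF assms, of 1 a] by (simp add: add.commute)

lemma integrable_mult_bdd:
  assumes H: "integrable lborel H" and f: "bdd_borel f"
  shows "integrable lborel (\<lambda>x. H x * f x)"
proof -
  obtain C where C: "0 \<le> C" "\<And>x. \<bar>f x\<bar> \<le> C" using f by (metis bdd_borel_bound)
  have "integrable lborel (\<lambda>x. \<bar>H x\<bar> * C)" by (intro integrable_mult_left integrable_abs H)
  then show ?thesis
    by (rule Bochner_Integration.integrable_bound)
      (use C H bdd_borel_measurable[OF f] in \<open>auto simp: abs_mult intro!: mult_left_mono\<close>)
qed

section \<open>Ball averages\<close>

lemma ball_borel [measurable]: "ball x r \<in> sets borel"
  by simp

lemma integrable_ball_indicator: "integrable lborel (indicator (ball (x::'a::euclidean_space) r) :: 'a \<Rightarrow> real)"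
  by (rule integrable_real_indicator[OF _ emeasure_lborel_ball_finite]) simp

lemma integral_ball_indicator_translate:
  "(\<integral>z. indicator (ball (0::'a::euclidean_space) 1) (z + h) \<partial>lborel) = measure lborel (ball (0::'a) 1)"
  using lborel_integral_translate[of "indicator (ball (0::'a) 1)" h] by simp

definition unif :: "'a::euclidean_space measure" where
  "unif = uniform_measure lborel (ball 0 1)"

lemma unit_vol_pos: "0 < measure lborel (ball (0::'a::euclidean_space) 1)"
  by (simp add: content_ball)

lemma emeasure_unit_ball:
  "emeasure lborel (ball (0::'a::euclidean_space) 1) = ennreal (measure lborel (ball (0::'a) 1))"
  by (simp add: emeasure_ball content_ball)

lemma measure_ball_scale:
  "0 \<le> r \<Longrightarrow> measure lborel (ball (x::'a::euclidean_space) r)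
    = r ^ DIM('a) * measure lborel (ball (0::'a) 1)"
  by (simp add: content_ball)

lemma ball_law_unif: "ball_law (unif :: 'a::euclidean_space measure)"
proof -
  have fin: "emeasure lborel (ball (0::'a) 1) \<noteq> 0" "emeasure lborel (ball (0::'a) 1) \<noteq> \<infinity>"
    using unit_vol_pos[where 'a='a] emeasure_unit_ball[where 'a='a] by auto
  have one: "emeasure (unif :: 'a measure) (space unif) = 1"
    using fin unfolding unif_def by (simp, intro ennreal_divide_self) (auto simp: less_top[symmetric])
  interpret finite_measure "unif :: 'a measure"
    by (rule finite_measureI) (simp add: one)
  show ?thesis
  proof
    show "sets (unif::'a measure) = sets borel" by (simp add: unif_def)
    show "measure (unif::'a measure) UNIV = 1"
      using one by (simp add: measure_def unif_def)
    have "AE y in lborel. y \<in> ball 0 1 \<longrightarrow> norm (y::'a) \<le> 1" by auto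
    then show "AE y in unif. norm (y::'a) \<le> 1"
      unfolding unif_def by (intro AE_uniform_measureI) auto
  qed
qed

interpretation unif: ball_law "unif :: 'a::euclidean_space measure"
  by (rule ball_law_unif)

lemma integral_unif:
  fixes f :: "'a::euclidean_space \<Rightarrow> real"
  assumes [measurable]: "f \<in> borel_measurable borel"
  shows "(\<integral>z. f z \<partial>unif) = (\<integral>z. indicator (ball 0 1) z * f z \<partial>lborel) / measure lborel (ball (0::'a) 1)"
proof -
  let ?V = "measure lborel (ball (0::'a) 1)"
  have "indicator (ball 0 1) x / emeasure lborel (ball (0::'a) 1)
      = ennreal (indicator (ball 0 1) x / ?V)" for x :: 'a
    using unit_vol_pos[where 'a='a]
    divide_ennreal[of 1 ?V]
    by (auto simp: emeasure_unit_ball split: split_indicator)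
  then have "unif = density lborel (\<lambda>x::'a. ennreal (indicator (ball 0 1) x / ?V))"
    unfolding unif_def uniform_measure_def by simp
  then have "(\<integral>z. f z \<partial>unif) = (\<integral>z. (indicator (ball 0 1) z / ?V) * f z \<partial>lborel)"
    using unit_vol_pos[where 'a='a] by (simp only: \<open>unif = _\<close>) (subst integral_density, auto)
  then show ?thesis by simp
qed

lemma smear_unif:
  fixes f :: "'a::euclidean_space \<Rightarrow> real"
  assumes [measurable]: "f \<in> borel_measurable borel" and "0 < r"
  shows "smear unif r f x = (\<integral>y. indicator (ball x r) y * f y \<partial>lborel) / measure lborel (ball x r)"
proof -
  have ind: "indicator (ball x r) (x + r *\<^sub>R z) = (indicator (ball 0 1) z :: real)" for z
    using assms(2) by (auto simp: indicator_def dist_norm mult_less_cancel_left_pos[of r _ 1, simplified])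
  have "(\<integral>y. indicator (ball x r) y * f y \<partial>lborel)
      = r ^ DIM('a) * (\<integral>z. indicator (ball 0 1) z * f (x + r *\<^sub>R z) \<partial>lborel)"
    using lborel_integral_affine[of "\<lambda>y. indicator (ball x r) y * f y" r x] assms(2) ind by simp
  moreover have "smear unif r f x = (\<integral>z. indicator (ball 0 1) z * f (x + r *\<^sub>R z) \<partial>lborel)
      / measure lborel (ball (0::'a) 1)"
    unfolding smear_def by (rule integral_unif) measurable
  ultimately show ?thesis
    using assms(2) measure_ball_scale[of r x] by simp
qed

text \<open>The ball is symmetric; hence first-order terms disappear from ball averages.\<close>

lemma unif_linear: "(\<integral>z. a \<bullet> z \<partial>unif) = (0::real)" for a :: "'a::euclidean_space"
proof -
  have "(\<integral>z. indicator (ball 0 1) z * (a \<bullet> z) \<partial>lborel)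
      = (\<integral>z. indicator (ball 0 1) (-z) * (a \<bullet> (-z)) \<partial>lborel)"
    using lborel_integral_affine[of "\<lambda>z. indicator (ball 0 1) z * (a \<bullet> z)" "-1" 0] by simp
  also have "\<dots> = (\<integral>z. - (indicator (ball 0 1) z * (a \<bullet> z)) \<partial>lborel)"
    by (intro Bochner_Integration.integral_cong) (auto simp: indicator_def)
  finally show ?thesis by (simp add: integral_unif)
qed

section \<open>Shift estimates for radial kernels\<close>

text \<open>For smooth \<open>f\<close>, the derivative in \<open>s\<close> of the mean of \<open>f\<close> over the ball of radius \<open>s\<close> is \<open>s / 2\<close> times the
mean over the unit ball of \<open>cap z\<close> times the Laplacian of \<open>f\<close> at \<open>x + s z\<close>. Hence mixtures of dilates of this
profile recover \<open>f\<close> minus its ball average from the Laplacian of \<open>f\<close>.\<close>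

definition cap :: "'a::euclidean_space \<Rightarrow> real" where
  "cap z = max 0 (1 - z \<bullet> z)"

lemma cap_measurable [measurable]: "cap \<in> borel_measurable borel"
  unfolding cap_def[abs_def] by measurable

lemma cap_nonneg: "0 \<le> cap z" and cap_le_1: "cap z \<le> 1"
  by (auto simp: cap_def)

lemma cap_eq_0: "1 \<le> norm z \<Longrightarrow> cap z = 0"
  using power_mono[of 1 "norm z" 2] by (simp add: cap_def flip: power2_norm_eq_inner)

lemma cap_le_indicator: "cap z \<le> indicator (ball 0 1) z"
  by (cases "norm z < 1") (auto simp: cap_le_1 cap_eq_0)

lemma integrable_cap: "integrable lborel (cap :: 'a::euclidean_space \<Rightarrow> real)"
  by (rule Bochner_Integration.integrable_bound[OF integrable_ball_indicator[of 0 1]])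
     (auto intro!: AE_I2 order_trans[OF cap_le_indicator] simp: abs_of_nonneg[OF cap_nonneg] simp del: indicator_simps)

text \<open>For \<open>norm h \<le> 1\<close> the ball and its translate differ only inside the shell between the radii
\<open>1 - norm h\<close> and \<open>1 + norm h\<close>, whose volume is of order \<open>norm h\<close>; for larger \<open>h\<close> twice the volume of the ball is
already a good enough bound.\<close>

lemma unit_indicator_shift:
  fixes h :: "'a::euclidean_space" and V :: real
  defines "V \<equiv> measure lborel (ball (0::'a) 1)"
  shows "(\<integral>z. \<bar>indicator (ball 0 1) (z + h) - indicator (ball 0 1) z\<bar> \<partial>lborel) \<le> 2 ^ (DIM('a) + 1) * DIM('a) * V * norm h"
    (is "?I \<le> _")
proof -
  have V: "0 \<le> V" by (simp add: V_def)
  have int: "integrable lborel (\<lambda>z. \<bar>indicator (ball 0 1) (z + h) - indicator (ball 0 1) z :: real\<bar>)"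
    by (intro integrable_abs Bochner_Integration.integrable_diff lborel_integrable_translate integrable_ball_indicator)
  show ?thesis
  proof (cases "norm h \<le> 1")
    case True
    have "?I \<le> (\<integral>z. indicator (ball (0::'a) (1 + norm h)) z - indicator (ball 0 (1 - norm h)) z \<partial>lborel)"
    proof (rule integral_mono)
      show "integrable lborel (\<lambda>z::'a. indicator (ball 0 (1 + norm h)) z - indicator (ball 0 (1 - norm h)) z :: real)"
        by (intro Bochner_Integration.integrable_diff integrable_ball_indicator)
      fix z :: 'a
      have "norm (z + h) \<le> norm z + norm h" "norm z \<le> norm (z + h) + norm h"
        using norm_triangle_ineq[of z h] norm_triangle_ineq[of "z+h" "-h"] by auto
      then show "\<bar>indicator (ball 0 1) (z + h) - indicator (ball 0 1) z\<bar>
          \<le> indicator (ball 0 (1 + norm h)) z - (indicator (ball 0 (1 - norm h)) z :: real)"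
        using norm_ge_zero[of h] by (auto simp: indicator_def simp del: norm_ge_zero)
    qed (rule int)
    also have "\<dots> = measure lborel (ball (0::'a) (1 + norm h)) - measure lborel (ball (0::'a) (1 - norm h))"
      by (subst Bochner_Integration.integral_diff) (auto intro: integrable_ball_indicator)
    also have "\<dots> = V * ((1 + norm h) ^ DIM('a) - (1 - norm h) ^ DIM('a))"
      using True by (subst (1 2) measure_ball_scale) (auto simp: V_def algebra_simps)
    also have "(1 + norm h) ^ DIM('a) - (1 - norm h) ^ DIM('a)
        = 2 ^ DIM('a) * (((1 + norm h) / 2) ^ DIM('a) - ((1 - norm h) / 2) ^ DIM('a))"
      by (simp add: power_divide field_simps)
    also have "V * \<dots> \<le> V * (2 ^ DIM('a) * (DIM('a) * norm h))"
    proof -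
      have "norm (((1 + norm h) / 2) ^ DIM('a) - ((1 - norm h) / 2) ^ DIM('a))
          \<le> DIM('a) * norm ((1 + norm h) / 2 - (1 - norm h) / 2)"
        using True by (intro norm_power_diff) (auto intro: order_trans[OF _ norm_ge_zero])
      also have "norm ((1 + norm h) / 2 - (1 - norm h) / 2) = norm h"
        by (simp flip: diff_divide_distrib)
      finally show ?thesis using V by (intro mult_left_mono) auto
    qed
    also have "\<dots> \<le> 2 ^ (DIM('a) + 1) * DIM('a) * V * norm h"
      using V by (simp add: mult_nonneg_nonneg)
    finally show ?thesis .
  next
    case False
    have "?I \<le> (\<integral>z. indicator (ball 0 1) (z + h) + indicator (ball 0 1) z \<partial>lborel)"
      by (intro integral_mono[OF int] Bochner_Integration.integrable_add lborel_integrable_translate integrable_ball_indicator)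
         (auto simp: indicator_def)
    also have "\<dots> = 2 * V"
      by (subst Bochner_Integration.integral_add)
         (auto intro: lborel_integrable_translate integrable_ball_indicator
           simp: V_def integral_ball_indicator_translate)
    also have "\<dots> \<le> 2 * (2 ^ DIM('a) * DIM('a)) * V * norm h"
    proof -
      have "1 \<le> DIM('a)" by (simp add: Suc_leI)
      then have "1 * 1 \<le> (2::real) ^ DIM('a) * real DIM('a)"
        by (intro mult_mono) (auto simp: one_le_power)
      then have "1 * 1 \<le> ((2::real) ^ DIM('a) * real DIM('a)) * norm h"
        using False by (intro mult_mono) auto
      then have "V * 1 \<le> V * (((2::real) ^ DIM('a) * real DIM('a)) * norm h)"
        using V by (intro mult_left_mono) auto
      then show ?thesis by (simp add: algebra_simps)
    qed
    finally show ?thesis by (simp add: algebra_simps)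
  qed
qed

text \<open>The profile is Lipschitz with bounded support.\<close>

lemma cap_shift:
  fixes h :: "'a::euclidean_space" and V :: real
  defines "V \<equiv> measure lborel (ball (0::'a) 1)"
  shows "(\<integral>z. \<bar>cap (z + h) - cap z\<bar> \<partial>lborel) \<le> 5 * 2 ^ DIM('a) * V * norm h"
    (is "?I \<le> _")
proof -
  have V: "0 \<le> V" by (simp add: V_def)
  have int: "integrable lborel (\<lambda>z::'a. \<bar>cap (z + h) - cap z\<bar>)"
    by (intro integrable_abs Bochner_Integration.integrable_diff lborel_integrable_translate integrable_cap)
  show ?thesis
  proof (cases "norm h \<le> 1")
    case True
    have "?I \<le> (\<integral>z. 5 * norm h * indicator (ball (0::'a) 2) z \<partial>lborel)"
    proof (rule integral_mono[OF int])
      fix z :: 'a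
      show "\<bar>cap (z + h) - cap z\<bar> \<le> 5 * norm h * indicator (ball 0 2) z"
      proof (cases "norm z < 2")
        case z: True
        have "\<bar>cap (z + h) - cap z\<bar> \<le> \<bar>(1 - (z+h) \<bullet> (z+h)) - (1 - z \<bullet> z)\<bar>"
          unfolding cap_def by (simp add: max_def)
        also have "\<dots> = \<bar>(2 *\<^sub>R z + h) \<bullet> h\<bar>" by (simp add: inner_simps inner_commute algebra_simps)
        also have "\<dots> \<le> norm (2 *\<^sub>R z + h) * norm h" by (rule Cauchy_Schwarz_ineq2)
        also have "\<dots> \<le> 5 * norm h"
          using z True norm_triangle_ineq[of "2 *\<^sub>R z" h] by (intro mult_right_mono) auto
        finally show ?thesis using z by simp
      next
        case False
        then have "1 \<le> norm z" "1 \<le> norm (z + h)"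
          using True norm_triangle_ineq[of "z+h" "-h"] by auto
        then show ?thesis using False by (simp add: cap_eq_0)
      qed
    qed (intro integrable_mult_right integrable_ball_indicator)
    also have "\<dots> = 5 * norm h * measure lborel (ball (0::'a) 2)"
      by simp
    also have "\<dots> = 5 * 2 ^ DIM('a) * V * norm h"
      by (subst measure_ball_scale) (auto simp: V_def)
    finally show ?thesis .
  next
    case False
    have "?I \<le> (\<integral>z. indicator (ball 0 1) (z + h) + indicator (ball 0 1) z \<partial>lborel)"
    proof (intro integral_mono[OF int] Bochner_Integration.integrable_add lborel_integrable_translate integrable_ball_indicator)
      fix z :: 'a
      show "\<bar>cap (z + h) - cap z\<bar> \<le> indicator (ball 0 1) (z + h) + indicator (ball 0 1) z"
        using cap_nonneg[of z] cap_nonneg[of "z+h"] cap_le_indicator[of z] cap_le_indicator[of "z+h"]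
        by linarith
    qed
    also have "\<dots> = 2 * V"
      by (subst Bochner_Integration.integral_add)
         (auto intro: lborel_integrable_translate integrable_ball_indicator
           simp: V_def integral_ball_indicator_translate)
    also have "\<dots> \<le> 5 * 2 ^ DIM('a) * V * norm h"
    proof -
      have "2 * 1 \<le> (5 * 2 ^ DIM('a)) * norm h"
      proof (rule mult_mono)
        have "1 \<le> (2::real) ^ DIM('a)" by (simp add: one_le_power)
        then show "2 \<le> 5 * (2::real) ^ DIM('a)" by linarith
      qed (use False in auto)
      then have "V * (2 * 1) \<le> V * ((5 * 2 ^ DIM('a)) * norm h)"
        using V by (intro mult_left_mono) auto
      then show ?thesis by (simp add: algebra_simps)
    qed
    finally show ?thesis .
  qed
qed

text \<open>The constant serves all functions and all radii at once; the factor \<open>1 / r\<close> is the one of a kernel that is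
dilated by \<open>r\<close>.\<close>

definition mean_lipschitz :: "'a::euclidean_space measure \<Rightarrow> real \<Rightarrow> bool" where
  "mean_lipschitz \<mu> C \<longleftrightarrow> 0 \<le> C \<and> (\<forall>f B r x y. f \<in> borel_measurable borel \<longrightarrow> (\<forall>x. \<bar>f x\<bar> \<le> B) \<longrightarrow> 0 < r \<longrightarrow>
     \<bar>smear \<mu> r f x - smear \<mu> r f y\<bar> \<le> B * C * norm (x - y) / r)"

lemma mean_lipschitz_nonneg: "mean_lipschitz \<mu> C \<Longrightarrow> 0 \<le> C"
  by (simp add: mean_lipschitz_def)

lemma mean_lipschitzD:
  assumes "mean_lipschitz \<mu> C" "f \<in> borel_measurable borel" "\<And>x. \<bar>f x\<bar> \<le> B" "0 < r"
  shows "\<bar>smear \<mu> r f x - smear \<mu> r f y\<bar> \<le> B * C * norm (x - y) / r"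
  using assms unfolding mean_lipschitz_def by blast

lemma mean_lipschitz_continuous:
  assumes C: "mean_lipschitz \<mu> C" and f: "bdd_borel f" and r: "0 < r"
  shows "continuous_on UNIV (smear \<mu> r f)"
proof -
  obtain B where B: "0 \<le> B" "\<And>x. \<bar>f x\<bar> \<le> B" using f by (metis bdd_borel_bound)
  have "(B * C / r)-lipschitz_on UNIV (smear \<mu> r f)"
    using mean_lipschitz_nonneg[OF C] B(1) r mean_lipschitzD[OF C bdd_borel_measurable[OF f] B(2) r]
    by (intro lipschitz_onI) (auto simp: dist_norm)
  then show ?thesis by (rule lipschitz_on_continuous_on)
qed

text \<open>Moving the base point by \<open>x - y\<close> is the same as shifting the kernel by \<open>(x - y) / t\<close>, so the difference is at
most the integral of the shifted difference of the kernel.\<close>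

lemma kernel_mean_lipschitz:
  fixes k f :: "'a::euclidean_space \<Rightarrow> real"
  assumes k: "integrable lborel k" and shift: "\<And>h. (\<integral>z. \<bar>k (z + h) - k z\<bar> \<partial>lborel) \<le> C * norm h"
    and f [measurable]: "f \<in> borel_measurable borel" and B: "\<And>x. \<bar>f x\<bar> \<le> B" and "0 < t"
  shows "\<bar>(\<integral>z. k z * f (x + t *\<^sub>R z) \<partial>lborel) - (\<integral>z. k z * f (y + t *\<^sub>R z) \<partial>lborel)\<bar> \<le> B * C * norm (x - y) / t"
proof -
  define h where "h = (x - y) /\<^sub>R t"
  have norm_h: "norm h = norm (x - y) / t"
    using \<open>0 < t\<close> by (simp add: h_def divide_inverse mult.commute)
  have [measurable]: "k \<in> borel_measurable borel" using k by auto
  have intf: "integrable lborel (\<lambda>z. g z * f (c + t *\<^sub>R z))" if g: "integrable lborel g" for g c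
  proof (rule integrable_mult_bdd[OF g])
    show "bdd_borel (\<lambda>z. f (c + t *\<^sub>R z))"
      by (rule bdd_borelI[OF _ B]) measurable
  qed
  have B0: "0 \<le> B" using order_trans[OF abs_ge_zero B] by blast
  have "(\<integral>z. k z * f (x + t *\<^sub>R z) \<partial>lborel) = (\<integral>z. k (z + (-h)) * f (y + t *\<^sub>R z) \<partial>lborel)"
    using lborel_integral_translate[of "\<lambda>z. k (z + (-h)) * f (y + t *\<^sub>R z)" h] \<open>0 < t\<close>
    by (simp add: h_def algebra_simps)
  then have "\<bar>(\<integral>z. k z * f (x + t *\<^sub>R z) \<partial>lborel) - (\<integral>z. k z * f (y + t *\<^sub>R z) \<partial>lborel)\<bar>
      = \<bar>\<integral>z. (k (z + (-h)) - k z) * f (y + t *\<^sub>R z) \<partial>lborel\<bar>"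
    by (simp only: left_diff_distrib,
        subst Bochner_Integration.integral_diff) (auto intro!: intf lborel_integrable_translate[of k "-h", simplified] k)
  also have "\<dots> \<le> (\<integral>z. \<bar>(k (z + (-h)) - k z) * f (y + t *\<^sub>R z)\<bar> \<partial>lborel)"
    by (rule integral_abs_bound)
  also have "\<dots> \<le> (\<integral>z. \<bar>k (z + (-h)) - k z\<bar> * B \<partial>lborel)"
  proof (rule integral_mono)
    show "\<bar>(k (z + (-h)) - k z) * f (y + t *\<^sub>R z)\<bar> \<le> \<bar>k (z + (-h)) - k z\<bar> * B" for z
      unfolding abs_mult by (intro mult_left_mono B) auto
  qed (intro integrable_abs integrable_mult_left intf Bochner_Integration.integrable_diff lborel_integrable_translate k)+
  also have "\<dots> = (\<integral>z. \<bar>k (z + (-h)) - k z\<bar> \<partial>lborel) * B" by simp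
  also have "\<dots> \<le> (C * norm (-h)) * B" by (intro mult_right_mono shift B0)
  also have "\<dots> = B * C * norm (x - y) / t" by (simp add: norm_h)
  finally show ?thesis .
qed

lemma smear_unif_lipschitz:
  obtains C where "mean_lipschitz (unif :: 'a::euclidean_space measure) C"
proof -
  define V where "V = measure lborel (ball (0::'a) 1)"
  have V: "0 < V" using unit_vol_pos[where 'a='a] by (simp add: V_def)
  show ?thesis
  proof (rule that[of "2 ^ (DIM('a) + 1) * DIM('a)"], unfold mean_lipschitz_def, intro conjI allI impI)
    fix f :: "'a \<Rightarrow> real" and B r x y
    assume f [measurable]: "f \<in> borel_measurable borel" and B': "\<forall>x. \<bar>f x\<bar> \<le> B" and r: "0 < (r::real)"
    then have B: "\<And>x. \<bar>f x\<bar> \<le> B" by blast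
    have "\<bar>smear unif r f x - smear unif r f y\<bar> = \<bar>(\<integral>z. indicator (ball 0 1) z * f (x + r *\<^sub>R z) \<partial>lborel)
        - (\<integral>z. indicator (ball 0 1) z * f (y + r *\<^sub>R z) \<partial>lborel)\<bar> / V"
      unfolding smear_def by (subst (1 2) integral_unif) (auto simp: V_def abs_mult simp flip: diff_divide_distrib)
    also have "\<dots> \<le> (B * (2 ^ (DIM('a) + 1) * DIM('a) * V) * norm (x - y) / r) / V"
      using kernel_mean_lipschitz[OF integrable_ball_indicator unit_indicator_shift f B r] V
      by (intro divide_right_mono) (auto simp: V_def)
    finally show "\<bar>smear unif r f x - smear unif r f y\<bar> \<le> B * (2 ^ (DIM('a) + 1) * DIM('a)) * norm (x - y) / r"
      using V by simp
  qed simp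
qed

section \<open>The companion average\<close>

definition unit_cylinder :: "(real \<times> 'a::euclidean_space) set" where
  "unit_cylinder = {0..1} \<times> cball 0 1"

text \<open>The integral of \<open>\<sigma>\<close> times the dilated profile over \<open>0 \<le> \<sigma> \<le> 1\<close> is, up to a constant
factor, the kernel that turns the Laplacian of a function into its ball average minus its value. As a law, it is the distribution of the point
\<open>\<sigma> z\<close> when the pair of \<open>\<sigma>\<close> and \<open>z\<close> has density proportional to this weight.\<close>

definition dome_weight :: "real \<times> 'a::euclidean_space \<Rightarrow> real" where
  "dome_weight p = indicator {0..1} (fst p) * fst p * cap (snd p)"

definition dome_mass :: "'a::euclidean_space itself \<Rightarrow> real" where
  "dome_mass _ = (\<integral>p. dome_weight (p :: real \<times> 'a) \<partial>lborel)"

definition dome :: "'a::euclidean_space measure" where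
  "dome = distr (density lborel (\<lambda>p. ennreal (dome_weight p / dome_mass TYPE('a)))) borel
     (\<lambda>p. fst p *\<^sub>R snd p)"

lemma compact_unit_cylinder: "compact unit_cylinder"
  unfolding unit_cylinder_def by (intro compact_Times) auto

lemma dome_weight_measurable [measurable]: "dome_weight \<in> borel_measurable borel"
  unfolding dome_weight_def[abs_def] borel_prod[symmetric] by measurable

lemma dome_weight_nonneg: "0 \<le> dome_weight p"
  by (auto simp: dome_weight_def indicator_def cap_nonneg)

lemma dome_weight_unit_cylinder: "dome_weight p = indicator unit_cylinder p * (fst p * (1 - snd p \<bullet> snd p))"
proof (cases "norm (snd p) \<le> 1")
  case True
  then have "snd p \<bullet> snd p \<le> 1" by (simp add: power2_norm_eq_inner[symmetric] power_le_one)
  then show ?thesis using True by (cases p) (auto simp: dome_weight_def unit_cylinder_def cap_def indicator_def)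
next
  case False
  then show ?thesis by (cases p) (auto simp: dome_weight_def unit_cylinder_def indicator_def cap_eq_0)
qed

lemma dome_weight_le: "dome_weight p \<le> indicator unit_cylinder p"
  by (cases p) (auto simp: dome_weight_def unit_cylinder_def indicator_def cap_le_1 cap_eq_0 mult_le_one cap_nonneg)

lemma integrable_unit_cylinder:
  "continuous_on unit_cylinder f \<Longrightarrow> integrable lborel (\<lambda>p. indicator unit_cylinder p * (f p :: real))"
  using borel_integrable_compact[OF compact_unit_cylinder, of f] by simp

lemma integrable_dome_weight: "integrable lborel (dome_weight :: real \<times> 'a::euclidean_space \<Rightarrow> real)"
proof -
  have "integrable lborel (\<lambda>p :: real \<times> 'a. indicator unit_cylinder p * (fst p * (1 - snd p \<bullet> snd p)))"
    by (intro integrable_unit_cylinder continuous_intros)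
  then show ?thesis by (simp add: dome_weight_unit_cylinder[abs_def])
qed

lemma dome_mass_pos: "0 < dome_mass TYPE('a::euclidean_space)"
proof -
  have "dome_mass TYPE('a) \<noteq> 0"
  proof
    assume "dome_mass TYPE('a) = 0"
    then have "AE p in lborel. dome_weight (p :: real \<times> 'a) = 0"
      unfolding dome_mass_def
      by (subst (asm) integral_nonneg_eq_0_iff_AE) (auto simp: dome_weight_nonneg integrable_dome_weight)
    then have "AE p in lborel. p \<notin> {0<..<1::real} \<times> ball (0::'a) 1"
    proof eventually_elim
      case (elim p)
      show ?case
      proof
        assume "p \<in> {0<..<1::real} \<times> ball (0::'a) 1"
        then have "norm (snd p) < 1" "0 < fst p" "fst p < 1" by (auto simp: mem_Times_iff)
        moreover from this have "snd p \<bullet> snd p < 1"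
          by (simp add: power2_norm_eq_inner[symmetric] power_less_one_iff)
        ultimately show False using elim by (simp add: dome_weight_def cap_def indicator_def)
      qed
    qed
    then have "{0<..<1::real} \<times> ball (0::'a) 1 \<in> null_sets lborel"
      by (subst (asm) AE_iff_null_sets[symmetric]) (auto simp: borel_open open_Times)
    then have "negligible ({0<..<1::real} \<times> ball (0::'a) 1)"
      using negligible_iff_null_sets null_sets_completionI by blast
    moreover have "open ({0<..<1::real} \<times> ball (0::'a) 1)" by (intro open_Times) auto
    moreover have "(1/2, 0) \<in> {0<..<1::real} \<times> ball (0::'a) 1" by auto
    ultimately show False using open_not_negligible by blast
  qed
  moreover have "0 \<le> dome_mass TYPE('a)"
    unfolding dome_mass_def by (intro integral_nonneg_AE AE_I2 dome_weight_nonneg)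
  ultimately show ?thesis by simp
qed

lemma dome_point_measurable [measurable]:
  "(\<lambda>p. fst p *\<^sub>R snd p) \<in> borel_measurable (borel :: (real \<times> 'a::euclidean_space) measure)"
  by (intro borel_measurable_continuous_onI continuous_intros)

lemma ball_law_dome: "ball_law (dome :: 'a::euclidean_space measure)"
proof -
  let ?D = "density lborel (\<lambda>p::real \<times> 'a. ennreal (dome_weight p / dome_mass TYPE('a)))"
  have one: "emeasure ?D UNIV = 1"
  proof -
    have "emeasure ?D UNIV = (\<integral>\<^sup>+p. ennreal (dome_weight (p :: real \<times> 'a) / dome_mass TYPE('a)) \<partial>lborel)"
      by (simp add: emeasure_density)
    also have "\<dots> = ennreal (\<integral>p. dome_weight (p :: real \<times> 'a) / dome_mass TYPE('a) \<partial>lborel)"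
      using dome_mass_pos[where 'a='a]
      by (intro nn_integral_eq_integral) (auto simp: integrable_dome_weight dome_weight_nonneg)
    also have "(\<integral>p. dome_weight (p :: real \<times> 'a) / dome_mass TYPE('a) \<partial>lborel) = 1"
      using dome_mass_pos[where 'a='a] by (simp add: dome_mass_def)
    finally show ?thesis by simp
  qed
  have em: "emeasure (dome::'a measure) UNIV = 1"
    unfolding dome_def by (subst emeasure_distr) (auto simp: one)
  interpret finite_measure "dome :: 'a measure"
    by (rule finite_measureI) (use em in \<open>simp add: dome_def\<close>)
  show ?thesis
  proof
    show "sets (dome::'a measure) = sets borel" by (simp add: dome_def)
    show "measure (dome::'a measure) UNIV = 1" using em by (simp add: measure_def)
    have "AE p in lborel. 0 < ennreal (dome_weight p / dome_mass TYPE('a)) \<longrightarrow> norm (fst p *\<^sub>R (snd p :: 'a)) \<le> 1"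
    proof (rule AE_I2, rule impI)
      fix p :: "real \<times> 'a"
      assume "0 < ennreal (dome_weight p / dome_mass TYPE('a))"
      then have "0 < dome_weight p" using dome_mass_pos[where 'a='a] by (simp add: zero_less_divide_iff)
      then have "p \<in> unit_cylinder" using dome_weight_le[of p] by (cases "p \<in> unit_cylinder") auto
      then show "norm (fst p *\<^sub>R snd p) \<le> 1" by (cases p) (auto simp: unit_cylinder_def mult_le_one)
    qed
    then show "AE y in dome. norm (y::'a) \<le> 1"
      unfolding dome_def by (subst AE_distr_iff) (auto simp: AE_density)
  qed
qed

interpretation dome: ball_law "dome :: 'a::euclidean_space measure"
  by (rule ball_law_dome)

lemma integral_dome:
  fixes f :: "'a::euclidean_space \<Rightarrow> real"
  assumes [measurable]: "f \<in> borel_measurable borel"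
  shows "(\<integral>y. f y \<partial>dome) = (\<integral>p. dome_weight p * f (fst p *\<^sub>R snd p) \<partial>lborel) / dome_mass TYPE('a)"
proof -
  have "(\<integral>y. f y \<partial>dome) = (\<integral>p. (dome_weight p / dome_mass TYPE('a)) * f (fst p *\<^sub>R snd p) \<partial>lborel)"
    unfolding dome_def using dome_mass_pos[where 'a='a]
    by (subst integral_distr, simp, simp, subst integral_density) (auto simp: dome_weight_nonneg)
  then show ?thesis by simp
qed

definition cap_mean :: "('a::euclidean_space \<Rightarrow> real) \<Rightarrow> 'a \<Rightarrow> real \<Rightarrow> real" where
  "cap_mean f x t = (\<integral>z. cap z * f (x + t *\<^sub>R z) \<partial>lborel)"

lemma smear_dome:
  fixes f :: "'a::euclidean_space \<Rightarrow> real"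
  assumes f: "bdd_borel f"
  shows "smear dome r f x = (\<integral>\<sigma>. indicator {0..1} \<sigma> * (\<sigma> * cap_mean f x (r * \<sigma>)) \<partial>lborel) / dome_mass TYPE('a)"
    and "integrable lborel (\<lambda>\<sigma>. indicator {0..1} \<sigma> * (\<sigma> * cap_mean f x (r * \<sigma>)))"
proof -
  have [measurable]: "f \<in> borel_measurable borel" using f by (rule bdd_borel_measurable)
  obtain C where C: "\<And>x. \<bar>f x\<bar> \<le> C" using f by (metis bdd_borel_bound)
  have "bdd_borel (\<lambda>p. f (x + (r * fst p) *\<^sub>R snd p))"
  proof (rule bdd_borelI[OF _ C])
    have [measurable]: "(\<lambda>p :: real \<times> 'a. x + (r * fst p) *\<^sub>R snd p) \<in> borel_measurable borel"
      by (intro borel_measurable_continuous_onI continuous_intros)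
    show "(\<lambda>p. f (x + (r * fst p) *\<^sub>R snd p)) \<in> borel_measurable borel" by measurable
  qed
  then have int: "integrable lborel (\<lambda>p. dome_weight p * f (x + (r * fst p) *\<^sub>R snd p))"
    by (rule integrable_mult_bdd[OF integrable_dome_weight])
  then have int': "integrable (lborel \<Otimes>\<^sub>M lborel) (\<lambda>p. dome_weight p * f (x + (r * fst p) *\<^sub>R snd p))"
    by (simp add: lborel_prod)
  have inner: "(\<integral>z. dome_weight (\<sigma>, z) * f (x + (r * \<sigma>) *\<^sub>R z) \<partial>lborel)
      = indicator {0..1} \<sigma> * (\<sigma> * cap_mean f x (r * \<sigma>))" for \<sigma>
    by (simp add: dome_weight_def cap_mean_def mult.assoc)
  have "smear dome r f x = (\<integral>p. dome_weight p * f (x + (r * fst p) *\<^sub>R snd p) \<partial>lborel) / dome_mass TYPE('a)"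
    unfolding smear_def by (subst integral_dome) auto
  also have "(\<integral>p. dome_weight p * f (x + (r * fst p) *\<^sub>R snd p) \<partial>lborel)
      = (\<integral>\<sigma>. indicator {0..1} \<sigma> * (\<sigma> * cap_mean f x (r * \<sigma>)) \<partial>lborel)"
    using lborel_pair.integral_fst'[OF int'] by (simp add: inner lborel_prod)
  finally show "smear dome r f x = (\<integral>\<sigma>. indicator {0..1} \<sigma> * (\<sigma> * cap_mean f x (r * \<sigma>)) \<partial>lborel) / dome_mass TYPE('a)" .
  show "integrable lborel (\<lambda>\<sigma>. indicator {0..1} \<sigma> * (\<sigma> * cap_mean f x (r * \<sigma>)))"
    using lborel_pair.integrable_fst'[OF int'] by (simp add: inner)
qed

lemma smear_dome_lipschitz:
  obtains C where "mean_lipschitz (dome :: 'a::euclidean_space measure) C"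
proof -
  define K where "K = 5 * 2 ^ DIM('a) * measure lborel (ball (0::'a) 1)"
  define m where "m = dome_mass TYPE('a)"
  have m: "0 < m" unfolding m_def by (rule dome_mass_pos)
  show ?thesis
  proof (rule that[of "K / m"], unfold mean_lipschitz_def, intro conjI allI impI)
    show "0 \<le> K / m" using m by (simp add: K_def)
    fix f :: "'a \<Rightarrow> real" and B r x y
    assume f: "f \<in> borel_measurable borel" and B': "\<forall>x. \<bar>f x\<bar> \<le> B" and r: "0 < (r::real)"
    then have B: "\<And>x. \<bar>f x\<bar> \<le> B" by blast
    have bf: "bdd_borel f" using f B by (rule bdd_borelI)
    have lip: "\<bar>cap_mean f x t - cap_mean f y t\<bar> \<le> B * K * norm (x - y) / t" if "0 < t" for t
      unfolding cap_mean_def K_def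
      using kernel_mean_lipschitz[OF integrable_cap cap_shift f B that] .
    let ?g = "\<lambda>x \<sigma>. indicator {0..1} \<sigma> * (\<sigma> * cap_mean f x (r * \<sigma>))"
    have "\<bar>smear dome r f x - smear dome r f y\<bar> = \<bar>(\<integral>\<sigma>. ?g x \<sigma> - ?g y \<sigma> \<partial>lborel)\<bar> / m"
      using m by (simp add: smear_dome[OF bf] m_def[symmetric] flip: diff_divide_distrib)
    also have "\<dots> \<le> (\<integral>\<sigma>. \<bar>?g x \<sigma> - ?g y \<sigma>\<bar> \<partial>lborel) / m"
      using m by (intro divide_right_mono integral_abs_bound) auto
    also have "\<dots> \<le> (\<integral>\<sigma>. indicator {0..1::real} \<sigma> * (B * K * norm (x - y) / r) \<partial>lborel) / m"
    proof (intro divide_right_mono integral_mono)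
      show "integrable lborel (\<lambda>\<sigma>. \<bar>?g x \<sigma> - ?g y \<sigma>\<bar>)"
        by (intro integrable_abs Bochner_Integration.integrable_diff smear_dome(2)[OF bf])
      show "integrable lborel (\<lambda>\<sigma>::real. indicator {0..1} \<sigma> * (B * K * norm (x - y) / r))"
        by (intro integrable_mult_left) simp
      fix \<sigma> :: real
      show "\<bar>?g x \<sigma> - ?g y \<sigma>\<bar> \<le> indicator {0..1} \<sigma> * (B * K * norm (x - y) / r)"
      proof (cases "0 < \<sigma> \<and> \<sigma> \<le> 1")
        case True
        then have "\<sigma> * \<bar>cap_mean f x (r * \<sigma>) - cap_mean f y (r * \<sigma>)\<bar> \<le> \<sigma> * (B * K * norm (x - y) / (r * \<sigma>))"
          using r by (intro mult_left_mono lip) auto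
        then show ?thesis using True
          by (simp add: indicator_def abs_mult flip: right_diff_distrib)
      next
        case False
        moreover have "0 \<le> B" using B[of x] by linarith
        ultimately show ?thesis using r m by (auto simp: indicator_def K_def)
      qed
    qed (use m in auto)
    also have "\<dots> = B * (K / m) * norm (x - y) / r" by simp
    finally show "\<bar>smear dome r f x - smear dome r f y\<bar> \<le> B * (K / m) * norm (x - y) / r" .
  qed
qed

text \<open>The substitution \<open>\<tau> = s \<sigma>\<close> writes \<open>s\<^sup>2 * smear dome s f x\<close> as the integral of one nonnegative
function of \<open>\<tau>\<close> over the interval from \<open>0\<close> to \<open>s\<close>.\<close>

lemma smear_dome_monotone:
  fixes f :: "'a::euclidean_space \<Rightarrow> real"
  assumes f: "bdd_borel f" and nonneg: "\<And>x. 0 \<le> f x" and "0 < s" "s \<le> R"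
  shows "s\<^sup>2 * smear dome s f x \<le> R\<^sup>2 * smear dome R f x"
proof -
  define m where "m = dome_mass TYPE('a)"
  have m: "0 < m" unfolding m_def by (rule dome_mass_pos)
  have [measurable]: "f \<in> borel_measurable borel" using f by (rule bdd_borel_measurable)
  have Jm [measurable]: "cap_mean f x \<in> borel_measurable borel"
  proof -
    have [measurable]: "(\<lambda>p. x + fst p *\<^sub>R snd p) \<in> borel_measurable (borel :: (real \<times> 'a) measure)"
      by (intro borel_measurable_continuous_onI continuous_intros)
    have "(\<lambda>p. f (x + fst p *\<^sub>R snd p)) \<in> borel_measurable (borel \<Otimes>\<^sub>M borel)"
      by (simp add: borel_prod)
    then have "(\<lambda>p. cap (snd p) * f (x + fst p *\<^sub>R snd p)) \<in> borel_measurable (borel \<Otimes>\<^sub>M borel)"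
      by measurable
    then show ?thesis
      unfolding cap_mean_def[abs_def]
      by (intro lborel.borel_measurable_lebesgue_integral) (simp add: split_beta' cong: measurable_cong_sets)
  qed
  have J0: "0 \<le> cap_mean f x t" for t
    unfolding cap_mean_def by (intro integral_nonneg_AE AE_I2 mult_nonneg_nonneg cap_nonneg nonneg)
  let ?h = "\<lambda>T \<tau>. indicator {0..T} \<tau> * (\<tau> * cap_mean f x \<tau>)"
  have scale: "?h T (0 + T * \<sigma>) = T * (indicator {0..1} \<sigma> * (\<sigma> * cap_mean f x (T * \<sigma>)))" if "0 < T" for T \<sigma>
    using that by (auto simp: indicator_def zero_le_mult_iff mult_le_cancel_left1)
  have eq: "T\<^sup>2 * smear dome T f x = (\<integral>\<tau>. ?h T \<tau> \<partial>lborel) / m" if "0 < T" for T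
    using lborel_integral_real_affine[of T "?h T" 0] that
    by (simp only: scale[OF that] smear_dome[OF f] m_def) (simp add: power2_eq_square)
  have int: "integrable lborel (?h T)" if "0 < T" for T
    using lborel_integrable_real_affine_iff[of T "?h T" 0] that smear_dome(2)[OF f, of x T]
    by (simp only: scale[OF that]) simp
  have "(\<integral>\<tau>. ?h s \<tau> \<partial>lborel) \<le> (\<integral>\<tau>. ?h R \<tau> \<partial>lborel)"
    using assms(3,4) by (intro integral_mono int) (auto simp: indicator_def J0)
  then show ?thesis
    using eq[of s] eq[of R] assms(3,4) m by (simp add: divide_right_mono)
qed

section \<open>Exponentials as common eigenfunctions\<close>

lemma cball_borel [measurable]: "cball x r \<in> sets borel"
  by simp

lemma AE_not_unit_sphere: "AE z in lborel. norm (z::'a::euclidean_space) \<noteq> 1"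
proof -
  have "sphere (0::'a) 1 \<in> null_sets lborel"
    using negligible_sphere[of "0::'a" 1]
    by (auto simp: null_sets_completion_iff negligible_iff_null_sets)
  from AE_not_in[OF this] show ?thesis by simp
qed

definition cap_exp :: "'a::euclidean_space \<Rightarrow> real \<Rightarrow> 'a \<Rightarrow> real" where
  "cap_exp \<xi> t z = (1 - z \<bullet> z) * exp (t * (\<xi> \<bullet> z))"

text \<open>The derivative of \<open>cap_exp \<xi> t\<close> in the direction \<open>\<xi>\<close>.\<close>

definition cap_exp_deriv :: "'a::euclidean_space \<Rightarrow> real \<Rightarrow> 'a \<Rightarrow> real" where
  "cap_exp_deriv \<xi> t z = (t * (\<xi> \<bullet> \<xi>) * (1 - z \<bullet> z) - 2 * (\<xi> \<bullet> z)) * exp (t * (\<xi> \<bullet> z))"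

lemma cap_exp_has_deriv:
  "((\<lambda>\<tau>. cap_exp \<xi> t (z + \<tau> *\<^sub>R \<xi>)) has_real_derivative cap_exp_deriv \<xi> t (z + \<tau> *\<^sub>R \<xi>)) (at \<tau>)"
proof -
  have eq: "cap_exp \<xi> t (z + \<tau> *\<^sub>R \<xi>)
      = (1 - (z \<bullet> z + 2 * \<tau> * (\<xi> \<bullet> z) + \<tau>\<^sup>2 * (\<xi> \<bullet> \<xi>))) * exp (t * (\<xi> \<bullet> z + \<tau> * (\<xi> \<bullet> \<xi>)))" for \<tau>
    by (simp add: cap_exp_def inner_simps inner_commute[of z \<xi>] power2_eq_square algebra_simps)
  show ?thesis
    unfolding eq
    by (auto intro!: derivative_eq_intros
        simp: cap_exp_deriv_def inner_simps inner_commute[of z \<xi>] power2_eq_square algebra_simps)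
qed

text \<open>This is the divergence theorem on the unit ball for the field \<open>cap_exp \<xi> t z *\<^sub>R \<xi>\<close>, which vanishes
on the sphere. Because it vanishes there, its positive part \<open>F\<close> extends by zero to a compactly supported function
on the whole space. Translations preserve the integral of \<open>F\<close>, so the difference quotients of \<open>F\<close> in the
direction \<open>\<xi>\<close> have integral zero, and they converge boundedly to the derivative off the sphere.\<close>

lemma cap_exp_deriv_integral:
  fixes \<xi> :: "'a::euclidean_space"
  shows "(\<integral>z. indicator (cball 0 1) z * cap_exp_deriv \<xi> t z \<partial>lborel) = 0"
proof -
  \<comment> \<open>The positive part of \<open>cap_exp \<xi> t\<close>, in the form that is manifestly measurable.\<close>
  define F where "F z = cap z * exp (t * (\<xi> \<bullet> z))" for z
  have F_max: "F z = max 0 (cap_exp \<xi> t z)" for z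
    by (auto simp: F_def cap_exp_def cap_def max_def zero_le_mult_iff mult_le_0_iff)
  have [measurable]: "F \<in> borel_measurable borel"
    unfolding F_def[abs_def] by measurable
  define S where "S = cball (0::'a) (1 + norm \<xi>)"
  have cont: "continuous_on A (cap_exp_deriv \<xi> t)" for A
    unfolding cap_exp_deriv_def[abs_def] by (intro continuous_intros)
  have "bounded (cap_exp_deriv \<xi> t ` cball 0 (1 + 2 * norm \<xi>))"
    by (intro compact_imp_bounded compact_continuous_image cont compact_cball)
  then obtain K where "\<forall>z\<in>cball 0 (1 + 2 * norm \<xi>). \<bar>cap_exp_deriv \<xi> t z\<bar> \<le> K"
    unfolding bounded_iff by auto
  then have K: "\<bar>cap_exp_deriv \<xi> t z\<bar> \<le> K" if "norm z \<le> 1 + 2 * norm \<xi>" for z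
    using that by (simp add: dist_norm)
  have K0: "0 \<le> K" using K[of 0] by (smt (verit) norm_zero norm_ge_zero)
  define G where "G n z = real (Suc n) * (F (z + (1 / real (Suc n)) *\<^sub>R \<xi>) - F z)" for n z
  have [measurable]: "G n \<in> borel_measurable borel" for n
    unfolding G_def[abs_def] by measurable
  have bound: "\<bar>G n z\<bar> \<le> K * indicator S z" for n z
  proof (cases "norm z \<le> 1 + norm \<xi>")
    case True
    define \<eta> where "\<eta> = 1 / real (Suc n)"
    have eta: "0 < \<eta>" "\<eta> \<le> 1" by (auto simp: \<eta>_def)
    obtain \<tau> where tau: "0 < \<tau>" "\<tau> < \<eta>"
      "cap_exp \<xi> t (z + \<eta> *\<^sub>R \<xi>) - cap_exp \<xi> t (z + 0 *\<^sub>R \<xi>) = (\<eta> - 0) * cap_exp_deriv \<xi> t (z + \<tau> *\<^sub>R \<xi>)"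
      using MVT2[of 0 \<eta> "\<lambda>\<tau>. cap_exp \<xi> t (z + \<tau> *\<^sub>R \<xi>)" "\<lambda>\<tau>. cap_exp_deriv \<xi> t (z + \<tau> *\<^sub>R \<xi>)"]
        eta cap_exp_has_deriv by blast
    have "norm (\<tau> *\<^sub>R \<xi>) \<le> norm \<xi>" using tau eta by (simp add: mult_left_le_one_le)
    then have "norm (z + \<tau> *\<^sub>R \<xi>) \<le> 1 + 2 * norm \<xi>"
      using True norm_triangle_ineq[of z "\<tau> *\<^sub>R \<xi>"] by linarith
    then have "\<bar>cap_exp \<xi> t (z + \<eta> *\<^sub>R \<xi>) - cap_exp \<xi> t z\<bar> \<le> \<eta> * K"
      using tau eta K by (simp add: abs_mult mult_left_mono)
    then have "\<bar>F (z + \<eta> *\<^sub>R \<xi>) - F z\<bar> \<le> \<eta> * K"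
      unfolding F_max by (auto simp: max_def)
    then have "real (Suc n) * \<bar>F (z + \<eta> *\<^sub>R \<xi>) - F z\<bar> \<le> real (Suc n) * (\<eta> * K)"
      by (intro mult_left_mono) auto
    then show ?thesis using True by (simp add: G_def \<eta>_def S_def abs_mult)
  next
    case False
    have "norm ((1 / real (Suc n)) *\<^sub>R \<xi>) \<le> norm \<xi>"
      using mult_left_le_one_le[of "norm \<xi>" "1 / real (Suc n)"] by (simp del: of_nat_Suc)
    then have "1 \<le> norm (z + (1 / real (Suc n)) *\<^sub>R \<xi>)"
      using False norm_triangle_ineq[of "z + (1 / real (Suc n)) *\<^sub>R \<xi>" "- ((1 / real (Suc n)) *\<^sub>R \<xi>)"] by auto
    moreover have "1 \<le> norm z" using False norm_ge_zero[of \<xi>] by linarith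
    ultimately show ?thesis using False by (simp add: G_def F_def cap_eq_0 S_def)
  qed
  have int_F: "integrable lborel F"
  proof -
    have "integrable lborel (\<lambda>z::'a. indicator (cball 0 1) z *\<^sub>R cap_exp \<xi> t z)"
      unfolding cap_exp_def by (intro borel_integrable_compact continuous_intros) auto
    moreover have "indicator (cball 0 1) z *\<^sub>R cap_exp \<xi> t z = F z" for z
    proof (cases "norm z \<le> 1")
      case True
      then have "z \<bullet> z \<le> 1" by (simp add: power2_norm_eq_inner[symmetric] power_le_one)
      then show ?thesis using True by (simp add: F_def cap_exp_def cap_def)
    qed (simp add: F_def cap_eq_0)
    ultimately show ?thesis by simp
  qed
  have zero: "(\<integral>z. G n z \<partial>lborel) = 0" for n
    unfolding G_def
    by (simp add: Bochner_Integration.integral_diff lborel_integrable_translate int_F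
        lborel_integral_translate)
  have lim: "(\<lambda>n. \<integral>z. G n z \<partial>lborel) \<longlonglongrightarrow> (\<integral>z. indicator (cball 0 1) z * cap_exp_deriv \<xi> t z \<partial>lborel)"
  proof (rule integral_dominated_convergence[where w="\<lambda>z. K * indicator S z"])
    have [measurable]: "cap_exp_deriv \<xi> t \<in> borel_measurable borel"
      by (intro borel_measurable_continuous_onI cont)
    show "(\<lambda>z. indicator (cball 0 1) z * cap_exp_deriv \<xi> t z) \<in> borel_measurable lborel"
      by measurable
    show "integrable lborel (\<lambda>z. K * indicator S z)"
      unfolding S_def using emeasure_lborel_cball_finite[of "0::'a" "1 + norm \<xi>"]
      by (intro integrable_mult_right integrable_real_indicator) auto
    show "AE z in lborel. norm (G n z) \<le> K * indicator S z" for n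
      using bound by simp
    show "AE z in lborel. (\<lambda>n. G n z) \<longlonglongrightarrow> indicator (cball 0 1) z * cap_exp_deriv \<xi> t z"
      using AE_not_unit_sphere
    proof eventually_elim
      case (elim z)
      have to0: "(\<lambda>n. 1 / real (Suc n)) \<longlonglongrightarrow> 0"
        using LIMSEQ_inverse_real_of_nat by (simp add: inverse_eq_divide)
      have conv: "(\<lambda>n. z + (1 / real (Suc n)) *\<^sub>R \<xi>) \<longlonglongrightarrow> z + 0 *\<^sub>R \<xi>"
        by (intro tendsto_intros to0)
      show ?case
      proof (cases "norm z < 1")
        case True
        have "\<forall>\<^sub>F n in sequentially. z + (1 / real (Suc n)) *\<^sub>R \<xi> \<in> ball 0 1"
          using conv True by (intro topological_tendstoD[OF conv]) auto
        then have ev: "\<forall>\<^sub>F n in sequentially. (cap_exp \<xi> t (z + (0 + 1 / real (Suc n)) *\<^sub>R \<xi>) - cap_exp \<xi> t (z + 0 *\<^sub>R \<xi>)) / (1 / real (Suc n)) = G n z"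
        proof eventually_elim
          case (elim n)
          have pos: "F y = cap_exp \<xi> t y" if "norm y < 1" for y
          proof -
            have "y \<bullet> y < 1" using that by (simp add: power2_norm_eq_inner[symmetric] power_less_one_iff)
            then show ?thesis by (simp add: F_def cap_def cap_exp_def)
          qed
          show ?case using elim True by (simp add: G_def pos)
        qed
        have "((\<lambda>h. (cap_exp \<xi> t (z + (0 + h) *\<^sub>R \<xi>) - cap_exp \<xi> t (z + 0 *\<^sub>R \<xi>)) / h) \<longlongrightarrow> cap_exp_deriv \<xi> t (z + 0 *\<^sub>R \<xi>)) (at 0)"
          using cap_exp_has_deriv[of \<xi> t z 0] unfolding DERIV_def .
        moreover have "filterlim (\<lambda>n. 1 / real (Suc n)) (at 0) sequentially"
          using to0 by (intro filterlim_atI) auto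
        ultimately have "(\<lambda>n. (cap_exp \<xi> t (z + (0 + 1 / real (Suc n)) *\<^sub>R \<xi>) - cap_exp \<xi> t (z + 0 *\<^sub>R \<xi>)) / (1 / real (Suc n))) \<longlonglongrightarrow> cap_exp_deriv \<xi> t (z + 0 *\<^sub>R \<xi>)"
          by (rule filterlim_compose)
        then have "(\<lambda>n. G n z) \<longlonglongrightarrow> cap_exp_deriv \<xi> t (z + 0 *\<^sub>R \<xi>)"
          by (rule Lim_transform_eventually[OF _ ev])
        then show ?thesis using True by simp
      next
        case False
        with elim have "norm z > 1" by simp
        have "\<forall>\<^sub>F n in sequentially. z + (1 / real (Suc n)) *\<^sub>R \<xi> \<in> - cball 0 1"
          using conv \<open>norm z > 1\<close> by (intro topological_tendstoD[OF conv]) auto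
        then have "\<forall>\<^sub>F n in sequentially. 0 = G n z"
          by eventually_elim (use \<open>norm z > 1\<close> in \<open>auto simp: G_def F_def cap_eq_0\<close>)
        then have "(\<lambda>n. G n z) \<longlonglongrightarrow> 0"
          by (rule Lim_transform_eventually[OF tendsto_const])
        then show ?thesis using \<open>norm z > 1\<close> by simp
      qed
    qed
    show "G n \<in> borel_measurable lborel" for n by measurable
  qed
  show ?thesis
    using lim unfolding zero LIMSEQ_const_iff by (rule sym)
qed

text \<open>Exponentials are eigenfunctions of every translation invariant average, and this is the relation between
their eigenvalues for the two laws. What matters is that the factor in front of \<open>r\<^sup>2\<close> does not depend on \<open>r\<close>;
it is a multiple of \<open>\<xi> \<bullet> \<xi>\<close>, the eigenvalue of the Laplacian. To see it, write
\<open>exp (r * (\<xi> \<bullet> z)) - 1\<close> as an integral over \<open>\<sigma>\<close> from \<open>0\<close> to \<open>1\<close>, exchange the integrals, and for each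
\<open>\<sigma>\<close> trade the linear factor \<open>\<xi> \<bullet> z\<close> for the profile \<open>1 - z \<bullet> z\<close> by the divergence identity.\<close>

lemma exp_eigenvalues:
  fixes \<xi> :: "'a::euclidean_space"
  shows "(\<integral>y. exp (r * (\<xi> \<bullet> y)) \<partial>unif) - 1
    = (dome_mass TYPE('a) / (2 * measure lborel (ball (0::'a) 1)) * (\<xi> \<bullet> \<xi>)) * r\<^sup>2 * (\<integral>y. exp (r * (\<xi> \<bullet> y)) \<partial>dome)"
proof -
  define V where "V = measure lborel (ball (0::'a) 1)"
  have V: "0 < V" unfolding V_def by (rule unit_vol_pos)
  have half: "I = A / 2 * J" if "2 * I = A * J" for I J A :: real
    using that by simp
  have regroup: "i * r * (r * s * c / 2 * J) = i * (r\<^sup>2 * s * c / 2) * J" for i s c J :: real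
    by (simp add: power2_eq_square)
  have solve: "a = (m / (2 * v) * c) * q * b" if "0 < v" "v * a = q * c / 2 * (m * b)" for v a q c m b :: real
    using that by (simp add: field_simps)
  let ?B = "indicator (cball (0::'a) 1) :: 'a \<Rightarrow> real"
  let ?H = "\<lambda>p::real \<times> 'a. indicator unit_cylinder p * ((r * (\<xi> \<bullet> snd p)) * exp (r * fst p * (\<xi> \<bullet> snd p)))"
  let ?G = "\<lambda>p::real \<times> 'a. indicator unit_cylinder p * (r\<^sup>2 * (\<xi> \<bullet> \<xi>) / 2 * (fst p * (1 - snd p \<bullet> snd p)) * exp (r * fst p * (\<xi> \<bullet> snd p)))"
  have iH: "integrable (lborel \<Otimes>\<^sub>M lborel) ?H" and iG: "integrable (lborel \<Otimes>\<^sub>M lborel) ?G"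
    unfolding lborel_prod by (intro integrable_unit_cylinder continuous_intros)+
  have ind: "indicator unit_cylinder (\<sigma>, z) = indicator {0..1} \<sigma> * ?B z" for \<sigma> z
    by (simp add: unit_cylinder_def indicator_times)
  have "(\<integral>p. ?H p \<partial>(lborel \<Otimes>\<^sub>M lborel)) = (\<integral>p. ?G p \<partial>(lborel \<Otimes>\<^sub>M lborel))"
  proof -
    have "(\<integral>z. ?H (\<sigma>, z) \<partial>lborel) = (\<integral>z. ?G (\<sigma>, z) \<partial>lborel)" for \<sigma>
    proof -
      let ?e = "\<lambda>z. exp (r * \<sigma> * (\<xi> \<bullet> z))"
      have i1: "integrable lborel (\<lambda>z. ?B z * ((\<xi> \<bullet> z) * ?e z))"
        and i2: "integrable lborel (\<lambda>z. ?B z * ((1 - z \<bullet> z) * ?e z))"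
        using borel_integrable_compact[OF compact_cball, of "0::'a" 1 "\<lambda>z. (\<xi> \<bullet> z) * ?e z"]
          borel_integrable_compact[OF compact_cball, of "0::'a" 1 "\<lambda>z. (1 - z \<bullet> z) * ?e z"]
        by (simp_all add: continuous_intros)
      have "0 = (\<integral>z. ?B z * cap_exp_deriv \<xi> (r * \<sigma>) z \<partial>lborel)"
        by (simp add: cap_exp_deriv_integral)
      also have "\<dots> = (\<integral>z. (r * \<sigma>) * (\<xi> \<bullet> \<xi>) * (?B z * ((1 - z \<bullet> z) * ?e z)) - 2 * (?B z * ((\<xi> \<bullet> z) * ?e z)) \<partial>lborel)"
        by (intro Bochner_Integration.integral_cong) (auto simp: cap_exp_deriv_def algebra_simps)
      also have "\<dots> = (r * \<sigma>) * (\<xi> \<bullet> \<xi>) * (\<integral>z. ?B z * ((1 - z \<bullet> z) * ?e z) \<partial>lborel) - 2 * (\<integral>z. ?B z * ((\<xi> \<bullet> z) * ?e z) \<partial>lborel)"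
        by (subst Bochner_Integration.integral_diff) (use i1 i2 in auto)
      finally have key: "(\<integral>z. ?B z * ((\<xi> \<bullet> z) * ?e z) \<partial>lborel) = (r * \<sigma>) * (\<xi> \<bullet> \<xi>) / 2 * (\<integral>z. ?B z * ((1 - z \<bullet> z) * ?e z) \<partial>lborel)"
        by (intro half) simp
      have "(\<integral>z. ?H (\<sigma>, z) \<partial>lborel) = (\<integral>z. indicator {0..1} \<sigma> * r * (?B z * ((\<xi> \<bullet> z) * ?e z)) \<partial>lborel)"
        by (intro Bochner_Integration.integral_cong) (auto simp: ind)
      also have "\<dots> = indicator {0..1} \<sigma> * r * (\<integral>z. ?B z * ((\<xi> \<bullet> z) * ?e z) \<partial>lborel)"
        by simp
      also have "\<dots> = indicator {0..1} \<sigma> * (r\<^sup>2 * \<sigma> * (\<xi> \<bullet> \<xi>) / 2) * (\<integral>z. ?B z * ((1 - z \<bullet> z) * ?e z) \<partial>lborel)"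
        by (simp only: key regroup)
      also have "\<dots> = (\<integral>z. indicator {0..1} \<sigma> * (r\<^sup>2 * \<sigma> * (\<xi> \<bullet> \<xi>) / 2) * (?B z * ((1 - z \<bullet> z) * ?e z)) \<partial>lborel)"
        by simp
      also have "\<dots> = (\<integral>z. ?G (\<sigma>, z) \<partial>lborel)"
        by (intro Bochner_Integration.integral_cong) (auto simp: ind)
      finally show ?thesis .
    qed
    then show ?thesis
      by (simp only: lborel_pair.integral_fst'[OF iH, symmetric] lborel_pair.integral_fst'[OF iG, symmetric])
  qed
  moreover have "(\<integral>p. ?G p \<partial>(lborel \<Otimes>\<^sub>M lborel))
      = r\<^sup>2 * (\<xi> \<bullet> \<xi>) / 2 * (dome_mass TYPE('a) * (\<integral>y. exp (r * (\<xi> \<bullet> y)) \<partial>dome))"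
  proof -
    have "(\<integral>p. ?G p \<partial>(lborel \<Otimes>\<^sub>M lborel))
        = (\<integral>p. r\<^sup>2 * (\<xi> \<bullet> \<xi>) / 2 * (dome_weight p * exp (r * (\<xi> \<bullet> (fst p *\<^sub>R snd p)))) \<partial>(lborel :: (real \<times> 'a) measure))"
      unfolding lborel_prod by (intro Bochner_Integration.integral_cong) (auto simp: dome_weight_unit_cylinder)
    also have "\<dots> = r\<^sup>2 * (\<xi> \<bullet> \<xi>) / 2 * (\<integral>p. (dome_weight p * exp (r * (\<xi> \<bullet> (fst p *\<^sub>R snd p)))) \<partial>(lborel :: (real \<times> 'a) measure))"
      by simp
    also have "(\<integral>p. (dome_weight p * exp (r * (\<xi> \<bullet> (fst p *\<^sub>R snd p)))) \<partial>(lborel :: (real \<times> 'a) measure))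
        = dome_mass TYPE('a) * (\<integral>y. exp (r * (\<xi> \<bullet> y)) \<partial>dome)"
      using dome_mass_pos[where 'a='a] integral_dome[of "\<lambda>y. exp (r * (\<xi> \<bullet> y))"] by simp
    finally show ?thesis .
  qed
  moreover have "(\<integral>p. ?H p \<partial>(lborel \<Otimes>\<^sub>M lborel)) = V * ((\<integral>y. exp (r * (\<xi> \<bullet> y)) \<partial>unif) - 1)"
  proof -
    have inner: "(\<integral>\<sigma>. ?H (\<sigma>, z) \<partial>lborel) = ?B z * (exp (r * (\<xi> \<bullet> z)) - 1)" for z
    proof -
      have "(\<integral>\<sigma>. (r * (\<xi> \<bullet> z)) * exp (r * \<sigma> * (\<xi> \<bullet> z)) * indicator {0..1} \<sigma> \<partial>lborel)
          = exp (r * 1 * (\<xi> \<bullet> z)) - exp (r * 0 * (\<xi> \<bullet> z))"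
        by (intro integral_FTC_Icc_real) (auto intro!: derivative_eq_intros continuous_intros)
      then have "?B z * (\<integral>\<sigma>. (r * (\<xi> \<bullet> z)) * exp (r * \<sigma> * (\<xi> \<bullet> z)) * indicator {0..1} \<sigma> \<partial>lborel)
          = ?B z * (exp (r * (\<xi> \<bullet> z)) - 1)" by simp
      also have "?B z * (\<integral>\<sigma>. (r * (\<xi> \<bullet> z)) * exp (r * \<sigma> * (\<xi> \<bullet> z)) * indicator {0..1} \<sigma> \<partial>lborel)
          = (\<integral>\<sigma>. ?B z * ((r * (\<xi> \<bullet> z)) * exp (r * \<sigma> * (\<xi> \<bullet> z)) * indicator {0..1} \<sigma>) \<partial>lborel)"
        by simp
      also have "\<dots> = (\<integral>\<sigma>. ?H (\<sigma>, z) \<partial>lborel)"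
        by (intro Bochner_Integration.integral_cong) (auto simp: ind)
      finally show ?thesis by simp
    qed
    have "(\<integral>p. ?H p \<partial>(lborel \<Otimes>\<^sub>M lborel)) = (\<integral>z. (\<integral>\<sigma>. ?H (\<sigma>, z) \<partial>lborel) \<partial>lborel)"
      using lborel_pair.integral_snd[of "\<lambda>\<sigma> z. ?H (\<sigma>, z)"] iH by (simp add: split_beta')
    also have "\<dots> = (\<integral>z. ?B z * (exp (r * (\<xi> \<bullet> z)) - 1) \<partial>lborel)"
      by (simp only: inner)
    also have "\<dots> = (\<integral>z. indicator (ball 0 1) z * (exp (r * (\<xi> \<bullet> z)) - 1) \<partial>lborel)"
    proof (rule integral_cong_AE)
      show "AE z in lborel. ?B z * (exp (r * (\<xi> \<bullet> z)) - 1) = indicator (ball 0 1) z * (exp (r * (\<xi> \<bullet> z)) - 1)"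
        using AE_not_unit_sphere by eventually_elim (auto simp: indicator_def)
      have [measurable]: "(\<lambda>z. exp (r * (\<xi> \<bullet> z)) - 1) \<in> borel_measurable lborel"
        by simp
      show "(\<lambda>z. ?B z * (exp (r * (\<xi> \<bullet> z)) - 1)) \<in> borel_measurable lborel"
        by (intro borel_measurable_times borel_measurable_indicator) auto
      show "(\<lambda>z. indicator (ball 0 1) z * (exp (r * (\<xi> \<bullet> z)) - 1)) \<in> borel_measurable lborel"
        by (intro borel_measurable_times borel_measurable_indicator) auto
    qed
    also have "\<dots> = V * (\<integral>z. exp (r * (\<xi> \<bullet> z)) - 1 \<partial>unif)"
      using V by (subst integral_unif) (auto simp: V_def)
    also have "(\<integral>z. exp (r * (\<xi> \<bullet> z)) - 1 \<partial>unif) = (\<integral>y. exp (r * (\<xi> \<bullet> y)) \<partial>unif) - 1"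
    proof (subst Bochner_Integration.integral_diff)
      show "integrable unif (\<lambda>z::'a. exp (r * (\<xi> \<bullet> z)))"
      proof (rule unif.integrable_const_bound[where B="exp (\<bar>r\<bar> * norm \<xi>)"])
        show "AE z in unif. norm (exp (r * (\<xi> \<bullet> z))) \<le> exp (\<bar>r\<bar> * norm \<xi>)"
          using unif.supp
        proof eventually_elim
          case (elim z)
          have "r * (\<xi> \<bullet> z) \<le> \<bar>r\<bar> * \<bar>\<xi> \<bullet> z\<bar>" by (simp flip: abs_mult)
          also have "\<dots> \<le> \<bar>r\<bar> * (norm \<xi> * norm z)"
            by (intro mult_left_mono Cauchy_Schwarz_ineq2) auto
          also have "\<dots> \<le> \<bar>r\<bar> * (norm \<xi> * 1)"
            using elim by (intro mult_left_mono) auto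
          finally show ?case by simp
        qed
      qed measurable
    qed (auto simp: unif.space_eq unif.mass)
    finally show ?thesis .
  qed
  ultimately have "V * ((\<integral>y. exp (r * (\<xi> \<bullet> y)) \<partial>unif) - 1)
     = r\<^sup>2 * (\<xi> \<bullet> \<xi>) / 2 * (dome_mass TYPE('a) * (\<integral>y. exp (r * (\<xi> \<bullet> y)) \<partial>dome))"
    by simp
  then show ?thesis unfolding V_def[symmetric] by (rule solve[OF V])
qed

lemma continuous_smear_unif: "bdd_borel f \<Longrightarrow> 0 < r \<Longrightarrow> continuous_on UNIV (smear unif r f)"
  by (rule smear_unif_lipschitz) (rule mean_lipschitz_continuous)

lemma continuous_smear_dome: "bdd_borel f \<Longrightarrow> 0 < r \<Longrightarrow> continuous_on UNIV (smear dome r f)"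
  by (rule smear_dome_lipschitz) (rule mean_lipschitz_continuous)

section \<open>The cocycle identity\<close>

text \<open>The span of the exponentials is an algebra that separates points, so it is dense in the continuous functions
on every compact set.\<close>

inductive exp_poly :: "('a::euclidean_space \<Rightarrow> real) \<Rightarrow> bool" where
  monom: "exp_poly (\<lambda>x. c * exp (\<xi> \<bullet> x))"
| add: "exp_poly f \<Longrightarrow> exp_poly g \<Longrightarrow> exp_poly (\<lambda>x. f x + g x)"

lemma exp_poly_mult:
  assumes "exp_poly f" "exp_poly g" shows "exp_poly (\<lambda>x. f x * g x)"
  using assms(1)
proof induction
  case (monom c \<xi>)
  show ?case using assms(2)
  proof induction
    case (monom c' \<xi>')
    have "(\<lambda>x. c * exp (\<xi> \<bullet> x) * (c' * exp (\<xi>' \<bullet> x))) = (\<lambda>x. (c * c') * exp ((\<xi> + \<xi>') \<bullet> x))"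
      by (auto simp: inner_add_left exp_add)
    then show ?case by (simp add: exp_poly.monom)
  next
    case (add f g)
    then show ?case by (simp add: distrib_left exp_poly.add)
  qed
next
  case (add f g)
  then show ?case by (simp add: distrib_right exp_poly.add)
qed

lemma exp_poly_continuous: "exp_poly f \<Longrightarrow> continuous_on A f"
  by (induction rule: exp_poly.induct) (auto intro!: continuous_intros)

lemma exp_poly_dense:
  assumes "compact K" "continuous_on K f" "0 < e"
  shows "\<exists>g. exp_poly g \<and> (\<forall>x\<in>K. \<bar>f x - g x\<bar> < e)"
proof (rule Stone_Weierstrass_HOL[OF assms(1) _ _ _ _ _ assms(2,3)])
  show "exp_poly (\<lambda>x. c)" for c using exp_poly.monom[of c 0] by simp
  show "exp_poly f \<and> exp_poly g \<Longrightarrow> exp_poly (\<lambda>x. f x + g x)" for f g by (simp add: exp_poly.add)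
  show "exp_poly f \<and> exp_poly g \<Longrightarrow> exp_poly (\<lambda>x. f x * g x)" for f g by (simp add: exp_poly_mult)
  show "exp_poly f \<Longrightarrow> continuous_on K f" for f by (rule exp_poly_continuous)
  fix x y :: 'a assume "x \<in> K \<and> y \<in> K \<and> x \<noteq> y"
  then have "(x - y) \<bullet> x \<noteq> (x - y) \<bullet> y"
    by (metis inner_diff_right inner_eq_zero_iff eq_iff_diff_eq_0)
  then have "1 * exp ((x - y) \<bullet> x) \<noteq> 1 * exp ((x - y) \<bullet> y)" by simp
  then show "\<exists>f. exp_poly f \<and> f x \<noteq> f y" using exp_poly.monom[of 1 "x - y"] by blast
qed

context ball_law begin

lemma smear_exp:
  assumes "f \<in> borel_measurable borel" "0 \<le> r" "\<And>z. z \<in> cball x r \<Longrightarrow> f z = c * exp (\<xi> \<bullet> z)"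
  shows "smear \<mu> r f x = (c * (\<integral>z. exp (r * (\<xi> \<bullet> z)) \<partial>\<mu>)) * exp (\<xi> \<bullet> x)"
proof -
  have [measurable]: "f \<in> borel_measurable borel" by fact
  have "smear \<mu> r f x = (\<integral>z. (c * exp (\<xi> \<bullet> x)) * exp (r * (\<xi> \<bullet> z)) \<partial>\<mu>)"
    unfolding smear_def
  proof (rule integral_cong_AE)
    show "AE z in \<mu>. f (x + r *\<^sub>R z) = c * exp (\<xi> \<bullet> x) * exp (r * (\<xi> \<bullet> z))"
      using AE_in_cball[OF assms(2), of x]
      by eventually_elim (simp add: assms(3) inner_simps exp_add)
    show "(\<lambda>z. f (x + r *\<^sub>R z)) \<in> borel_measurable \<mu>" by measurable
    show "(\<lambda>z. c * exp (\<xi> \<bullet> x) * exp (r * (\<xi> \<bullet> z))) \<in> borel_measurable \<mu>" by measurable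
  qed
  then show ?thesis by simp
qed

end

text \<open>The defect is linear in \<open>f\<close>, is bounded by the supremum of \<open>f\<close>, and sees only the values of \<open>f\<close> on
\<open>cball x (r + s)\<close>. Hence it vanishes on continuous functions as soon as it vanishes on exponentials.\<close>

definition cocycle_defect :: "real \<Rightarrow> real \<Rightarrow> ('a::euclidean_space \<Rightarrow> real) \<Rightarrow> 'a \<Rightarrow> real" where
  "cocycle_defect r s f x = s\<^sup>2 * (smear unif r (smear dome s f) x - smear dome s f x)
     - r\<^sup>2 * (smear unif s (smear dome r f) x - smear dome r f x)"

lemma cocycle_defect_add:
  assumes "bdd_borel f" "bdd_borel g"
  shows "cocycle_defect r s (\<lambda>x. f x + g x) x = cocycle_defect r s f x + cocycle_defect r s g x"
proof -
  have "smear dome t (\<lambda>x. f x + g x) = (\<lambda>x. smear dome t f x + smear dome t g x)" for t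
    using assms by (intro ext dome.smear_add)
  then show ?thesis
    by (simp add: cocycle_defect_def unif.smear_add dome.bdd_borel_smear assms algebra_simps)
qed

lemma cocycle_defect_abs_le:
  assumes f: "bdd_borel f" and e: "\<And>y. \<bar>f y\<bar> \<le> e" and "0 \<le> r" "0 \<le> s"
  shows "\<bar>cocycle_defect r s f x\<bar> \<le> 2 * (r\<^sup>2 + s\<^sup>2) * e"
proof -
  have d: "\<bar>smear dome t f y\<bar> \<le> e" if "0 \<le> t" for t y
    using f that e by (intro dome.smear_abs_le) auto
  have u: "\<bar>smear unif t (smear dome t' f) y\<bar> \<le> e" if "0 \<le> t" "0 \<le> t'" for t t' y
    using that f d by (intro unif.smear_abs_le dome.bdd_borel_smear) auto
  have "\<bar>s\<^sup>2 * (smear unif r (smear dome s f) x - smear dome s f x)\<bar> \<le> s\<^sup>2 * (2 * e)"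
    unfolding abs_mult using u[of r s x] d[of s x] assms(3,4) by (intro mult_mono) auto
  moreover have "\<bar>r\<^sup>2 * (smear unif s (smear dome r f) x - smear dome r f x)\<bar> \<le> r\<^sup>2 * (2 * e)"
    unfolding abs_mult using u[of s r x] d[of r x] assms(3,4) by (intro mult_mono) auto
  ultimately show ?thesis unfolding cocycle_defect_def by (simp add: algebra_simps)
qed

lemma cocycle_defect_cong:
  assumes f: "bdd_borel f" "bdd_borel g" and "0 \<le> r" "0 \<le> s"
    and eq: "\<And>y. y \<in> cball x (r + s) \<Longrightarrow> f y = g y"
  shows "cocycle_defect r s f x = cocycle_defect r s g x"
proof -
  have d: "smear dome t f y = smear dome t g y" if "0 \<le> t" "norm (y - x) + t \<le> r + s" for t y
  proof (rule dome.smear_cong[OF f that(1)])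
    fix z assume "z \<in> cball y t"
    then have "z \<in> cball x (r + s)"
      using that(2) dist_triangle[of x z y] by (simp add: dist_norm norm_minus_commute)
    then show "f z = g z" by (rule eq)
  qed
  have u: "smear unif t (smear dome t' f) x = smear unif t (smear dome t' g) x"
    if "0 \<le> t" "0 \<le> t'" "t + t' = r + s" for t t'
    by (rule unif.smear_cong) (use that f in \<open>auto intro!: dome.bdd_borel_smear d simp: dist_norm norm_minus_commute\<close>)
  show ?thesis
    using assms(3,4) by (simp add: cocycle_defect_def u d)
qed

text \<open>Exponentials are unbounded; cutting them off outside the ball that matters brings them into the class on
which the averages act.\<close>

lemma bdd_borel_cut:
  assumes "continuous_on UNIV g"
  shows "bdd_borel (\<lambda>y. indicator (cball x R) y * g y)"
proof -
  have "bounded (g ` cball x R)"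
    by (intro compact_imp_bounded compact_continuous_image continuous_on_subset[OF assms]) auto
  then obtain C where C: "\<forall>y\<in>cball x R. \<bar>g y\<bar> \<le> C" unfolding bounded_iff by auto
  have [measurable]: "g \<in> borel_measurable borel"
    using assms by (rule borel_measurable_continuous_onI)
  have "(\<lambda>y. indicator (cball x R) y * g y) \<in> borel_measurable borel" by measurable
  moreover have "\<bar>indicator (cball x R) y * g y\<bar> \<le> max C 0" for y
    using C by (auto simp: indicator_def le_max_iff_disj)
  ultimately show ?thesis by (rule bdd_borelI)
qed

lemma cocycle_defect_exp_poly:
  assumes "exp_poly g" "0 \<le> r" "0 \<le> s"
  shows "cocycle_defect r s (\<lambda>y. indicator (cball x (r + s)) y * g y) x = 0"
  using assms(1)
proof induction
  case (monom c \<xi>)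
  let ?f = "\<lambda>y. indicator (cball x (r + s)) y * (c * exp (\<xi> \<bullet> y))"
  let ?a = "\<lambda>t. (\<integral>z. exp (t * (\<xi> \<bullet> z)) \<partial>unif)" and ?b = "\<lambda>t. (\<integral>z. exp (t * (\<xi> \<bullet> z)) \<partial>dome)"
  have bf: "bdd_borel ?f" by (intro bdd_borel_cut continuous_intros)
  have d: "smear dome t ?f y = (c * ?b t) * exp (\<xi> \<bullet> y)" if "0 \<le> t" "norm (y - x) + t \<le> r + s" for t y
  proof (rule dome.smear_exp[OF bdd_borel_measurable[OF bf] that(1)])
    fix z assume "z \<in> cball y t"
    then have "z \<in> cball x (r + s)"
      using that(2) dist_triangle[of x z y] by (simp add: dist_norm norm_minus_commute)
    then show "?f z = c * exp (\<xi> \<bullet> z)" by simp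
  qed
  have u: "smear unif t (smear dome t' ?f) x = (c * ?b t' * ?a t) * exp (\<xi> \<bullet> x)"
    if "0 \<le> t" "0 \<le> t'" "t + t' = r + s" for t t'
    by (rule unif.smear_exp) (use that in \<open>auto intro!: dome.borel_smear bdd_borel_measurable[OF bf] d simp: dist_norm norm_minus_commute\<close>)
  define q where "q = dome_mass TYPE('a) / (2 * measure lborel (ball (0::'a) 1)) * (\<xi> \<bullet> \<xi>)"
  have eig: "?a t = 1 + q * t\<^sup>2 * ?b t" for t
    using exp_eigenvalues[of t \<xi>] by (simp add: q_def)
  show ?case
    using assms(2,3) by (simp add: cocycle_defect_def u d eig) (simp add: algebra_simps)
next
  case (add f g)
  have "bdd_borel (\<lambda>y. indicator (cball x (r + s)) y * f y)" "bdd_borel (\<lambda>y. indicator (cball x (r + s)) y * g y)"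
    by (auto intro!: bdd_borel_cut exp_poly_continuous add)
  from cocycle_defect_add[OF this, of r s x] add show ?case by (simp add: distrib_left)
qed

lemma cocycle_continuous:
  assumes f: "bdd_borel f" "continuous_on UNIV f" and rs: "0 \<le> r" "0 \<le> s"
  shows "cocycle_defect r s f x = 0"
proof -
  let ?cut = "\<lambda>g y. indicator (cball x (r + s)) y * g y"
  have small: "\<bar>cocycle_defect r s f x\<bar> \<le> 2 * (r\<^sup>2 + s\<^sup>2) * e" if e: "0 < e" for e
  proof -
    obtain g where g: "exp_poly g" "\<And>y. y \<in> cball x (r + s) \<Longrightarrow> \<bar>f y - g y\<bar> < e"
      using exp_poly_dense[OF compact_cball[of x "r + s"] continuous_on_subset[OF f(2) subset_UNIV] e] by auto
    have bg: "bdd_borel (?cut g)" by (intro bdd_borel_cut exp_poly_continuous g)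
    have bd: "bdd_borel (?cut (\<lambda>y. f y - g y))"
      by (intro bdd_borel_cut continuous_intros f exp_poly_continuous g)
    have "cocycle_defect r s f x = cocycle_defect r s (\<lambda>y. ?cut g y + ?cut (\<lambda>y. f y - g y) y) x"
      by (rule cocycle_defect_cong[OF f(1) bdd_borel_add[OF bg bd] rs]) simp
    also have "\<dots> = cocycle_defect r s (?cut (\<lambda>y. f y - g y)) x"
      using cocycle_defect_add[OF bg bd, of r s x] cocycle_defect_exp_poly[OF g(1) rs] by simp
    finally show ?thesis
      using cocycle_defect_abs_le[OF bd _ rs, of e x] g(2) that by (force simp: indicator_def less_imp_le)
  qed
  have "\<bar>cocycle_defect r s f x\<bar> \<le> e" if "0 < e" for e
  proof -
    have pos: "0 < 2 * (r\<^sup>2 + s\<^sup>2) + 1" by (simp add: add_nonneg_pos)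
    have "2 * (r\<^sup>2 + s\<^sup>2) * (e / (2 * (r\<^sup>2 + s\<^sup>2) + 1)) \<le> e"
      using that pos by (simp add: divide_le_eq mult.commute)
    then show ?thesis using small[of "e / (2 * (r\<^sup>2 + s\<^sup>2) + 1)"] that pos by (simp add: order_trans)
  qed
  then show ?thesis by (metis abs_le_zero_iff dense_ge)
qed

text \<open>If \<open>A r\<close> and \<open>E r\<close> denote the averages with respect to \<open>unif\<close> and \<open>dome\<close> at radius \<open>r\<close>, then for smooth \<open>f\<close> the
difference \<open>A r f - f\<close> is a constant times \<open>r\<^sup>2\<close> times \<open>E r\<close> of the Laplacian of \<open>f\<close>. Both sides are therefore
the same constant times \<open>r\<^sup>2 * s\<^sup>2\<close> times \<open>E r (E s _)\<close> of the Laplacian, while the identity itself mentions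
no derivative. For a bounded Borel function \<open>f\<close>, replace \<open>f\<close> by the continuous function \<open>A t f\<close>, let the operators
commute, and let \<open>t\<close> tend to \<open>0\<close>; this works because \<open>E s f\<close> is continuous.\<close>

theorem cocycle:
  assumes f: "bdd_borel f" and rs: "0 < r" "0 < s"
  shows "s\<^sup>2 * (smear unif r (smear dome s f) x - smear dome s f x)
    = r\<^sup>2 * (smear unif s (smear dome r f) x - smear dome r f x)"
proof -
  define t where "t n = 1 / real (Suc n)" for n
  have t: "t \<longlonglongrightarrow> 0" "0 < t n" for n
    using LIMSEQ_inverse_real_of_nat by (auto simp: t_def[abs_def] inverse_eq_divide)
  have ev: "\<forall>\<^sub>F n in sequentially. 0 \<le> t n" using t(2) by (simp add: less_imp_le)
  have com: "smear dome a (smear unif b f) = smear unif b (smear dome a f)" for a b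
    by (intro ext smear_commute ball_law_dome ball_law_unif f)
  have com': "smear unif a (smear unif b g) x = smear unif b (smear unif a g) x" if "bdd_borel g" for a b g
    using smear_commute[OF ball_law_unif ball_law_unif that] .
  have lim: "(\<lambda>n. smear dome a (smear unif (t n) f) x) \<longlonglongrightarrow> smear dome a f x"
    "(\<lambda>n. smear unif b (smear dome a (smear unif (t n) f)) x) \<longlonglongrightarrow> smear unif b (smear dome a f) x"
    if "0 < a" for a b
  proof -
    have c: "continuous_on UNIV (smear dome a f)" by (rule continuous_smear_dome[OF f that])
    then show "(\<lambda>n. smear dome a (smear unif (t n) f) x) \<longlonglongrightarrow> smear dome a f x"
      unfolding com by (intro unif.smear_tendsto_cont dome.bdd_borel_smear f t ev)
        (auto simp: continuous_on_eq_continuous_at)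
    have "continuous_on UNIV (smear unif b (smear dome a f))"
      by (intro unif.smear_continuous dome.bdd_borel_smear f c)
    then show "(\<lambda>n. smear unif b (smear dome a (smear unif (t n) f)) x) \<longlonglongrightarrow> smear unif b (smear dome a f) x"
      unfolding com com'[OF dome.bdd_borel_smear[OF f], of b]
      by (intro unif.smear_tendsto_cont unif.bdd_borel_smear dome.bdd_borel_smear f t ev)
        (auto simp: continuous_on_eq_continuous_at)
  qed
  have "(\<lambda>n. cocycle_defect r s (smear unif (t n) f) x) \<longlonglongrightarrow> cocycle_defect r s f x"
    unfolding cocycle_defect_def by (intro tendsto_intros lim rs)
  moreover have "cocycle_defect r s (smear unif (t n) f) x = 0" for n
    using rs t(2) by (intro cocycle_continuous unif.bdd_borel_smear continuous_smear_unif f) auto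
  ultimately have "cocycle_defect r s f x = 0" by (simp add: LIMSEQ_const_iff)
  then show ?thesis by (simp add: cocycle_defect_def)
qed

text \<open>In this form the identity moves information between scales: an inequality for \<open>A r f - f\<close> at a tiny radius \<open>r\<close>
that holds on \<open>cball x s\<close> is averaged with \<open>s\<^sup>2 * E s\<close>, and after division by \<open>r\<^sup>2\<close> it becomes, as \<open>r\<close> tends to \<open>0\<close>,
an inequality for \<open>A s f - f\<close> at \<open>x\<close>.\<close>

corollary cocycle_symmetric:
  assumes f: "bdd_borel f" and rs: "0 < r" "0 < s"
  shows "s\<^sup>2 * smear dome s (\<lambda>y. smear unif r f y - f y) x
    = r\<^sup>2 * smear dome r (\<lambda>y. smear unif s f y - f y) x"
proof -
  have "smear dome a (smear unif b f) x = smear unif b (smear dome a f) x" for a b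
    by (intro smear_commute ball_law_dome ball_law_unif f)
  then show ?thesis
    using cocycle[OF f rs, of x]
    by (simp add: dome.smear_diff[OF unif.bdd_borel_smear[OF f] f])
qed

section \<open>From local to global sub-mean values\<close>

definition usc_on :: "'a::euclidean_space set \<Rightarrow> ('a \<Rightarrow> real) \<Rightarrow> bool" where
  "usc_on K k \<longleftrightarrow> (\<forall>x\<in>K. \<forall>e>0. \<exists>d>0. \<forall>y\<in>K. dist y x < d \<longrightarrow> k y < k x + e)"

text \<open>The sets where the function is less than one of its values are relatively open; if no value were maximal,
finitely many of them would cover \<open>K\<close>, and the largest of the finitely many values would be less than itself.\<close>

lemma usc_on_attains_max:
  assumes "compact K" "K \<noteq> {}" "usc_on K \<phi>"
  shows "\<exists>y\<in>K. \<forall>y'\<in>K. \<phi> y' \<le> \<phi> y"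
proof (rule ccontr)
  assume contra: "\<not> ?thesis"
  define T where "T y' = interior {w. w \<in> K \<longrightarrow> \<phi> w < \<phi> y'}" for y'
  have "K \<subseteq> (\<Union>y'\<in>K. T y')"
  proof
    fix y assume "y \<in> K"
    with contra obtain y' where y': "y' \<in> K" "\<phi> y < \<phi> y'" by force
    obtain d where d: "d > 0" "\<And>w. w \<in> K \<Longrightarrow> dist w y < d \<Longrightarrow> \<phi> w < \<phi> y + (\<phi> y' - \<phi> y)"
      using assms(3) \<open>y \<in> K\<close> y'(2) unfolding usc_on_def by (metis diff_gt_0_iff_gt)
    then have "ball y d \<subseteq> {w. w \<in> K \<longrightarrow> \<phi> w < \<phi> y'}" by (auto simp: dist_commute)
    then have "y \<in> T y'" unfolding T_def using d(1) by (meson centre_in_ball interiorI open_ball)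
    then show "y \<in> (\<Union>y'\<in>K. T y')" using y'(1) by blast
  qed
  then obtain D where D: "D \<subseteq> K" "finite D" "K \<subseteq> (\<Union>y'\<in>D. T y')"
    by (rule compactE_image[OF assms(1), rotated]) (auto simp: T_def)
  then have "D \<noteq> {}" using assms(2) by auto
  obtain m where m: "m \<in> D" "\<And>y. y \<in> D \<Longrightarrow> \<phi> y \<le> \<phi> m"
  proof -
    have "Max (\<phi> ` D) \<in> \<phi> ` D" using D(2) \<open>D \<noteq> {}\<close> by simp
    then obtain m where "m \<in> D" "\<phi> m = Max (\<phi> ` D)" by auto
    then show thesis using that[of m] D(2) by simp
  qed
  then obtain y' where "y' \<in> D" "m \<in> T y'" using D by blast
  then have "\<phi> m < \<phi> y'" using m(1) D(1) interior_subset unfolding T_def by blast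
  then show False using m(2)[OF \<open>y' \<in> D\<close>] by linarith
qed

lemma dist_sq_diff_le:
  fixes x x' y :: "'a::euclidean_space"
  shows "\<bar>(dist x' y)\<^sup>2 - (dist x y)\<^sup>2\<bar> \<le> dist x x' * (2 * dist x y + dist x x')"
proof -
  have "(dist x' y)\<^sup>2 - (dist x y)\<^sup>2 = (dist x' y - dist x y) * (dist x' y + dist x y)"
    by (simp add: power2_eq_square algebra_simps)
  moreover have "\<bar>dist x' y - dist x y\<bar> \<le> dist x x'" "dist x' y + dist x y \<le> 2 * dist x y + dist x x'"
    using dist_triangle[of x' y x] dist_triangle[of x y x'] by (auto simp: dist_commute)
  ultimately show ?thesis
    by (simp add: abs_mult) (intro mult_mono, auto)
qed

text \<open>The radius below which the sub-mean value inequality is assumed depends on the point, so it gives no bound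
that is uniform on a ball. The remedy is sup-convolution: let \<open>h n z\<close> be the maximum over \<open>y\<close> in \<open>K\<close> of
\<open>k y - n * (dist z y)\<^sup>2\<close>. This function is continuous. It is semiconvex, so \<open>A r (h n) - h n\<close> is at
least \<open>- n * r\<^sup>2\<close> for all small \<open>r\<close>. It inherits the local sub-mean value inequality of \<open>k\<close> from the point at
which the maximum is attained, provided that this point is interior, which holds for large \<open>n\<close>. So the quotients
\<open>(A r (h n) - h n) / r\<^sup>2\<close> are bounded below and their negative parts tend to \<open>0\<close> pointwise. Averaging them over
\<open>cball x R\<close> and changing the scale by the cocycle identity gives \<open>h n x \<le> A R (h n) x\<close>. Finally \<open>h n\<close> tends
to \<open>k\<close> because \<open>k\<close> is upper semicontinuous.\<close>

lemma local_submean_imp_submean: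
  fixes k :: "'a::euclidean_space \<Rightarrow> real"
  assumes bk: "bdd_borel k" and K: "compact K" and usc: "usc_on K k"
    and sub: "\<And>x. x \<in> interior K \<Longrightarrow> \<forall>\<^sub>F r in at_right 0. k x \<le> smear unif r k x"
    and ball: "cball x R \<subseteq> interior K" and R: "0 < R"
  shows "k x \<le> smear unif R k x"
proof -
  have ballK: "cball x R \<subseteq> K" using ball interior_subset by blast
  then have xK: "x \<in> K" and Kne: "K \<noteq> {}" using R by auto
  obtain C where C: "0 \<le> C" "\<And>x. \<bar>k x\<bar> \<le> C" using bk by (metis bdd_borel_bound)
  have ex: "\<exists>y\<in>K. \<forall>y'\<in>K. k y' - real n * (dist z y')\<^sup>2 \<le> k y - real n * (dist z y)\<^sup>2" for n z
  proof (rule usc_on_attains_max[OF K Kne])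
    show "usc_on K (\<lambda>y. k y - real n * (dist z y)\<^sup>2)"
      unfolding usc_on_def
    proof (intro ballI allI impI)
      fix y :: 'a and e :: real assume "y \<in> K" "0 < e"
      obtain d1 where d1: "d1 > 0" "\<And>w. w \<in> K \<Longrightarrow> dist w y < d1 \<Longrightarrow> k w < k y + e/2"
        using usc \<open>y \<in> K\<close> \<open>0 < e\<close> unfolding usc_on_def by (metis half_gt_zero)
      have "isCont (\<lambda>y. real n * (dist z y)\<^sup>2) y" by (intro continuous_intros)
      then obtain d2 where d2: "d2 > 0" "\<And>w. dist w y < d2 \<Longrightarrow> dist (real n * (dist z w)\<^sup>2) (real n * (dist z y)\<^sup>2) < e/2"
        using \<open>0 < e\<close> unfolding continuous_at_eps_delta by (metis half_gt_zero)
      have "k w - real n * (dist z w)\<^sup>2 < k y - real n * (dist z y)\<^sup>2 + e" if "w \<in> K" "dist w y < min d1 d2" for w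
      proof -
        have "\<bar>real n * (dist z w)\<^sup>2 - real n * (dist z y)\<^sup>2\<bar> < e / 2" "k w < k y + e / 2"
          using d1(2)[of w] d2(2)[of w] that by (simp_all add: dist_real_def)
        then show ?thesis by linarith
      qed
      then show "\<exists>d>0. \<forall>w\<in>K. dist w y < d \<longrightarrow> k w - real n * (dist z w)\<^sup>2 < k y - real n * (dist z y)\<^sup>2 + e"
        using d1(1) d2(1) by (intro exI[of _ "min d1 d2"]) auto
    qed
  qed
  define ys where "ys n z = (SOME y. y \<in> K \<and> (\<forall>y'\<in>K. k y' - real n * (dist z y')\<^sup>2 \<le> k y - real n * (dist z y)\<^sup>2))" for n z
  have ys: "ys n z \<in> K" "\<And>y'. y' \<in> K \<Longrightarrow> k y' - real n * (dist z y')\<^sup>2 \<le> k (ys n z) - real n * (dist z (ys n z))\<^sup>2" for n z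
    using someI_ex[OF ex[of n z, unfolded Bex_def]] unfolding ys_def by blast+
  define h where "h n z = k (ys n z) - real n * (dist z (ys n z))\<^sup>2" for n z
  have h_ge: "k y - real n * (dist z y)\<^sup>2 \<le> h n z" if "y \<in> K" for n z y
    unfolding h_def using ys(2)[OF that] .
  have h_le: "h n z \<le> k (ys n z)" for n z by (simp add: h_def)
  \<comment> \<open>Far from \<open>K\<close> the sup-convolution is very negative; the maximum keeps it bounded and changes nothing on \<open>K\<close>.\<close>
  define kt where "kt n z = max (h n z) (- C)" for n z
  have kt_h: "kt n z = h n z" "k z \<le> h n z" if "z \<in> K" for n z
    using h_ge[OF that, of n z] C(2)[of z] by (auto simp: kt_def abs_le_iff)
  have kt_bound: "\<bar>kt n z\<bar> \<le> C" for n z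
    using h_le[of n z] C(2)[of "ys n z"] C(1) by (auto simp: kt_def abs_le_iff)
  obtain D where D: "\<And>y. y \<in> K \<Longrightarrow> norm y \<le> D"
    using compact_imp_bounded[OF K] unfolding bounded_iff by auto
  have cont_h: "continuous_on UNIV (h n)" for n
  proof -
    have "isCont (h n) z" for z
    proof -
      define M where "M = real n * (2 * (norm z + D) + 1)"
      have D0: "0 \<le> D" using D[OF xK] norm_ge_zero order_trans by blast
      then have M0: "0 \<le> M" by (simp add: M_def)
      have one: "h n a \<le> h n b + M * dist z z'"
        if "dist z z' \<le> 1" "(a = z \<and> b = z') \<or> (a = z' \<and> b = z)" for a b z'
      proof -
        let ?y = "ys n a"
        have "\<bar>(dist z' ?y)\<^sup>2 - (dist z ?y)\<^sup>2\<bar> \<le> dist z z' * (2 * dist z ?y + dist z z')"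
          by (rule dist_sq_diff_le)
        also have "\<dots> \<le> dist z z' * (2 * (norm z + D) + 1)"
          using that(1) D[OF ys(1), of n a] norm_triangle_ineq4[of z ?y]
          by (intro mult_left_mono) (auto simp: dist_norm)
        finally have "real n * \<bar>(dist z' ?y)\<^sup>2 - (dist z ?y)\<^sup>2\<bar> \<le> M * dist z z'"
          unfolding M_def by (simp add: mult.assoc mult.commute[of "dist z z'"] mult_left_mono)
        then have "\<bar>real n * (dist z' ?y)\<^sup>2 - real n * (dist z ?y)\<^sup>2\<bar> \<le> M * dist z z'"
          by (simp add: abs_mult flip: right_diff_distrib)
        then have "- real n * (dist a ?y)\<^sup>2 \<le> - real n * (dist b ?y)\<^sup>2 + M * dist z z'"
          using that(2) by (auto simp: abs_le_iff)
        then show ?thesis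
          using h_ge[OF ys(1)[of n a], of n b] by (simp add: h_def[of n a])
      qed
      have lim: "((\<lambda>z'. M * dist z z') \<longlongrightarrow> M * dist z z) (at z)" by (intro tendsto_intros)
      have "((\<lambda>z'. h n z' - h n z) \<longlongrightarrow> 0) (at z)"
      proof (rule Lim_null_comparison[of _ "\<lambda>z'. M * dist z z'"])
        show "\<forall>\<^sub>F z' in at z. norm (h n z' - h n z) \<le> M * dist z z'"
          unfolding eventually_at
        proof (intro exI[of _ 1] conjI ballI impI)
          fix z' assume "z' \<noteq> z \<and> dist z' z < 1"
          then have "h n z' \<le> h n z + M * dist z z'" "h n z \<le> h n z' + M * dist z z'"
            using one[of z' z' z] one[of z' z z'] by (auto simp: dist_commute)
          then show "norm (h n z' - h n z) \<le> M * dist z z'" by (simp add: abs_le_iff)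
        qed simp
      qed (use lim in simp)
      then show ?thesis unfolding isCont_def by (simp add: LIM_zero_iff)
    qed
    then show ?thesis by (simp add: continuous_on_eq_continuous_at)
  qed
  have cont_kt: "continuous_on UNIV (kt n)" for n
    unfolding kt_def by (intro continuous_intros cont_h)
  have bkt: "bdd_borel (kt n)" for n
    by (rule bdd_borelI[OF borel_measurable_continuous_onI[OF cont_kt] kt_bound])
  \<comment> \<open>The paraboloid through the maximising point lies below \<open>kt n\<close>, and its linear part averages to zero.\<close>
  have semiconvex: "kt n y - real n * r\<^sup>2 \<le> smear unif r (kt n) y" if "y \<in> K" "0 \<le> r" for n y r
  proof -
    let ?a = "- (2 * real n * r) *\<^sub>R (y - ys n y)"
    have int: "integrable unif (\<lambda>z. kt n y - real n * r\<^sup>2 + ?a \<bullet> z)"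
    proof (intro Bochner_Integration.integrable_add)
      show "integrable unif (\<lambda>z. ?a \<bullet> z)"
      proof (rule unif.integrable_const_bound[where B="norm ?a"])
        show "AE z in unif. norm (?a \<bullet> z) \<le> norm ?a"
          using unif.supp
        proof eventually_elim
          case (elim z)
          have "norm (?a \<bullet> z) \<le> norm ?a * norm z" using Cauchy_Schwarz_ineq2[of ?a z] by simp
          also have "\<dots> \<le> norm ?a" using elim by (simp only: mult_left_le norm_ge_zero)
          finally show ?case .
        qed
      qed measurable
    qed simp
    have "kt n y - real n * r\<^sup>2 = (\<integral>z. kt n y - real n * r\<^sup>2 + ?a \<bullet> z \<partial>unif)"
    proof -
      have i2: "integrable unif (\<lambda>z. ?a \<bullet> z)"
        using Bochner_Integration.integrable_diff[OF int, of "\<lambda>z. kt n y - real n * r\<^sup>2"] by simp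
      show ?thesis
        by (subst Bochner_Integration.integral_add[OF _ i2])
          (simp_all only: unif_linear, simp_all add: unif.space_eq unif.mass)
    qed
    also have "\<dots> \<le> smear unif r (kt n) y"
      unfolding smear_def
    proof (rule integral_mono_AE[OF int unif.integrable_smear[OF bkt]])
      show "AE z in unif. kt n y - real n * r\<^sup>2 + ?a \<bullet> z \<le> kt n (y + r *\<^sub>R z)"
        using unif.supp
      proof eventually_elim
        case (elim z)
        have "(dist (y + r *\<^sub>R z) (ys n y))\<^sup>2 = (dist y (ys n y))\<^sup>2 + 2 * r * ((y - ys n y) \<bullet> z) + r\<^sup>2 * (norm z)\<^sup>2"
          unfolding dist_norm power2_norm_eq_inner
          by (simp add: inner_diff_left inner_diff_right inner_add_left inner_add_right
              inner_commute power2_eq_square algebra_simps)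
        also have "\<dots> \<le> (dist y (ys n y))\<^sup>2 + 2 * r * ((y - ys n y) \<bullet> z) + r\<^sup>2 * 1"
          using elim by (intro add_left_mono mult_left_mono) (auto simp: power_le_one)
        finally have "real n * (dist (y + r *\<^sub>R z) (ys n y))\<^sup>2 \<le> real n * ((dist y (ys n y))\<^sup>2 + 2 * r * ((y - ys n y) \<bullet> z) + r\<^sup>2)"
          by (intro mult_left_mono) auto
        then have "kt n y - real n * r\<^sup>2 + ?a \<bullet> z \<le> k (ys n y) - real n * (dist (y + r *\<^sub>R z) (ys n y))\<^sup>2"
          using kt_h(1)[OF that(1), of n] by (simp add: h_def[of n y] algebra_simps)
        also have "\<dots> \<le> kt n (y + r *\<^sub>R z)"
          using h_ge[OF ys(1)[of n y], of n "y + r *\<^sub>R z"] by (simp add: kt_def)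
        finally show ?case .
      qed
    qed
    finally show ?thesis .
  qed
  \<comment> \<open>Translate the inequality at the maximising point to \<open>y\<close>.\<close>
  have locally: "\<forall>\<^sub>F r in at_right 0. kt n y \<le> smear unif r (kt n) y"
    if yK: "y \<in> K" and yi: "ys n y \<in> interior K" for n y
  proof -
    let ?y = "ys n y"
    obtain d where d: "d > 0" "ball ?y d \<subseteq> K" using yi by (meson mem_interior)
    have "\<forall>\<^sub>F r in at_right 0. r < d \<and> 0 < r"
      using d(1) eventually_at_right_less by (auto simp: eventually_at_right_field intro!: exI[of _ d])
    with sub[OF yi] show ?thesis
    proof eventually_elim
      case (elim r)
      have "kt n y = k ?y - real n * (dist y ?y)\<^sup>2"
        using kt_h(1)[OF yK] by (simp add: h_def)
      also have "\<dots> \<le> smear unif r k ?y - real n * (dist y ?y)\<^sup>2" using elim by simp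
      also have "\<dots> = smear unif r (\<lambda>z. k z - real n * (dist y ?y)\<^sup>2) ?y"
        by (subst unif.smear_diff[OF bk bdd_borel_const]) (simp add: unif.smear_const)
      also have "\<dots> \<le> smear unif r (\<lambda>z. kt n (z + (y - ?y))) ?y"
      proof (rule unif.smear_mono)
        fix z assume "z \<in> cball ?y r"
        then have "z \<in> K" using elim d by (meson mem_ball mem_cball le_less_trans subsetD)
        have "dist (z + (y - ?y)) z = dist y ?y" by (simp add: dist_norm)
        then have "k z - real n * (dist y ?y)\<^sup>2 \<le> h n (z + (y - ?y))"
          using h_ge[OF \<open>z \<in> K\<close>, of n "z + (y - ?y)"] by simp
        then show "k z - real n * (dist y ?y)\<^sup>2 \<le> kt n (z + (y - ?y))" by (simp add: kt_def)
      qed (use elim in \<open>auto intro!: bdd_borel_diff bk bdd_borel_const bdd_borel_translate[OF bkt]\<close>)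
      also have "\<dots> = smear unif r (kt n) y"
        by (subst unif.smear_translate) simp
      finally show ?case .
    qed
  qed
  have close: "real n * (dist y (ys n y))\<^sup>2 \<le> 2 * C" if "y \<in> K" for n y
    using kt_h(2)[OF that, of n] C(2)[of y] C(2)[of "ys n y"] unfolding h_def by (auto simp: abs_le_iff)
  have close': "dist y (ys n y) < d" if "y \<in> K" "0 < d" "2 * C / d\<^sup>2 < real n" for n y d
  proof (rule ccontr)
    assume "\<not> dist y (ys n y) < d"
    then have "d\<^sup>2 \<le> (dist y (ys n y))\<^sup>2" using that(2) by (intro power_mono) auto
    then have "real n * d\<^sup>2 \<le> 2 * C"
      using close[OF that(1), of n] by (meson mult_left_mono of_nat_0_le_iff order_trans)
    then show False using that(2,3) by (simp add: divide_less_eq)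
  qed
  obtain \<eta> where eta: "\<eta> > 0" "(\<Union>y\<in>cball x R. cball y \<eta>) \<subseteq> interior K"
    using compact_subset_open_imp_cball_epsilon_subset[OF compact_cball open_interior ball] by blast
  define t where "t j = 1 / real (Suc j)" for j
  have t: "t \<longlonglongrightarrow> 0" "0 < t j" for j
    using LIMSEQ_inverse_real_of_nat by (auto simp: t_def[abs_def] inverse_eq_divide)
  have t_right: "filterlim t (at_right 0) sequentially"
    by (rule filterlim_at_withinI) (use t in \<open>auto simp: less_imp_neq[THEN not_sym]\<close>)
  have main: "kt n x \<le> smear unif R (kt n) x" if n: "2 * C / \<eta>\<^sup>2 < real n" for n
  proof -
    have inside: "ys n y \<in> interior K" if "y \<in> cball x R" for y
      using close'[OF _ eta(1) n, of y] that ballK eta(2) by (force simp: less_imp_le)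
    \<comment> \<open>Only the negative part needs to vanish in the limit, so domination is needed from below only.\<close>
    define \<psi> where "\<psi> j y = min 0 ((smear unif (t j) (kt n) y - kt n y) / (t j)\<^sup>2)" for j y
    have bpsi: "bdd_borel (\<psi> j)" for j
    proof -
      have "\<psi> j = (\<lambda>y. -1 * max 0 (- (1 / (t j)\<^sup>2) * (smear unif (t j) (kt n) y - kt n y)))"
        by (auto simp: \<psi>_def fun_eq_iff min_def max_def)
      then show ?thesis
        by (simp only:) (intro bdd_borel_cmult bdd_borel_max bdd_borel_const bdd_borel_diff unif.bdd_borel_smear bkt)
    qed
    have psi_bound: "\<bar>\<psi> j y\<bar> \<le> real n" if "y \<in> cball x R" for j y
    proof -
      have "kt n y - real n * (t j)\<^sup>2 \<le> smear unif (t j) (kt n) y"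
        using that ballK t(2)[of j] by (intro semiconvex) auto
      then have "- real n \<le> (smear unif (t j) (kt n) y - kt n y) / (t j)\<^sup>2"
        using t(2)[of j] by (simp add: le_divide_eq)
      then show ?thesis by (auto simp: \<psi>_def min_def abs_if)
    qed
    have psi_lim: "(\<lambda>j. \<psi> j y) \<longlonglongrightarrow> 0" if "y \<in> cball x R" for y
    proof -
      have "\<forall>\<^sub>F r in at_right 0. kt n y \<le> smear unif r (kt n) y"
        using that ballK inside by (intro locally) auto
      then have "\<forall>\<^sub>F j in sequentially. kt n y \<le> smear unif (t j) (kt n) y"
        using t_right by (rule eventually_compose_filterlim)
      then have "\<forall>\<^sub>F j in sequentially. 0 = \<psi> j y"
        by eventually_elim (simp add: \<psi>_def min_def divide_le_0_iff)
      then show ?thesis by (rule Lim_transform_eventually[OF tendsto_const])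
    qed
    have "(\<lambda>j. smear dome R (\<psi> j) x) \<longlonglongrightarrow> smear dome R (\<lambda>_. 0) x"
      by (rule dome.smear_dominated[where C="real n"])
        (use R bpsi psi_bound psi_lim in \<open>auto intro: bdd_borel_const\<close>)
    then have lim1: "(\<lambda>j. smear dome R (\<psi> j) x) \<longlonglongrightarrow> 0"
      by (simp add: dome.smear_const)
    let ?L = "\<lambda>y. smear unif R (kt n) y - kt n y"
    have contL: "continuous_on UNIV ?L"
      by (intro continuous_intros unif.smear_continuous bkt cont_kt)
    have lim2: "(\<lambda>j. smear dome (t j) ?L x / R\<^sup>2) \<longlonglongrightarrow> ?L x / R\<^sup>2"
    proof (rule tendsto_divide[OF dome.smear_tendsto_cont tendsto_const])
      show "isCont ?L x" using contL by (simp add: continuous_on_eq_continuous_at)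
      show "\<forall>\<^sub>F j in sequentially. 0 \<le> t j" using t(2) by (simp add: less_imp_le)
    qed (use R in \<open>auto intro!: bdd_borel_diff unif.bdd_borel_smear bkt t\<close>)
    have le: "smear dome R (\<psi> j) x \<le> smear dome (t j) ?L x / R\<^sup>2" for j
    proof -
      let ?g = "\<lambda>y. smear unif (t j) (kt n) y - kt n y"
      have "smear dome R (\<psi> j) x \<le> smear dome R (\<lambda>y. (1 / (t j)\<^sup>2) * ?g y) x"
      proof (rule dome.smear_mono[OF bpsi])
        show "bdd_borel (\<lambda>y. (1 / (t j)\<^sup>2) * ?g y)"
          by (intro bdd_borel_cmult bdd_borel_diff unif.bdd_borel_smear bkt)
      qed (use R in \<open>auto simp: \<psi>_def\<close>)
      also have "\<dots> = smear dome R ?g x / (t j)\<^sup>2"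
        by (subst dome.smear_cmult) simp
      also have "\<dots> = smear dome (t j) ?L x / R\<^sup>2"
        using cocycle_symmetric[OF bkt t(2) R, of j n x] R t(2)[of j]
        by (simp add: frac_eq_eq mult.commute)
      finally show ?thesis .
    qed
    have "0 \<le> ?L x / R\<^sup>2" using LIMSEQ_le[OF lim1 lim2] le by blast
    then show ?thesis using R by (simp add: zero_le_divide_iff)
  qed
  have kt_lim: "(\<lambda>n. kt n y) \<longlonglongrightarrow> k y" if yK: "y \<in> K" for y
  proof (rule LIMSEQ_I)
    fix e :: real assume "0 < e"
    then obtain d where d: "d > 0" "\<And>w. w \<in> K \<Longrightarrow> dist w y < d \<Longrightarrow> k w < k y + e"
      using usc yK unfolding usc_on_def by metis
    obtain N :: nat where N: "2 * C / d\<^sup>2 < real N" using reals_Archimedean2 by blast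
    have "norm (kt n y - k y) < e" if "N \<le> n" for n
    proof -
      have "2 * C / d\<^sup>2 < real n" using N that by (meson less_le_trans of_nat_le_iff)
      then have "k (ys n y) < k y + e"
        using d close'[OF \<open>y \<in> K\<close> d(1)] ys(1) by (simp add: dist_commute)
      then show ?thesis using kt_h[OF \<open>y \<in> K\<close>, of n] h_le[of n y] by simp
    qed
    then show "\<exists>N. \<forall>n\<ge>N. norm (kt n y - k y) < e" by blast
  qed
  have "(\<lambda>n. smear unif R (kt n) x) \<longlonglongrightarrow> smear unif R k x"
    by (rule unif.smear_dominated[where C=C])
      (use R bk bkt kt_bound kt_lim ballK in auto)
  moreover have "\<forall>\<^sub>F n in sequentially. k x \<le> smear unif R (kt n) x"
  proof -
    obtain N :: nat where N: "2 * C / \<eta>\<^sup>2 < real N" using reals_Archimedean2 by blast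
    have "k x \<le> smear unif R (kt n) x" if "N \<le> n" for n
    proof -
      have "2 * C / \<eta>\<^sup>2 < real n" using N that by (meson less_le_trans of_nat_le_iff)
      then show ?thesis using main[of n] kt_h[OF xK, of n] by simp
    qed
    then show ?thesis unfolding eventually_sequentially by blast
  qed
  ultimately show ?thesis by (rule tendsto_lowerbound) simp
qed

section \<open>Discrete obstacle problems\<close>

text \<open>The function \<open>s\<^sup>2 * E s f\<close> serves as a potential of \<open>f\<close>: its generalised Laplacian is \<open>A s f - f\<close>. When \<open>s\<close> is
large, \<open>A s f\<close> is small and locally constant, so a genuine Newtonian potential, whose form depends on the
dimension, can be avoided.\<close>

lemma smear_dome_potential:
  assumes f: "bdd_borel f" and "0 < \<epsilon>" "0 < s"
  shows "smear unif \<epsilon> (\<lambda>x. s\<^sup>2 * smear dome s f x) x - s\<^sup>2 * smear dome s f x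
    = \<epsilon>\<^sup>2 * smear dome \<epsilon> (\<lambda>y. smear unif s f y - f y) x"
proof -
  have "smear dome \<epsilon> (smear unif s f) x = smear unif s (smear dome \<epsilon> f) x"
    by (intro smear_commute ball_law_dome ball_law_unif f)
  then show ?thesis
    using cocycle[OF f assms(2,3), of x]
    by (simp add: unif.smear_cmult dome.smear_diff[OF unif.bdd_borel_smear[OF f] f] right_diff_distrib)
qed

text \<open>Up to a constant factor, this says at the scale \<open>\<epsilon>\<close> that the Laplacian of the nonnegative function \<open>v\<close> is
at most \<open>1 - w\<close>.\<close>

definition supersolution :: "real \<Rightarrow> ('a::euclidean_space \<Rightarrow> real) \<Rightarrow> ('a \<Rightarrow> real) \<Rightarrow> bool" where
  "supersolution \<epsilon> w v \<longleftrightarrow> bdd_borel v \<and> (\<forall>x. 0 \<le> v x) \<and>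
     (\<forall>x. smear unif \<epsilon> v x - v x \<le> \<epsilon>\<^sup>2 * smear dome \<epsilon> (\<lambda>y. 1 - w y) x)"

text \<open>The name comes from the divisible sandpile: the least supersolution measures how much mass leaves each point
when the mass distribution \<open>w\<close> is spread until no density exceeds one.\<close>

definition odometer :: "real \<Rightarrow> ('a::euclidean_space \<Rightarrow> real) \<Rightarrow> ('a \<Rightarrow> real) \<Rightarrow> bool" where
  "odometer \<epsilon> w u \<longleftrightarrow> supersolution \<epsilon> w u \<and>
     (\<forall>x. 0 < u x \<longrightarrow> smear unif \<epsilon> u x - u x = \<epsilon>\<^sup>2 * smear dome \<epsilon> (\<lambda>y. 1 - w y) x) \<and>
     (\<forall>v x. supersolution \<epsilon> w v \<longrightarrow> u x \<le> v x)"

text \<open>Start with zero and repeatedly take the least value at each point that the inequality allows, given the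
current function. The iterates increase and stay below every supersolution; their limit is a fixed point of the
iteration, which is the equation where the limit is positive.\<close>

lemma odometer_exists:
  assumes w: "bdd_borel w" and e: "0 < \<epsilon>" and v0: "supersolution \<epsilon> w v0"
  shows "\<exists>u. odometer \<epsilon> w u"
proof -
  define d where "d x = \<epsilon>\<^sup>2 * smear dome \<epsilon> (\<lambda>y. 1 - w y) x" for x
  have bd: "bdd_borel d"
    unfolding d_def[abs_def] by (intro bdd_borel_cmult dome.bdd_borel_smear bdd_borel_diff bdd_borel_const w)
  define T where "T u x = max 0 (smear unif \<epsilon> u x - d x)" for u x
  define U where "U n = (T ^^ n) (\<lambda>_. 0)" for n
  have U_Suc: "U (Suc n) = T (U n)" and U_0: "U 0 = (\<lambda>_. 0)" for n by (auto simp: U_def)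
  have bU: "bdd_borel (U n)" for n
    by (induction n) (auto simp: U_0 U_Suc T_def[abs_def]
        intro!: bdd_borel_const bdd_borel_max bdd_borel_diff unif.bdd_borel_smear bd)
  have T_mono: "T a x \<le> T b x" if "bdd_borel a" "bdd_borel b" "\<And>x. a x \<le> b x" for a b x
    unfolding T_def using unif.smear_mono[OF that(1,2), of \<epsilon> x] e that(3) by (simp add: max.coboundedI2)
  have U_nonneg: "0 \<le> U n x" for n x
    by (cases n) (auto simp: U_0 U_Suc T_def)
  have U_inc: "U n x \<le> U (Suc n) x" for n x
  proof (induction n arbitrary: x)
    case 0 then show ?case using U_nonneg[of 1] by (simp add: U_0)
  next
    case (Suc n) then show ?case unfolding U_Suc[of "Suc n"] U_Suc[of n]
      by (intro T_mono) (auto simp: U_Suc[symmetric] bU)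
  qed
  have U_le: "U n x \<le> v x" if v: "supersolution \<epsilon> w v" for n v x
  proof (induction n arbitrary: x)
    case 0 then show ?case using v by (simp add: U_0 supersolution_def)
  next
    case (Suc n)
    have bv: "bdd_borel v" using v by (simp add: supersolution_def)
    have "U (Suc n) x \<le> T v x" unfolding U_Suc by (intro T_mono bU bv Suc)
    also have "\<dots> \<le> v x" using v by (auto simp: T_def d_def supersolution_def algebra_simps)
    finally show ?case .
  qed
  have inc: "incseq (\<lambda>n. U n x)" for x by (intro incseq_SucI U_inc)
  obtain C where C: "\<And>x. \<bar>v0 x\<bar> \<le> C"
    using v0 unfolding supersolution_def by (metis bdd_borel_bound)
  have U_C: "\<bar>U n x\<bar> \<le> C" for n x
    using U_le[OF v0, of n x] U_nonneg[of n x] C[of x] by auto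
  define u where "u x = lim (\<lambda>n. U n x)" for x
  have lim: "(\<lambda>n. U n x) \<longlonglongrightarrow> u x" for x
  proof -
    obtain l where "(\<lambda>n. U n x) \<longlonglongrightarrow> l"
      using incseq_convergent[OF inc, of x "v0 x"] U_le[OF v0] by blast
    then show ?thesis by (simp add: u_def limI)
  qed
  have u_nonneg: "0 \<le> u x" for x
    using lim by (rule LIMSEQ_le_const) (use U_nonneg in auto)
  have u_le: "u x \<le> v x" if "supersolution \<epsilon> w v" for v x
    using lim by (rule LIMSEQ_le_const2) (use U_le[OF that] in auto)
  have bu: "bdd_borel u"
  proof (rule bdd_borelI)
    show "u \<in> borel_measurable borel"
      by (rule borel_measurable_LIMSEQ_real[OF lim]) (rule bdd_borel_measurable[OF bU])
    show "\<bar>u x\<bar> \<le> C" for x using u_nonneg[of x] u_le[OF v0, of x] C[of x] by auto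
  qed
  have fixpoint: "u x = max 0 (smear unif \<epsilon> u x - d x)" for x
  proof -
    have "(\<lambda>n. smear unif \<epsilon> (U n) x) \<longlonglongrightarrow> smear unif \<epsilon> u x"
      by (rule unif.smear_dominated[where C=C]) (use e bU bu U_C lim in auto)
    then have "(\<lambda>n. max 0 (smear unif \<epsilon> (U n) x - d x)) \<longlonglongrightarrow> max 0 (smear unif \<epsilon> u x - d x)"
      by (intro tendsto_intros)
    then have "(\<lambda>n. U (Suc n) x) \<longlonglongrightarrow> max 0 (smear unif \<epsilon> u x - d x)"
      by (simp add: U_Suc T_def)
    then show ?thesis using LIMSEQ_Suc[OF lim] LIMSEQ_unique by blast
  qed
  have "odometer \<epsilon> w u"
    unfolding odometer_def supersolution_def
  proof (intro conjI allI impI)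
    show "smear unif \<epsilon> u x - u x \<le> \<epsilon>\<^sup>2 * smear dome \<epsilon> (\<lambda>y. 1 - w y) x" for x
      using fixpoint[of x] by (simp add: d_def)
    show "smear unif \<epsilon> u x - u x = \<epsilon>\<^sup>2 * smear dome \<epsilon> (\<lambda>y. 1 - w y) x" if "0 < u x" for x
      using fixpoint[of x] that by (simp add: d_def)
    show "u x \<le> v x" if "bdd_borel v \<and> (\<forall>x. 0 \<le> v x) \<and>
        (\<forall>x. smear unif \<epsilon> v x - v x \<le> \<epsilon>\<^sup>2 * smear dome \<epsilon> (\<lambda>y. 1 - w y) x)" for v x
      using u_le that unfolding supersolution_def by blast
  qed (auto simp: bu u_nonneg)
  then show ?thesis by blast
qed

lemma smear_unif_supported:
  fixes f :: "'a::euclidean_space \<Rightarrow> real"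
  assumes f: "f \<in> borel_measurable borel" and R: "0 < R"
    and supp: "\<And>y. y \<notin> ball x R \<Longrightarrow> f y = 0"
  shows "smear unif R f x = (\<integral>y. f y \<partial>lborel) / (R ^ DIM('a) * measure lborel (ball (0::'a) 1))"
proof -
  have "(\<lambda>y. indicator (ball x R) y * f y) = f"
    using supp by (auto simp: fun_eq_iff indicator_def)
  then show ?thesis
    using smear_unif[OF f R, of x] measure_ball_scale[of R x] R by simp
qed

lemma smear_unif_ball_indicator_le:
  fixes x :: "'a::euclidean_space"
  assumes "0 < R" "0 < \<rho>"
  shows "smear unif R (indicator (ball 0 \<rho>)) x \<le> (\<rho> / R) ^ DIM('a)"
proof -
  let ?V = "measure lborel (ball (0::'a) 1)"
  have "smear unif R (indicator (ball 0 \<rho>)) x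
      = (\<integral>y. indicator (ball x R) y * indicator (ball 0 \<rho>) y \<partial>lborel) / measure lborel (ball x R)"
    by (rule smear_unif) (use assms in auto)
  also have "\<dots> \<le> (\<integral>y. indicator (ball (0::'a) \<rho>) y \<partial>lborel) / measure lborel (ball x R)"
  proof (intro divide_right_mono integral_mono)
    show "integrable lborel (\<lambda>y::'a. indicator (ball x R) y * indicator (ball 0 \<rho>) y :: real)"
      using integrable_real_mult_indicator[OF _ integrable_ball_indicator[of 0 \<rho>], of "ball x R"]
      by (simp add: mult.commute)
    show "integrable lborel (\<lambda>y::'a. indicator (ball 0 \<rho>) y :: real)"
      by (rule integrable_ball_indicator)
  qed (auto simp: indicator_def)
  also have "\<dots> = (\<rho> ^ DIM('a) * ?V) / (R ^ DIM('a) * ?V)"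
    using assms by (simp add: measure_ball_scale[of R x] measure_ball_scale[of \<rho> "0::'a"])
  also have "\<dots> = (\<rho> / R) ^ DIM('a)"
    using unit_vol_pos[where 'a='a] by (simp add: power_divide)
  finally show ?thesis .
qed

text \<open>The barrier describes how mass from a ball of radius \<open>S\<close> spreads to the ball of radius \<open>R1\<close>: it is the difference
of two potentials of the same bump, and its generalised Laplacian is the difference of the two ball averages of
the bump. The height of the bump is chosen such that its average at radius \<open>S\<close> is exactly \<open>M\<close> on the support of
\<open>w\<close>, and \<open>R1\<close> such that its average at radius \<open>R1\<close> is at most \<open>1\<close> everywhere.\<close>

lemma barrier_exists:
  fixes w :: "'a::euclidean_space \<Rightarrow> real"
  assumes w: "bdd_borel w" and w_le: "\<And>x. w x \<le> M" and w_supp: "\<And>x. R0 < norm x \<Longrightarrow> w x = 0"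
    and M: "1 \<le> M" and R0: "0 \<le> R0"
  obtains v R2 where "0 \<le> R2" "\<And>x. R2 < norm x \<Longrightarrow> v x = 0" "\<And>\<epsilon>. 0 < \<epsilon> \<Longrightarrow> supersolution \<epsilon> w v"
proof -
  define S where "S = R0 + 1"
  \<comment> \<open>The factor makes the ball average of the bump at radius \<open>S\<close> equal to \<open>M\<close>.\<close>
  define c where "c = M * S ^ DIM('a)"
  define R1 where "R1 = M * S"
  have S: "1 \<le> S" using R0 by (simp add: S_def)
  have R1: "S \<le> R1" using M S by (simp add: R1_def)
  have c: "0 \<le> c" using M S by (simp add: c_def)
  define bump where "bump x = c * indicator (ball 0 1) x" for x :: 'a
  have b_bump: "bdd_borel bump"
    unfolding bump_def[abs_def] by (intro bdd_borel_cmult bdd_borelI[where C=1]) (auto simp: indicator_def)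
  have bump_nonneg: "0 \<le> bump x" for x using c by (simp add: bump_def)
  define P where "P r x = r\<^sup>2 * smear dome r bump x" for r x
  define v where "v x = P R1 x - P S x" for x
  have bP: "bdd_borel (P r)" for r
    unfolding P_def[abs_def] by (intro bdd_borel_cmult dome.bdd_borel_smear b_bump)
  have bv: "bdd_borel v" unfolding v_def[abs_def] by (intro bdd_borel_diff bP)
  have v_nonneg: "0 \<le> v x" for x
    using smear_dome_monotone[OF b_bump bump_nonneg, of S R1 x] S R1 by (simp add: v_def P_def)
  have v_supp: "v x = 0" if "R1 + 1 < norm x" for x
  proof -
    have "smear dome r bump x = smear dome r (\<lambda>_. 0) x" if r: "0 \<le> r" "r \<le> R1" for r
    proof (rule dome.smear_cong[OF b_bump bdd_borel_const r(1)])
      fix y assume "y \<in> cball x r"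
      then have "1 \<le> norm y"
        using \<open>R1 + 1 < norm x\<close> r norm_triangle_ineq2[of x "x - y"] by (simp add: dist_norm)
      then show "bump y = 0" by (simp add: bump_def)
    qed
    then show ?thesis using S R1 by (simp add: v_def P_def dome.smear_const)
  qed
  have key: "smear unif R1 bump y - smear unif S bump y \<le> 1 - w y" for y
  proof -
    have u1: "smear unif r bump z = c * smear unif r (indicator (ball 0 1)) z" for r z
      unfolding bump_def by (rule unif.smear_cmult)
    have "smear unif R1 bump y \<le> c * (1 / R1) ^ DIM('a)"
      unfolding u1 using smear_unif_ball_indicator_le[of R1 1 y] c S R1 by (intro mult_left_mono) auto
    also have "\<dots> \<le> 1"
    proof -
      have "M ^ 1 \<le> M ^ DIM('a)" using M by (intro power_increasing) (auto simp: Suc_leI)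
      then have "c \<le> R1 ^ DIM('a)"
        using S by (simp add: c_def R1_def power_mult_distrib)
      then show ?thesis using S R1 by (simp add: power_divide divide_le_eq)
    qed
    finally have 1: "smear unif R1 bump y \<le> 1" .
    show ?thesis
    proof (cases "norm y \<le> R0")
      case True
      have "smear unif S bump y = (\<integral>z. bump z \<partial>lborel) / (S ^ DIM('a) * measure lborel (ball (0::'a) 1))"
      proof (rule smear_unif_supported[OF bdd_borel_measurable[OF b_bump]])
        fix z assume "z \<notin> ball y S"
        then have "1 \<le> norm z"
          using True norm_triangle_ineq4[of y z] by (simp add: dist_norm S_def)
        then show "bump z = 0" by (simp add: bump_def)
      qed (use S in simp)
      also have "\<dots> = M"
        using S unit_vol_pos[where 'a='a] by (simp add: bump_def c_def)
      finally show ?thesis using 1 w_le[of y] by simp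
    next
      case False
      have "0 \<le> smear unif S bump y"
        using S by (intro unif.smear_ge_const b_bump) (auto simp: bump_nonneg)
      then show ?thesis using 1 w_supp[of y] False by simp
    qed
  qed
  have "supersolution \<epsilon> w v" if e: "0 < \<epsilon>" for \<epsilon>
    unfolding supersolution_def
  proof (intro conjI allI bv v_nonneg)
    fix x
    have lap: "smear unif \<epsilon> (P r) x - P r x = \<epsilon>\<^sup>2 * smear dome \<epsilon> (\<lambda>y. smear unif r bump y - bump y) x" if "0 < r" for r
      unfolding P_def using smear_dome_potential[OF b_bump e that] .
    have "smear unif \<epsilon> v x - v x = (smear unif \<epsilon> (P R1) x - P R1 x) - (smear unif \<epsilon> (P S) x - P S x)"
      unfolding v_def by (simp add: unif.smear_diff bP)
    also have "\<dots> = \<epsilon>\<^sup>2 * smear dome \<epsilon> (\<lambda>y. (smear unif R1 bump y - bump y) - (smear unif S bump y - bump y)) x"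
      using S R1 by (subst dome.smear_diff) (auto intro!: bdd_borel_diff unif.bdd_borel_smear b_bump simp: lap right_diff_distrib)
    also have "\<dots> \<le> \<epsilon>\<^sup>2 * smear dome \<epsilon> (\<lambda>y. 1 - w y) x"
      using e key by (intro mult_left_mono dome.smear_mono)
        (auto intro!: bdd_borel_diff unif.bdd_borel_smear b_bump bdd_borel_const w)
    finally show "smear unif \<epsilon> v x - v x \<le> \<epsilon>\<^sup>2 * smear dome \<epsilon> (\<lambda>y. 1 - w y) x" .
  qed
  then show ?thesis using that[of "R1 + 1" v] v_supp S R1 by auto
qed

text \<open>Compare \<open>u\<close> with its translate by \<open>h\<close>. The translate is a supersolution for the translated weight; adding the
difference of the potential \<open>p\<close> of \<open>w\<close> and its translate corrects the weight, and adding the constant \<open>L * norm h\<close>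
restores nonnegativity. So the corrected translate is a supersolution for \<open>w\<close>, and by minimality it lies above
\<open>u\<close>. The constant is independent of \<open>\<epsilon>\<close> because only the Lipschitz constant of \<open>p\<close> enters.\<close>

lemma odometer_lipschitz:
  fixes w :: "'a::euclidean_space \<Rightarrow> real"
  assumes w: "bdd_borel w" and w_nonneg: "\<And>x. 0 \<le> w x" and w_le: "\<And>x. w x \<le> M"
    and w_supp: "\<And>x. R0 < norm x \<Longrightarrow> w x = 0"
    and M: "1 \<le> M" and R0: "0 \<le> R0" and R2: "0 \<le> R2"
  obtains L where "0 \<le> L"
    "\<And>\<epsilon> u x y. \<lbrakk>0 < \<epsilon>; \<epsilon> \<le> 1; odometer \<epsilon> w u; \<And>z. R2 < norm z \<Longrightarrow> u z = 0; norm (x - y) \<le> 1\<rbrakk>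
      \<Longrightarrow> \<bar>u x - u y\<bar> \<le> L * norm (x - y)"
proof -
  obtain C where C: "mean_lipschitz (dome :: 'a measure) C" by (rule smear_dome_lipschitz)
  \<comment> \<open>Within radius \<open>X + 2\<close> the average \<open>smear unif R w\<close> is constant; beyond \<open>X\<close> neither \<open>w\<close> nor \<open>u\<close>
    nor their translates are seen.\<close>
  define X where "X = R0 + R2 + 2"
  define R where "R = X + 3 + R0 + M * (R0 + 1)"
  have MR: "R0 + 1 \<le> M * (R0 + 1)" using M R0 by simp
  have R: "0 < R" using R0 R2 MR unfolding R_def X_def by linarith
  define L where "L = R\<^sup>2 * (M * C / R)"
  have L: "0 \<le> L" using mean_lipschitz_nonneg[OF C] M R by (simp add: L_def)
  define p where "p x = R\<^sup>2 * smear dome R w x" for x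
  have bp: "bdd_borel p" unfolding p_def[abs_def] by (intro bdd_borel_cmult dome.bdd_borel_smear w)
  have p_lip: "\<bar>p x - p y\<bar> \<le> L * norm (x - y)" for x y
  proof -
    have "\<bar>smear dome R w x - smear dome R w y\<bar> \<le> M * C * norm (x - y) / R"
      using w_nonneg w_le by (intro mean_lipschitzD[OF C] bdd_borel_measurable[OF w] R) (auto simp: abs_le_iff intro: order_trans[of _ 0])
    then have "R\<^sup>2 * \<bar>smear dome R w x - smear dome R w y\<bar> \<le> R\<^sup>2 * (M * C * norm (x - y) / R)"
      by (intro mult_left_mono) auto
    then show ?thesis by (simp add: p_def L_def abs_mult flip: right_diff_distrib)
  qed
  define a where "a = smear unif R w"
  have ba: "bdd_borel a" unfolding a_def by (intro unif.bdd_borel_smear w)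
  have a_le: "a y \<le> 1" for y
  proof -
    have "a y \<le> smear unif R (\<lambda>x. M * indicator (ball 0 (R0 + 1)) x) y"
      unfolding a_def
    proof (rule unif.smear_mono[OF w])
      show "bdd_borel (\<lambda>x::'a. M * indicator (ball 0 (R0 + 1)) x)"
        by (intro bdd_borel_cmult bdd_borelI[where C=1]) (auto simp: indicator_def)
      show "w x \<le> M * indicator (ball 0 (R0 + 1)) x" for x
        using w_le[of x] w_supp[of x] by (cases "norm x < R0 + 1") auto
    qed (use R in simp)
    also have "\<dots> = M * smear unif R (indicator (ball 0 (R0 + 1))) y" by (rule unif.smear_cmult)
    also have "\<dots> \<le> M * ((R0 + 1) / R) ^ DIM('a)"
      using M R0 R by (intro mult_left_mono smear_unif_ball_indicator_le) auto
    also have "\<dots> \<le> M * (1 / M) ^ DIM('a)"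
    proof (intro mult_left_mono power_mono)
      have "M * (R0 + 1) \<le> R" using R0 R2 by (simp add: R_def X_def)
      then show "(R0 + 1) / R \<le> 1 / M" using R M by (simp add: field_simps)
    qed (use M R0 R in auto)
    also have "\<dots> \<le> M * (1 / M) ^ 1"
      using M by (intro mult_left_mono power_decreasing) (auto simp: Suc_leI)
    finally show ?thesis using M by simp
  qed
  have a_nonneg: "0 \<le> a y" for y
    unfolding a_def using R w_nonneg by (intro unif.smear_ge_const w) auto
  have a_const: "a y = (\<integral>y. w y \<partial>lborel) / (R ^ DIM('a) * measure lborel (ball (0::'a) 1))"
    if "norm y \<le> X + 2" for y
    unfolding a_def
  proof (rule smear_unif_supported[OF bdd_borel_measurable[OF w] R])
    fix z assume "z \<notin> ball y R"
    then have "R \<le> norm (y - z)" by (simp add: dist_norm)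
    then have "R0 < norm z"
      using that norm_triangle_ineq4[of y z] MR R0 unfolding R_def by linarith
    then show "w z = 0" by (rule w_supp)
  qed
  have main: "u x \<le> u (x - h) + L * norm h + L * norm h"
    if e: "0 < \<epsilon>" "\<epsilon> \<le> 1" and u: "odometer \<epsilon> w u" and supp: "\<And>z. R2 < norm z \<Longrightarrow> u z = 0" and h: "norm h \<le> 1"
    for \<epsilon> u x h
  proof -
    have us: "supersolution \<epsilon> w u" using u by (simp add: odometer_def)
    then have bu: "bdd_borel u" by (simp add: supersolution_def)
    define v where "v x = u (x - h) + (p x - p (x - h) + L * norm h)" for x
    have bt: "bdd_borel (\<lambda>x. f (x - h))" if "bdd_borel f" for f :: "'a \<Rightarrow> real"
      using bdd_borel_translate[OF that, of "- h"] by simp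
    have st: "smear unif \<epsilon> (\<lambda>x. f (x - h)) x = smear unif \<epsilon> f (x - h)" for f :: "'a \<Rightarrow> real" and x
      using unif.smear_translate[of \<epsilon> f "- h" x] by simp
    have "supersolution \<epsilon> w v"
      unfolding supersolution_def
    proof (intro conjI allI)
      show "bdd_borel v"
        unfolding v_def[abs_def] by (intro bdd_borel_add bdd_borel_diff bt[OF bu] bt[OF bp] bp bdd_borel_const)
      show "0 \<le> v x" for x
        using us p_lip[of x "x - h"] unfolding supersolution_def v_def by (simp add: abs_le_iff add_nonneg_nonneg)
      fix x
      have "smear unif \<epsilon> v x = smear unif \<epsilon> u (x - h) + (smear unif \<epsilon> p x - smear unif \<epsilon> p (x - h) + L * norm h)"
        unfolding v_def[abs_def]
        by (simp only: unif.smear_add unif.smear_diff unif.smear_const st bt[OF bu] bt[OF bp] bp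
            bdd_borel_add bdd_borel_diff bdd_borel_const)
      then have "smear unif \<epsilon> v x - v x = (smear unif \<epsilon> u (x - h) - u (x - h))
          + (smear unif \<epsilon> p x - p x) - (smear unif \<epsilon> p (x - h) - p (x - h))"
        by (simp add: v_def)
      moreover have "smear unif \<epsilon> p z - p z = \<epsilon>\<^sup>2 * (smear dome \<epsilon> a z - smear dome \<epsilon> w z)" for z
        unfolding p_def a_def
        by (subst smear_dome_potential[OF w e(1) R]) (simp add: dome.smear_diff unif.bdd_borel_smear w)
      ultimately have eq: "smear unif \<epsilon> v x - v x = (smear unif \<epsilon> u (x - h) - u (x - h))
          + \<epsilon>\<^sup>2 * (smear dome \<epsilon> a x - smear dome \<epsilon> w x) - \<epsilon>\<^sup>2 * (smear dome \<epsilon> a (x - h) - smear dome \<epsilon> w (x - h))"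
        by (simp only:)
      have one_w: "smear dome \<epsilon> (\<lambda>y. 1 - w y) z = 1 - smear dome \<epsilon> w z" for z
        by (simp add: dome.smear_diff dome.smear_const bdd_borel_const w)
      show "smear unif \<epsilon> v x - v x \<le> \<epsilon>\<^sup>2 * smear dome \<epsilon> (\<lambda>y. 1 - w y) x"
      proof (cases "norm x \<le> X")
        case True
        define A where "A = (\<integral>y. w y \<partial>lborel) / (R ^ DIM('a) * measure lborel (ball (0::'a) 1))"
        have const: "smear dome \<epsilon> a z = A" if z: "norm z \<le> X + 1" for z
        proof -
          have "smear dome \<epsilon> a z = smear dome \<epsilon> (\<lambda>_. A) z"
          proof (rule dome.smear_cong[OF ba bdd_borel_const])
            fix y assume "y \<in> cball z \<epsilon>"
            then have "norm y \<le> X + 2"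
              using z e norm_triangle_ineq2[of y z] by (simp add: dist_norm norm_minus_commute)
            then show "a y = A" unfolding A_def by (rule a_const)
          qed (use e in simp)
          then show ?thesis by (simp add: dome.smear_const)
        qed
        have "norm (x - h) \<le> X + 1" using True h norm_triangle_ineq4[of x h] by linarith
        then have "smear dome \<epsilon> a x = smear dome \<epsilon> a (x - h)" using True by (simp add: const)
        moreover have "smear unif \<epsilon> u (x - h) - u (x - h) \<le> \<epsilon>\<^sup>2 * (1 - smear dome \<epsilon> w (x - h))"
          using us one_w unfolding supersolution_def by metis
        ultimately show ?thesis unfolding eq one_w by (simp add: algebra_simps)
      next
        case False
        have far: "R2 < norm y" "R0 < norm y" if "y \<in> cball x \<epsilon> \<or> y \<in> cball (x - h) \<epsilon>" for y
        proof -
          have "norm (x - y) \<le> 2"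
            using that e h norm_triangle_ineq[of "x - h - y" h] by (auto simp: dist_norm)
          then show "R2 < norm y" "R0 < norm y"
            using False norm_triangle_ineq2[of x "x - y"] R0 R2 by (auto simp: X_def)
        qed
        have zero: "smear dome \<epsilon> w z = 0" if "z = x \<or> z = x - h" for z
          using dome.smear_cong[OF w bdd_borel_const[of 0], of \<epsilon> z] e far(2) w_supp that
          by (auto simp: dome.smear_const)
        have uz: "smear unif \<epsilon> u (x - h) = 0"
          using unif.smear_cong[OF bu bdd_borel_const[of 0], of \<epsilon> "x - h"] e far(1) supp
          by (auto simp: unif.smear_const)
        have u0: "u (x - h) = 0" using far(1)[of "x - h"] supp e by simp
        have "smear dome \<epsilon> a x - smear dome \<epsilon> a (x - h) \<le> 1"
          using dome.smear_le_const[OF ba, of \<epsilon> x 1] dome.smear_ge_const[OF ba, of \<epsilon> "x - h" 0] e a_le a_nonneg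
          by (simp add: less_imp_le)
        then have "\<epsilon>\<^sup>2 * (smear dome \<epsilon> a x - smear dome \<epsilon> a (x - h)) \<le> \<epsilon>\<^sup>2 * 1"
          by (intro mult_left_mono) auto
        then show ?thesis unfolding eq one_w by (simp add: zero uz u0 algebra_simps)
      qed
    qed
    then have "u x \<le> v x" using u by (simp add: odometer_def)
    then show ?thesis using p_lip[of x "x - h"] by (simp add: v_def abs_le_iff)
  qed
  show ?thesis
  proof (rule that[of "2 * L"])
    show "0 \<le> 2 * L" using L by simp
    fix \<epsilon> u and x y :: 'a
    assume *: "0 < \<epsilon>" "\<epsilon> \<le> 1" "odometer \<epsilon> w u" "\<And>z. R2 < norm z \<Longrightarrow> u z = 0" "norm (x - y) \<le> 1"
    show "\<bar>u x - u y\<bar> \<le> 2 * L * norm (x - y)"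
      using main[OF *(1-4), of "x - y" x] main[OF *(1-4), of "y - x" y] *(5)
      by (simp add: norm_minus_commute abs_le_iff)
  qed
qed

section \<open>The obstacle problem\<close>

lemma locally_lipschitz_continuous:
  fixes u :: "'a::euclidean_space \<Rightarrow> real"
  assumes L: "0 \<le> L" "\<And>x y. norm (x - y) \<le> 1 \<Longrightarrow> \<bar>u x - u y\<bar> \<le> L * norm (x - y)"
  shows "continuous_on UNIV u"
  unfolding continuous_on_iff
proof (intro ballI allI impI)
  fix x :: 'a and e :: real assume "0 < e"
  show "\<exists>d>0. \<forall>x'\<in>UNIV. dist x' x < d \<longrightarrow> dist (u x') (u x) < e"
  proof (intro exI[of _ "min 1 (e / (L + 1))"] conjI ballI impI)
    show "0 < min 1 (e / (L + 1))" using \<open>0 < e\<close> L(1) by simp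
    fix y assume "dist y x < min 1 (e / (L + 1))"
    then have *: "norm (y - x) \<le> 1" "norm (y - x) * (L + 1) < e" using L(1) by (auto simp: less_divide_eq dist_norm)
    have "L * norm (y - x) \<le> norm (y - x) * (L + 1)" by (simp add: algebra_simps)
    then show "dist (u y) (u x) < e" using L(2)[OF *(1)] *(2) by (simp add: dist_real_def)
  qed
qed

text \<open>The odometers at the scales \<open>1 / (n + 1)\<close> are equi-Lipschitz with a common bounded support; let \<open>u\<close> be a uniform
limit of a subsequence. To pass to the limit in the relation at scale \<open>\<epsilon>\<close>, apply the positive operator
\<open>r\<^sup>2 * E r\<close>, exchange the scales by the cocycle identity, and divide by \<open>\<epsilon>\<^sup>2\<close>: the relation becomes an
inequality between \<open>E \<epsilon>\<close> of \<open>A r u - u\<close> and \<open>E \<epsilon>\<close> of \<open>r\<^sup>2 * E r (1 - w)\<close>, in which the limit can be taken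
pointwise. Equality holds where the operator sees only points at which the odometers are positive.\<close>

lemma obstacle_solution_exists:
  fixes w :: "'a::euclidean_space \<Rightarrow> real"
  assumes w: "bdd_borel w" and w_nonneg: "\<And>x. 0 \<le> w x" and w_supp: "\<And>x. R0 < norm x \<Longrightarrow> w x = 0"
  obtains u L R2 where "bdd_borel u" "\<And>x. 0 \<le> u x" "\<And>x. R2 < norm x \<Longrightarrow> u x = 0"
    "0 \<le> L" "\<And>x y. norm (x - y) \<le> 1 \<Longrightarrow> \<bar>u x - u y\<bar> \<le> L * norm (x - y)"
    "\<And>x r. 0 < r \<Longrightarrow> smear unif r u x - u x \<le> r\<^sup>2 * smear dome r (\<lambda>y. 1 - w y) x"
    "\<And>x r. 0 < r \<Longrightarrow> (\<And>y. y \<in> cball x r \<Longrightarrow> 0 < u y) \<Longrightarrow>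
       smear unif r u x - u x = r\<^sup>2 * smear dome r (\<lambda>y. 1 - w y) x"
proof -
  obtain C where C: "0 \<le> C" "\<And>x. \<bar>w x\<bar> \<le> C" using w by (metis bdd_borel_bound)
  define M where "M = C + 1"
  have M: "1 \<le> M" "w x \<le> M" for x using C(1) C(2)[of x] by (auto simp: M_def)
  define \<rho> where "\<rho> = max R0 0"
  have \<rho>: "0 \<le> \<rho>" "\<And>x. \<rho> < norm x \<Longrightarrow> w x = 0" using w_supp by (auto simp: \<rho>_def)
  obtain v R2 where v: "0 \<le> R2" "\<And>x. R2 < norm x \<Longrightarrow> v x = 0" "\<And>\<epsilon>. 0 < \<epsilon> \<Longrightarrow> supersolution \<epsilon> w v"
    by (rule barrier_exists[OF w M(2) \<rho>(2) M(1) \<rho>(1)]) (assumption, rule that)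
  obtain L where L: "0 \<le> L"
    "\<And>\<epsilon> u x y. \<lbrakk>0 < \<epsilon>; \<epsilon> \<le> 1; odometer \<epsilon> w u; \<And>z. R2 < norm z \<Longrightarrow> u z = 0; norm (x - y) \<le> 1\<rbrakk>
      \<Longrightarrow> \<bar>u x - u y\<bar> \<le> L * norm (x - y)"
  proof (rule odometer_lipschitz[OF w w_nonneg M(2) \<rho>(2) M(1) \<rho>(1) v(1)])
    fix L :: real
    assume "0 \<le> L" "\<And>\<epsilon> u x y. \<lbrakk>0 < \<epsilon>; \<epsilon> \<le> 1; odometer \<epsilon> w u; \<And>z. R2 < norm z \<Longrightarrow> u z = 0; norm (x - y) \<le> 1\<rbrakk>
      \<Longrightarrow> \<bar>u x - u y\<bar> \<le> L * norm (x - y)"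
    then show thesis by (rule that)
  qed
  have bv: "bdd_borel v" using v(3)[of 1] by (simp add: supersolution_def)
  obtain B where B: "\<And>x. \<bar>v x\<bar> \<le> B" using bv by (metis bdd_borel_bound)
  define t where "t j = 1 / real (Suc j)" for j
  have t: "t \<longlonglongrightarrow> 0" "0 < t j" "t j \<le> 1" for j
    using LIMSEQ_inverse_real_of_nat by (auto simp: t_def[abs_def] inverse_eq_divide)
  have "\<exists>U. \<forall>j. odometer (t j) w (U j)"
    using odometer_exists[OF w t(2) v(3)[OF t(2)]] by metis
  then obtain U where U: "\<And>j. odometer (t j) w (U j)" by blast
  have U_super: "supersolution (t j) w (U j)" for j using U by (simp add: odometer_def)
  have bU: "bdd_borel (U j)" and U_nonneg: "0 \<le> U j x" for j x
    using U_super by (auto simp: supersolution_def)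
  have U_v: "U j x \<le> v x" for j x using U v(3)[OF t(2)] by (simp add: odometer_def)
  have U_supp: "U j x = 0" if "R2 < norm x" for j x
    using U_v[of j x] U_nonneg[of j x] v(2)[OF that] by simp
  have U_B: "\<bar>U j x\<bar> \<le> B" for j x using U_v[of j x] U_nonneg[of j x] B[of x] by auto
  have U_lip: "\<bar>U j x - U j y\<bar> \<le> L * norm (x - y)" if "norm (x - y) \<le> 1" for j x y
    using L(2)[OF t(2) t(3) U U_supp that] .
  obtain g k where gk: "strict_mono (k :: nat \<Rightarrow> nat)"
    "\<And>e. 0 < e \<Longrightarrow> \<exists>N. \<forall>n x. n \<ge> N \<and> x \<in> cball 0 R2 \<longrightarrow> norm (U (k n) x - g x) < e"
  proof (rule Arzela_Ascoli[of "cball (0::'a) R2" U B])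
    fix x :: 'a and e :: real assume "0 < e"
    show "\<exists>d. 0 < d \<and> (\<forall>n y. y \<in> cball 0 R2 \<and> norm (x - y) < d \<longrightarrow> norm (U n x - U n y) < e)"
    proof (intro exI conjI allI impI)
      show "0 < min 1 (e / (L + 1))" using \<open>0 < e\<close> L(1) by simp
      fix n y assume "y \<in> cball 0 R2 \<and> norm (x - y) < min 1 (e / (L + 1))"
      then have *: "norm (x - y) \<le> 1" "norm (x - y) * (L + 1) < e" using L(1) by (auto simp: less_divide_eq)
      have "L * norm (x - y) \<le> norm (x - y) * (L + 1)" by (simp add: algebra_simps)
      then show "norm (U n x - U n y) < e" using U_lip[OF *(1), of n] *(2) by simp
    qed
  qed (use U_B in auto)
  define u where "u x = (if norm x \<le> R2 then g x else 0)" for x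
  have unif_conv: "\<exists>N. \<forall>n\<ge>N. \<forall>x. \<bar>U (k n) x - u x\<bar> < e" if e: "0 < e" for e
  proof -
    obtain N where "\<forall>n x. n \<ge> N \<and> x \<in> cball 0 R2 \<longrightarrow> norm (U (k n) x - g x) < e"
      using gk(2)[OF e] by blast
    then show ?thesis using U_supp e by (intro exI[of _ N]) (auto simp: u_def)
  qed
  have conv: "(\<lambda>n. U (k n) x) \<longlonglongrightarrow> u x" for x
    by (rule LIMSEQ_I) (use unif_conv in \<open>force\<close>)
  have u_nonneg: "0 \<le> u x" for x
    using conv by (rule LIMSEQ_le_const) (use U_nonneg in auto)
  have u_B: "\<bar>u x\<bar> \<le> B" for x
    using tendsto_rabs[OF conv] by (rule LIMSEQ_le_const2) (use U_B in auto)
  have u_supp: "u x = 0" if "R2 < norm x" for x using that by (simp add: u_def)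
  have u_lip: "\<bar>u x - u y\<bar> \<le> L * norm (x - y)" if "norm (x - y) \<le> 1" for x y
    using tendsto_rabs[OF tendsto_diff[OF conv conv]] by (rule LIMSEQ_le_const2) (use U_lip[OF that] in auto)
  have u_cont: "continuous_on UNIV u"
  proof -
    have "uniform_limit UNIV (\<lambda>n. U (k n)) u sequentially"
      unfolding uniform_limit_sequentially_iff using unif_conv by (simp add: dist_real_def)
    moreover have "continuous_on UNIV (U j)" for j
      using L(1) U_lip by (rule locally_lipschitz_continuous)
    ultimately show ?thesis
      by (intro uniform_limit_theorem[of _ "\<lambda>n. U (k n)"]) (auto intro: always_eventually)
  qed
  have bu: "bdd_borel u" by (rule bdd_borelI[OF borel_measurable_continuous_onI[OF u_cont] u_B])
  have t_k: "(\<lambda>n. t (k n)) \<longlonglongrightarrow> 0"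
    using LIMSEQ_subseq_LIMSEQ[OF t(1) gk(1)] by (simp add: o_def)
  have t_k_nonneg: "\<forall>\<^sub>F n in sequentially. 0 \<le> t (k n)" using t(2) by (simp add: less_imp_le)
  let ?g = "\<lambda>y. 1 - w y"
  have bg: "bdd_borel ?g" by (intro bdd_borel_diff bdd_borel_const w)
  have lim_lap: "(\<lambda>n. smear dome (t (k n)) (\<lambda>y. smear unif r (U (k n)) y - U (k n) y) x) \<longlonglongrightarrow> smear unif r u x - u x"
    if r: "0 < r" for r x
  proof (rule dome.smear_tendsto[OF _ t_k t_k_nonneg])
    show "bdd_borel (\<lambda>y. smear unif r (U (k n)) y - U (k n) y)" for n
      by (intro bdd_borel_diff unif.bdd_borel_smear bU)
    fix e :: real assume e: "0 < e"
    let ?l = "\<lambda>y. smear unif r u y - u y"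
    have "continuous_on UNIV ?l" by (intro continuous_intros unif.smear_continuous bu u_cont)
    then have "isCont ?l x" by (simp add: continuous_on_eq_continuous_at)
    then obtain d where d: "d > 0" "\<And>y. dist y x < d \<Longrightarrow> dist (?l y) (?l x) < e / 3"
      using e unfolding continuous_at_eps_delta by (metis zero_less_divide_iff zero_less_numeral)
    obtain N where N: "\<And>n y. N \<le> n \<Longrightarrow> \<bar>U (k n) y - u y\<bar> < e / 3" using unif_conv[of "e/3"] e by auto
    have "\<bar>smear unif r (U (k n)) y - U (k n) y - ?l x\<bar> \<le> e" if "N \<le> n" "y \<in> cball x (d / 2)" for n y
    proof -
      have "\<bar>smear unif r (\<lambda>z. U (k n) z - u z) y\<bar> \<le> e / 3"
        using r N[OF that(1)] by (intro unif.smear_abs_le bdd_borel_diff bU bu) (auto simp: less_imp_le)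
      then have "\<bar>smear unif r (U (k n)) y - smear unif r u y\<bar> \<le> e / 3"
        by (simp add: unif.smear_diff bU bu)
      moreover have "\<bar>U (k n) y - u y\<bar> < e / 3" by (rule N[OF that(1)])
      moreover have "dist y x < d" using that(2) d(1) by (simp add: dist_commute)
      then have "\<bar>?l y - ?l x\<bar> < e / 3" using d(2)[of y] by (simp add: dist_real_def)
      ultimately show ?thesis by linarith
    qed
    then show "\<exists>d>0. \<forall>\<^sub>F n in sequentially. \<forall>y\<in>cball x d. \<bar>smear unif r (U (k n)) y - U (k n) y - ?l x\<bar> \<le> e"
      using d(1) unfolding eventually_sequentially
      by (intro exI[of _ "d/2"] conjI exI[of _ N] allI impI ballI) auto
  qed
  have lim_g: "(\<lambda>n. r\<^sup>2 * smear dome (t (k n)) (smear dome r ?g) x) \<longlonglongrightarrow> r\<^sup>2 * smear dome r ?g x"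
    if r: "0 < r" for r x
  proof (intro tendsto_intros dome.smear_tendsto_cont[OF _ _ t_k t_k_nonneg])
    show "isCont (smear dome r ?g) x"
      using continuous_smear_dome[OF bg r] by (simp add: continuous_on_eq_continuous_at)
  qed (intro dome.bdd_borel_smear bg)
  have lhs: "smear dome s (\<lambda>y. smear unif r (U j) y - U j y) x = r\<^sup>2 * smear dome r (\<lambda>y. smear unif s (U j) y - U j y) x / s\<^sup>2"
    if "0 < r" "0 < s" for r s j x
    using cocycle_symmetric[OF bU that(2,1), of j x] that by (simp add: eq_divide_eq mult.commute)
  have rhs: "r\<^sup>2 * smear dome s (smear dome r ?g) x = r\<^sup>2 * smear dome r (\<lambda>y. s\<^sup>2 * smear dome s ?g y) x / s\<^sup>2"
    if "0 < s" for r s x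
    using that smear_commute[OF ball_law_dome ball_law_dome bg, of s r x] by (simp add: dome.smear_cmult)
  have upper: "smear unif r u x - u x \<le> r\<^sup>2 * smear dome r ?g x" if r: "0 < r" for r x
  proof (rule LIMSEQ_le[OF lim_lap[OF r] lim_g[OF r]], intro exI[of _ 0] allI impI)
    fix n
    show "smear dome (t (k n)) (\<lambda>y. smear unif r (U (k n)) y - U (k n) y) x \<le> r\<^sup>2 * smear dome (t (k n)) (smear dome r ?g) x"
      unfolding lhs[OF r t(2)] rhs[OF t(2)]
      using r U_super[of "k n"]
      by (intro divide_right_mono mult_left_mono dome.smear_mono)
        (auto simp: supersolution_def intro!: bdd_borel_diff unif.bdd_borel_smear bU bdd_borel_cmult dome.bdd_borel_smear bg)
  qed
  have equal: "smear unif r u x - u x = r\<^sup>2 * smear dome r ?g x"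
    if r: "0 < r" and pos: "\<And>y. y \<in> cball x r \<Longrightarrow> 0 < u y" for r x
  proof -
    have "cball x r \<noteq> {}" using r by simp
    then obtain z where z: "z \<in> cball x r" "\<And>y. y \<in> cball x r \<Longrightarrow> u z \<le> u y"
      using continuous_attains_inf[OF compact_cball _ continuous_on_subset[OF u_cont subset_UNIV], of x r] by blast
    obtain N where N: "\<And>n y. N \<le> n \<Longrightarrow> \<bar>U (k n) y - u y\<bar> < u z" using unif_conv[OF pos[OF z(1)]] by blast
    have "smear dome (t (k n)) (\<lambda>y. smear unif r (U (k n)) y - U (k n) y) x = r\<^sup>2 * smear dome (t (k n)) (smear dome r ?g) x"
      if "N \<le> n" for n
    proof -
      have "smear dome r (\<lambda>y. smear unif (t (k n)) (U (k n)) y - U (k n) y) x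
          = smear dome r (\<lambda>y. (t (k n))\<^sup>2 * smear dome (t (k n)) ?g y) x"
      proof (rule dome.smear_cong)
        fix y assume y: "y \<in> cball x r"
        then have "0 < U (k n) y" using N[OF that, of y] z(2)[OF y] by linarith
        then show "smear unif (t (k n)) (U (k n)) y - U (k n) y = (t (k n))\<^sup>2 * smear dome (t (k n)) ?g y"
          using U[of "k n"] by (simp add: odometer_def)
      qed (use r in \<open>auto intro!: bdd_borel_diff unif.bdd_borel_smear bU bdd_borel_cmult dome.bdd_borel_smear bg\<close>)
      then show ?thesis unfolding lhs[OF r t(2)] rhs[OF t(2)] by simp
    qed
    then have "\<forall>\<^sub>F n in sequentially. smear dome (t (k n)) (\<lambda>y. smear unif r (U (k n)) y - U (k n) y) x
        = r\<^sup>2 * smear dome (t (k n)) (smear dome r ?g) x"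
      unfolding eventually_sequentially by blast
    from Lim_transform_eventually[OF lim_lap[OF r] this] show ?thesis
      using lim_g[OF r] LIMSEQ_unique by blast
  qed
  show ?thesis using that[OF bu u_nonneg u_supp L(1) u_lip upper equal] by blast
qed

section \<open>Growth near the zero set\<close>

text \<open>The integral over the smaller ball is at most the one over the larger ball; only the volumes by which they are
divided remain to be compared.\<close>

lemma smear_unif_nested_le:
  fixes f :: "'a::euclidean_space \<Rightarrow> real"
  assumes f: "bdd_borel f" and nonneg: "\<And>x. 0 \<le> f x" and "0 < t" "0 < T" and sub: "ball x t \<subseteq> ball y T"
  shows "smear unif t f x \<le> (T / t) ^ DIM('a) * smear unif T f y"
proof -
  let ?V = "measure lborel (ball (0::'a) 1)"
  have [measurable]: "f \<in> borel_measurable borel" using f by (rule bdd_borel_measurable)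
  have int: "integrable lborel (\<lambda>y. indicator (ball z r) y * f y)" for z r
    by (rule integrable_mult_bdd[OF integrable_ball_indicator f])
  have "smear unif t f x = (\<integral>z. indicator (ball x t) z * f z \<partial>lborel) / (t ^ DIM('a) * ?V)"
    using assms by (simp add: smear_unif measure_ball_scale[of t x])
  also have "\<dots> \<le> (\<integral>z. indicator (ball y T) z * f z \<partial>lborel) / (t ^ DIM('a) * ?V)"
  proof (intro divide_right_mono integral_mono int)
    show "indicator (ball x t) z * f z \<le> indicator (ball y T) z * f z" for z
      using sub nonneg[of z] by (intro mult_right_mono) (auto simp: indicator_def)
  qed (use assms in auto)
  also have "\<dots> = (T / t) ^ DIM('a) * smear unif T f y"
    using assms by (simp add: smear_unif measure_ball_scale[of T y] power_divide)
  finally show ?thesis .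
qed

text \<open>This is the estimate that the square of the gradient of \<open>u\<close> is at most a constant times \<open>u\<close>. Comparing balls
around \<open>x\<close> with balls around the nearest zero of \<open>u\<close> shows that \<open>u x\<close> is at most \<open>C1\<close> times the square of the
distance to the zero set. So with \<open>\<tau> = sqrt (u x / C1)\<close> the ball of radius \<open>\<tau> / 2\<close> around \<open>x\<close> contains no
zero. On a smaller ball, averages over nested balls bound \<open>u\<close> by a multiple of \<open>u x\<close>, and the equation writes \<open>u\<close> near \<open>x\<close> as a ball average
of \<open>u\<close> minus a controlled term at radius \<open>\<tau> / 4\<close>; both have Lipschitz constants of order \<open>\<tau>\<close>.\<close>

lemma obstacle_gradient_bound:
  fixes u g :: "'a::euclidean_space \<Rightarrow> real"
  assumes bu: "bdd_borel u" and u_nonneg: "\<And>x. 0 \<le> u x" and cont: "continuous_on UNIV u"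
    and y0: "u y0 = 0" and bg: "bdd_borel g"
    and upper: "\<And>x r. 0 < r \<Longrightarrow> smear unif r u x - u x \<le> r\<^sup>2 * smear dome r g x"
    and equal: "\<And>x r. 0 < r \<Longrightarrow> (\<And>y. y \<in> cball x r \<Longrightarrow> 0 < u y) \<Longrightarrow>
       smear unif r u x - u x = r\<^sup>2 * smear dome r g x"
  obtains K c where "0 \<le> K" "0 < c"
    "\<And>x y. 0 < u x \<Longrightarrow> (norm (x - y))\<^sup>2 \<le> c * u x \<Longrightarrow> (u y - u x)\<^sup>2 \<le> K * u x * (norm (x - y))\<^sup>2"
proof -
  obtain G where G: "G \<ge> 0" "\<And>x. \<bar>g x\<bar> \<le> G" using bg by (metis bdd_borel_bound)
  define M where "M = G + 1"
  have M: "1 \<le> M" "\<bar>g x\<bar> \<le> M" for x using G(1) G(2)[of x] by (auto simp: M_def)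
  have Eg: "\<bar>r\<^sup>2 * smear dome r g x\<bar> \<le> M * r\<^sup>2" if "0 < r" for r x
  proof -
    have "\<bar>smear dome r g x\<bar> \<le> M" using that M(2) by (intro dome.smear_abs_le bg) auto
    then show ?thesis using mult_left_mono[of _ M "r\<^sup>2"] by (simp add: abs_mult mult.commute[of M])
  qed
  have up: "smear unif r u x \<le> u x + M * r\<^sup>2" if "0 < r" for r x
    using upper[OF that, of x] Eg[OF that, of x] by (simp add: abs_le_iff)
  have low: "u x \<le> smear unif r u x + M * r\<^sup>2" if "0 < r" "\<And>y. y \<in> cball x r \<Longrightarrow> 0 < u y" for r x
  proof -
    have "smear unif r u x - u x = r\<^sup>2 * smear dome r g x" by (rule equal[OF that(1)]) (rule that(2))
    then show ?thesis using Eg[OF that(1), of x] by (simp add: abs_le_iff)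
  qed
  define Q where "Q = (4::real) ^ DIM('a)"
  have Q: "1 \<le> Q" by (simp add: Q_def one_le_power)
  define C1 where "C1 = M * (4 * Q + 1)"
  have C1: "M \<le> C1" "0 < C1" using M Q by (simp_all add: C1_def)
  define E where "E = {x. u x = 0}"
  have E_closed: "closed E"
    unfolding E_def using continuous_closed_vimage[of "{0}" u] cont
    by (simp add: vimage_def continuous_on_eq_continuous_at)
  have E_ne: "E \<noteq> {}" using y0 by (auto simp: E_def)
  have inside: "0 < u z" if "dist x z < infdist x E" for x z
  proof -
    have "z \<notin> E" using that infdist_le[of z E x] by auto
    then show ?thesis using u_nonneg[of z] by (simp add: E_def less_le)
  qed
  have growth: "u x \<le> C1 * (infdist x E)\<^sup>2" if "0 < u x" for x
  proof -
    obtain y where y: "y \<in> E" "infdist x E = dist x y" using infdist_attains_inf[OF E_closed E_ne] by metis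
    define D where "D = infdist x E"
    have "x \<notin> E" using that by (simp add: E_def)
    then have D: "0 < D" using y by (auto simp: D_def)
    have "u x \<le> smear unif (D / 2) u x + M * (D / 2)\<^sup>2"
      using D by (intro low inside[of x]) (auto simp: D_def[symmetric])
    also have "smear unif (D / 2) u x \<le> ((2 * D) / (D / 2)) ^ DIM('a) * smear unif (2 * D) u y"
    proof (rule smear_unif_nested_le[OF bu u_nonneg])
      show "ball x (D / 2) \<subseteq> ball y (2 * D)"
      proof
        fix z assume "z \<in> ball x (D / 2)"
        then have "dist x z < D / 2" by simp
        moreover have "dist y z \<le> D + dist x z"
          using dist_triangle[of y z x] y(2) by (simp add: D_def dist_commute)
        ultimately show "z \<in> ball y (2 * D)" using D by simp
      qed
    qed (use D in auto)
    also have "(2 * D) / (D / 2) = 4" using D by simp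
    also have "4 ^ DIM('a) * smear unif (2 * D) u y \<le> Q * (M * (2 * D)\<^sup>2)"
      using up[of "2 * D" y] y(1) D by (simp add: E_def Q_def mult_left_mono)
    finally have "u x \<le> Q * (M * (2 * D)\<^sup>2) + M * (D / 2)\<^sup>2" by simp
    also have "\<dots> \<le> Q * (M * (2 * D)\<^sup>2) + M * D\<^sup>2"
      using M D by (intro add_left_mono mult_left_mono power_mono) auto
    also have "\<dots> = C1 * D\<^sup>2" by (simp add: C1_def power2_eq_square algebra_simps)
    finally show ?thesis by (simp add: D_def)
  qed
  obtain CA where CA: "mean_lipschitz (unif :: 'a measure) CA" by (rule smear_unif_lipschitz)
  obtain CE where CE: "mean_lipschitz (dome :: 'a measure) CE" by (rule smear_dome_lipschitz)
  define N where "N = 8 * Q * CA * C1 + M * CE"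
  have N: "0 \<le> N" using Q mean_lipschitz_nonneg[OF CA] C1 M mean_lipschitz_nonneg[OF CE] by (simp add: N_def)
  show ?thesis
  proof (rule that[of "N\<^sup>2 / C1" "1 / (64 * C1)"])
    show "0 \<le> N\<^sup>2 / C1" "0 < 1 / (64 * C1)" using C1 by auto
    fix x y
    assume ux: "0 < u x" and xy: "(norm (x - y))\<^sup>2 \<le> 1 / (64 * C1) * u x"
    define \<tau> where "\<tau> = sqrt (u x / C1)"
    have tau: "0 < \<tau>" "\<tau>\<^sup>2 = u x / C1" using ux C1 by (auto simp: \<tau>_def)
    have ut: "u x = C1 * \<tau>\<^sup>2" using tau C1 by simp
    have "(\<tau> / 8)\<^sup>2 = 1 / (64 * C1) * u x"
      unfolding power_divide tau(2) by simp
    then have "(norm (x - y))\<^sup>2 \<le> (\<tau> / 8)\<^sup>2" using xy by (simp only:)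
    then have dxy: "norm (x - y) \<le> \<tau> / 8"
      by (rule power2_le_imp_le) (use tau(1) in simp)
    have "\<tau>\<^sup>2 \<le> (infdist x E)\<^sup>2" using growth[OF ux] C1 by (simp add: ut)
    then have tau_le: "\<tau> \<le> infdist x E" by (rule power2_le_imp_le) (rule infdist_nonneg)
    have pos: "0 < u z" if "norm (x - z) \<le> \<tau> / 2" for z
      using that tau tau_le by (intro inside[of x]) (auto simp: dist_norm)
    have MT: "M * \<tau>\<^sup>2 \<le> u x" using C1 by (simp add: ut mult_right_mono)
    have sup: "u z \<le> 2 * Q * u x" if z: "norm (x - z) \<le> 3 * \<tau> / 8" for z
    proof -
      have tri: "norm (x - y) \<le> \<tau> / 2" if "norm (z - y) \<le> \<tau> / 8" for y
        using z that norm_triangle_ineq[of "x - z" "z - y"] by simp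
      have "u z \<le> smear unif (\<tau> / 8) u z + M * (\<tau> / 8)\<^sup>2"
        using tau by (intro low pos tri) (auto simp: dist_norm)
      also have "smear unif (\<tau> / 8) u z \<le> ((\<tau> / 2) / (\<tau> / 8)) ^ DIM('a) * smear unif (\<tau> / 2) u x"
      proof (rule smear_unif_nested_le[OF bu u_nonneg])
        show "ball z (\<tau> / 8) \<subseteq> ball x (\<tau> / 2)"
        proof
          fix y assume "y \<in> ball z (\<tau> / 8)"
          then show "y \<in> ball x (\<tau> / 2)"
            using z norm_triangle_ineq[of "x - z" "z - y"] by (simp add: dist_norm)
        qed
      qed (use tau in auto)
      also have "(\<tau> / 2) / (\<tau> / 8) = 4" using tau by simp
      also have "4 ^ DIM('a) * smear unif (\<tau> / 2) u x \<le> Q * (u x + M * (\<tau> / 2)\<^sup>2)"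
        using up[of "\<tau> / 2" x] tau by (simp add: Q_def mult_left_mono)
      finally have "u z \<le> Q * (u x + M * \<tau>\<^sup>2 / 4) + M * \<tau>\<^sup>2 / 64" by (simp add: power_divide)
      also have "\<dots> \<le> Q * (u x + u x / 4) + u x / 64"
        using MT Q by (intro add_mono mult_left_mono divide_right_mono) auto
      also have "\<dots> \<le> Q * (u x + u x / 4) + Q * (u x / 64)"
        using Q ux by simp
      also have "\<dots> = Q * u x * (81 / 64)" by (simp add: algebra_simps)
      also have "\<dots> \<le> Q * u x * 2" using Q ux by (intro mult_left_mono) auto
      finally show ?thesis by (simp add: mult_ac)
    qed
    define f where "f z = u z * indicator (cball x (3 * \<tau> / 8)) z" for z
    have [measurable]: "u \<in> borel_measurable borel" using bu by (rule bdd_borel_measurable)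
    have fm: "f \<in> borel_measurable borel" unfolding f_def[abs_def] by measurable
    have f_le: "\<bar>f z\<bar> \<le> 2 * Q * u x" for z
      using sup[of z] u_nonneg[of z] Q ux by (auto simp: f_def indicator_def dist_norm)
    have bf: "bdd_borel f" using fm f_le by (rule bdd_borelI)
    have Au: "smear unif (\<tau> / 4) u z = smear unif (\<tau> / 4) f z" if z: "norm (x - z) \<le> \<tau> / 8" for z
    proof (rule unif.smear_cong[OF bu bf])
      fix y assume "y \<in> cball z (\<tau> / 4)"
      then have "norm (x - y) \<le> 3 * \<tau> / 8"
        using z norm_triangle_ineq[of "x - z" "z - y"] by (simp add: dist_norm)
      then show "u y = f y" by (simp add: f_def dist_norm)
    qed (use tau in simp)
    have eq: "u z = smear unif (\<tau> / 4) u z - (\<tau> / 4)\<^sup>2 * smear dome (\<tau> / 4) g z" if z: "norm (x - z) \<le> \<tau> / 8" for z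
    proof -
      \<comment> \<open>The equation is available at \<open>z\<close> because this ball contains no zero.\<close>
      have "0 < u y" if "y \<in> cball z (\<tau> / 4)" for y
        using z that tau norm_triangle_ineq[of "x - z" "z - y"] by (intro pos) (simp add: dist_norm)
      then show ?thesis using equal[of "\<tau> / 4" z] tau by simp
    qed
    have t4: "0 < \<tau> / 4" using tau by simp
    have "u x - u y = (smear unif (\<tau> / 4) f x - smear unif (\<tau> / 4) f y)
        - (\<tau> / 4)\<^sup>2 * (smear dome (\<tau> / 4) g x - smear dome (\<tau> / 4) g y)"
      using eq[of x] eq[OF dxy] Au[of x] Au[OF dxy] tau by (simp add: right_diff_distrib)
    then have "\<bar>u x - u y\<bar> \<le> \<bar>smear unif (\<tau> / 4) f x - smear unif (\<tau> / 4) f y\<bar>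
        + (\<tau> / 4)\<^sup>2 * \<bar>smear dome (\<tau> / 4) g x - smear dome (\<tau> / 4) g y\<bar>"
      by (simp add: abs_mult order_trans[OF abs_triangle_ineq4])
    also have "\<dots> \<le> (2 * Q * u x) * CA * norm (x - y) / (\<tau> / 4)
        + (\<tau> / 4)\<^sup>2 * (M * CE * norm (x - y) / (\<tau> / 4))"
      by (intro add_mono mult_left_mono mean_lipschitzD[OF CA fm f_le t4]
          mean_lipschitzD[OF CE bdd_borel_measurable[OF bg] M(2) t4]) auto
    also have "\<dots> = (8 * Q * CA * C1 + M * CE / 4) * \<tau> * norm (x - y)"
      using tau(1) by (simp add: ut power2_eq_square field_simps)
    also have "\<dots> \<le> N * \<tau> * norm (x - y)"
      unfolding N_def using M mean_lipschitz_nonneg[OF CE] tau(1) by (intro mult_right_mono) auto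
    finally have "\<bar>u y - u x\<bar> \<le> N * \<tau> * norm (x - y)" by (simp add: abs_minus_commute)
    then have "(u y - u x)\<^sup>2 \<le> (N * \<tau> * norm (x - y))\<^sup>2" by (rule abs_le_square_iff[THEN iffD1, OF order_trans]) simp
    also have "\<dots> = N\<^sup>2 / C1 * u x * (norm (x - y))\<^sup>2" by (simp add: power_mult_distrib tau(2))
    finally show "(u y - u x)\<^sup>2 \<le> N\<^sup>2 / C1 * u x * (norm (x - y))\<^sup>2" .
  qed
qed

section \<open>Truncation\<close>

text \<open>A truncation that vanishes up to \<open>a\<close>, has slope one from \<open>2 * a\<close> on, and whose second derivative is at most
\<open>1 / a\<close>. Since it is a difference of two squared positive parts, its Taylor estimate reduces to that of one such
square.\<close>

definition soft :: "real \<Rightarrow> real \<Rightarrow> real" where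
  "soft a t = ((max 0 (t - a))\<^sup>2 - (max 0 (t - 2 * a))\<^sup>2) / (2 * a)"

definition soft_deriv :: "real \<Rightarrow> real \<Rightarrow> real" where
  "soft_deriv a t = (max 0 (t - a) - max 0 (t - 2 * a)) / a"

lemma soft_taylor:
  assumes "0 < a"
  shows "\<bar>soft a s - soft a t - soft_deriv a t * (s - t)\<bar> \<le> (s - t)\<^sup>2 / a"
proof -
  have pos: "0 \<le> ((max 0 s)\<^sup>2 - (max 0 t)\<^sup>2) - 2 * (max 0 t) * (s - t) \<and>
      ((max 0 s)\<^sup>2 - (max 0 t)\<^sup>2) - 2 * (max 0 t) * (s - t) \<le> (s - t)\<^sup>2" for s t :: real
  proof (cases "0 \<le> s"; cases "0 \<le> t")
    assume "0 \<le> s" "\<not> 0 \<le> t"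
    moreover from this have "s\<^sup>2 \<le> (s - t)\<^sup>2" by (intro power_mono) auto
    ultimately show ?thesis by (simp add: max_def)
  next
    assume "\<not> 0 \<le> s" "0 \<le> t"
    moreover from this have "0 \<le> t * (t - 2 * s)" by (intro mult_nonneg_nonneg) auto
    moreover have "0 \<le> s\<^sup>2" by simp
    ultimately show ?thesis by (simp add: max_def power2_eq_square algebra_simps)
  qed (use zero_le_power2[of "s - t"] in \<open>auto simp: max_def power2_eq_square algebra_simps\<close>)
  have p1: "0 \<le> (max 0 (s - a))\<^sup>2 - (max 0 (t - a))\<^sup>2 - 2 * max 0 (t - a) * (s - t)"
    "(max 0 (s - a))\<^sup>2 - (max 0 (t - a))\<^sup>2 - 2 * max 0 (t - a) * (s - t) \<le> (s - t)\<^sup>2"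
    using pos[of "s - a" "t - a"] by simp_all
  have p2: "0 \<le> (max 0 (s - 2 * a))\<^sup>2 - (max 0 (t - 2 * a))\<^sup>2 - 2 * max 0 (t - 2 * a) * (s - t)"
    "(max 0 (s - 2 * a))\<^sup>2 - (max 0 (t - 2 * a))\<^sup>2 - 2 * max 0 (t - 2 * a) * (s - t) \<le> (s - t)\<^sup>2"
    using pos[of "s - 2 * a" "t - 2 * a"] by simp_all
  have eq: "soft a s - soft a t - soft_deriv a t * (s - t)
    = (((max 0 (s - a))\<^sup>2 - (max 0 (t - a))\<^sup>2 - 2 * max 0 (t - a) * (s - t))
      - ((max 0 (s - 2 * a))\<^sup>2 - (max 0 (t - 2 * a))\<^sup>2 - 2 * max 0 (t - 2 * a) * (s - t))) / (2 * a)"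
    using assms by (simp add: soft_def soft_deriv_def field_simps)
  have "\<bar>soft a s - soft a t - soft_deriv a t * (s - t)\<bar> \<le> (s - t)\<^sup>2 / (2 * a)"
    unfolding eq abs_divide using p1 p2 assms by (simp add: divide_right_mono abs_le_iff)
  also have "\<dots> \<le> (s - t)\<^sup>2 / a" using assms by (intro divide_left_mono) auto
  finally show ?thesis .
qed

lemma soft_eq_0: "0 < a \<Longrightarrow> t \<le> a \<Longrightarrow> soft a t = 0"
  by (simp add: soft_def max_def)

lemma soft_nonneg: "0 < a \<Longrightarrow> 0 \<le> soft a t"
  unfolding soft_def by (intro divide_nonneg_pos) (auto simp: max_def intro!: power_mono)

lemma soft_linear: "0 < a \<Longrightarrow> 2 * a \<le> t \<Longrightarrow> soft a t = t - 3 * a / 2"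
  by (simp add: soft_def max_def power2_eq_square field_simps)

lemma soft_deriv_bounds: "0 < a \<Longrightarrow> 0 \<le> soft_deriv a t \<and> soft_deriv a t \<le> 1"
  by (auto simp: soft_deriv_def max_def field_simps)

lemma soft_deriv_linear: "0 < a \<Longrightarrow> 2 * a \<le> t \<Longrightarrow> soft_deriv a t = 1"
  by (simp add: soft_deriv_def max_def)

lemma continuous_soft: "continuous_on A (soft a)"
  unfolding soft_def by (cases "a = 0") (auto intro!: continuous_intros)

lemma soft_le: "0 < a \<Longrightarrow> 0 \<le> t \<Longrightarrow> soft a t \<le> t"
proof -
  assume a: "0 < a" and t: "0 \<le> t"
  consider "t \<le> a" | "a < t" "t < 2 * a" | "2 * a \<le> t" by linarith
  then show "soft a t \<le> t"
  proof cases
    case 2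
    have "(t - a)\<^sup>2 \<le> (t - a) * a" unfolding power2_eq_square using 2 by (intro mult_left_mono) auto
    also have "\<dots> \<le> t * (2 * a)" using 2 a by (intro mult_mono) auto
    finally show ?thesis using 2 a by (simp add: soft_def max_def divide_le_eq)
  qed (use a t in \<open>auto simp: soft_eq_0 soft_linear\<close>)
qed

lemma bdd_borel_soft:
  assumes bu: "bdd_borel u" and nonneg: "\<And>x. 0 \<le> u x" and a: "0 < a"
  shows "bdd_borel (\<lambda>x. soft a (u x))"
proof -
  obtain Z where Z: "\<And>x. \<bar>u x\<bar> \<le> Z" using bu by (metis bdd_borel_bound)
  have "(\<lambda>x. soft a (u x)) \<in> borel_measurable borel"
    using measurable_comp[OF bdd_borel_measurable[OF bu] borel_measurable_continuous_onI[OF continuous_soft[of UNIV a]]]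
    by (simp add: o_def)
  moreover have "\<bar>soft a (u x)\<bar> \<le> Z" for x
    using soft_nonneg[OF a, of "u x"] soft_le[OF a nonneg, of x] Z[of x] by linarith
  ultimately show ?thesis by (rule bdd_borelI)
qed

text \<open>The truncation level is proportional to the radius, so that a ball of radius \<open>r\<close> around a point where the
truncated function is positive contains no zero of \<open>u\<close>. The second-order error of the truncation at a point is at
most the square of the oscillation of \<open>u\<close> divided by \<open>B * r\<close>. Where \<open>u\<close> is comparable with \<open>B * r\<close>, the gradient
bound makes this at most a constant times \<open>r\<^sup>2\<close>; elsewhere the truncation is affine in the range of \<open>u\<close>.\<close>

lemma truncated_odometer:
  fixes u g :: "'a::euclidean_space \<Rightarrow> real"
  assumes bu: "bdd_borel u" and u_nonneg: "\<And>x. 0 \<le> u x"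
    and L: "0 \<le> L" "\<And>x y. norm (x - y) \<le> 1 \<Longrightarrow> \<bar>u x - u y\<bar> \<le> L * norm (x - y)"
    and y0: "u y0 = 0" and bg: "bdd_borel g"
    and upper: "\<And>x r. 0 < r \<Longrightarrow> smear unif r u x - u x \<le> r\<^sup>2 * smear dome r g x"
    and equal: "\<And>x r. 0 < r \<Longrightarrow> (\<And>y. y \<in> cball x r \<Longrightarrow> 0 < u y) \<Longrightarrow>
       smear unif r u x - u x = r\<^sup>2 * smear dome r g x"
  obtains B C where "0 < B" "0 \<le> C"
    "\<And>r x y. 0 < r \<Longrightarrow> r \<le> 1 \<Longrightarrow> B * r < u x \<Longrightarrow> y \<in> cball x r \<Longrightarrow> 0 < u y"
    "\<And>r x. 0 < r \<Longrightarrow> r \<le> 1 \<Longrightarrow>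
       \<bar>smear unif r (\<lambda>y. soft (B * r) (u y)) x - soft (B * r) (u x)\<bar> \<le> C * r\<^sup>2"
    "\<And>r x. 0 < r \<Longrightarrow> r \<le> 1 \<Longrightarrow> 3 * B * r < u x \<Longrightarrow>
       smear unif r (\<lambda>y. soft (B * r) (u y)) x - soft (B * r) (u x) = r\<^sup>2 * smear dome r g x"
proof -
  have cont: "continuous_on UNIV u" using L by (rule locally_lipschitz_continuous)
  obtain K c where K: "0 \<le> K" "0 < c"
    "\<And>x y. 0 < u x \<Longrightarrow> (norm (x - y))\<^sup>2 \<le> c * u x \<Longrightarrow> (u y - u x)\<^sup>2 \<le> K * u x * (norm (x - y))\<^sup>2"
    using obstacle_gradient_bound[OF bu u_nonneg cont y0 bg upper equal] by blast
  obtain M where M: "M \<ge> 0" "\<And>x. \<bar>g x\<bar> \<le> M" using bg by (metis bdd_borel_bound)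
  have Eg: "\<bar>r\<^sup>2 * smear dome r g x\<bar> \<le> M * r\<^sup>2" if "0 < r" for r x
  proof -
    have "\<bar>smear dome r g x\<bar> \<le> M" using that M(2) by (intro dome.smear_abs_le bg) auto
    then show ?thesis using mult_left_mono[of _ M "r\<^sup>2"] by (simp add: abs_mult mult.commute[of M])
  qed
  define B where "B = 2 * L + 1 + 2 / c"
  have B: "0 < B" "2 * L < B" "2 / c \<le> B" using L(1) K(2) by (auto simp: B_def add_pos_pos)
  have osc: "\<bar>u y - u x\<bar> < B * r / 2" if "0 < r" "r \<le> 1" "y \<in> cball x r" for r x y
  proof -
    have "\<bar>u x - u y\<bar> \<le> L * norm (x - y)" using that by (intro L(2)) (simp add: dist_norm)
    also have "\<dots> \<le> L * r" using that L(1) by (intro mult_left_mono) (auto simp: dist_norm)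
    also have "\<dots> < B / 2 * r" using that B(2) by (intro mult_strict_right_mono) auto
    finally show ?thesis by (simp add: abs_minus_commute)
  qed
  have bsoft: "bdd_borel (\<lambda>y. soft a (u y))" if "0 < a" for a
    by (rule bdd_borel_soft[OF bu u_nonneg that])
  have core: "\<bar>(smear unif r (\<lambda>y. soft (B * r) (u y)) x - soft (B * r) (u x))
      - soft_deriv (B * r) (u x) * (smear unif r u x - u x)\<bar> \<le> e"
    if r: "0 < r" and e: "\<And>y. y \<in> cball x r \<Longrightarrow>
      \<bar>soft (B * r) (u y) - soft (B * r) (u x) - soft_deriv (B * r) (u x) * (u y - u x)\<bar> \<le> e" for r x e
  proof -
    have a: "0 < B * r" using B r by simp
    let ?s = "soft (B * r)" and ?d = "soft_deriv (B * r) (u x)"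
    have "\<bar>smear unif r (\<lambda>y. (?s (u y) - ?s (u x)) - ?d * (u y - u x)) x\<bar> \<le> e"
      using e r by (intro unif.smear_abs_le bdd_borel_diff bdd_borel_cmult bsoft[OF a] bu bdd_borel_const) auto
    also have "smear unif r (\<lambda>y. (?s (u y) - ?s (u x)) - ?d * (u y - u x)) x
       = (smear unif r (\<lambda>y. ?s (u y)) x - ?s (u x)) - ?d * (smear unif r u x - u x)"
      by (simp only: unif.smear_diff unif.smear_cmult unif.smear_const bsoft[OF a] bu bdd_borel_diff bdd_borel_cmult bdd_borel_const)
    finally show ?thesis .
  qed
  have inside: "0 < u y" if "0 < r" "r \<le> 1" "B * r / 2 < u x" "y \<in> cball x r" for r x y
    using osc[OF that(1,2,4)] that(3) by linarith
  have lin: "smear unif r (\<lambda>y. soft (B * r) (u y)) x - soft (B * r) (u x) = r\<^sup>2 * smear dome r g x"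
    if r: "0 < r" "r \<le> 1" and ux: "3 * B * r < u x" for r x
  proof -
    have a: "0 < B * r" using B r by simp
    have "\<bar>(smear unif r (\<lambda>y. soft (B * r) (u y)) x - soft (B * r) (u x))
      - soft_deriv (B * r) (u x) * (smear unif r u x - u x)\<bar> \<le> 0"
    proof (rule core[OF r(1)])
      fix y assume "y \<in> cball x r"
      then have "2 * (B * r) \<le> u y" "2 * (B * r) \<le> u x" using osc[OF r, of y x] ux a by linarith+
      then show "\<bar>soft (B * r) (u y) - soft (B * r) (u x) - soft_deriv (B * r) (u x) * (u y - u x)\<bar> \<le> 0"
        using a by (simp add: soft_linear soft_deriv_linear)
    qed
    moreover have "soft_deriv (B * r) (u x) = 1" using a ux by (intro soft_deriv_linear) auto
    moreover have "smear unif r u x - u x = r\<^sup>2 * smear dome r g x"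
      using a ux by (intro equal r inside[OF r]) auto
    ultimately show ?thesis by simp
  qed
  have bound: "\<bar>smear unif r (\<lambda>y. soft (B * r) (u y)) x - soft (B * r) (u x)\<bar> \<le> (M + 3 * K) * r\<^sup>2"
    if r: "0 < r" "r \<le> 1" for r x
  proof -
    have a: "0 < B * r" using B r by simp
    \<comment> \<open>The truncation is zero near \<open>x\<close>, curved near \<open>x\<close>, or affine near \<open>x\<close>.\<close>
    consider "u x \<le> B * r / 2" | "B * r / 2 < u x" "u x \<le> 3 * B * r" | "3 * B * r < u x" by linarith
    then show ?thesis
    proof cases
      case 1
      have z: "soft (B * r) (u y) = 0" if "y \<in> cball x r" for y
        using osc[OF r that] 1 by (intro soft_eq_0 a) linarith
      have "smear unif r (\<lambda>y. soft (B * r) (u y)) x = smear unif r (\<lambda>y. 0) x"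
        using z r by (intro unif.smear_cong bsoft a bdd_borel_const) auto
      then show ?thesis using z[of x] r M K by (simp add: unif.smear_const)
    next
      case 2
      have ux: "0 < u x" using 2 a by linarith
      have "\<bar>(smear unif r (\<lambda>y. soft (B * r) (u y)) x - soft (B * r) (u x))
        - soft_deriv (B * r) (u x) * (smear unif r u x - u x)\<bar> \<le> 3 * K * r\<^sup>2"
      proof (rule core[OF r(1)])
        fix y assume "y \<in> cball x r"
        then have n: "norm (x - y) \<le> r" by (simp add: dist_norm)
        have "(norm (x - y))\<^sup>2 \<le> r\<^sup>2" using n by (intro power_mono) auto
        also have "\<dots> \<le> r * 1" unfolding power2_eq_square using r by (intro mult_left_mono) auto
        also have "\<dots> \<le> r * (c * B / 2)"
          using r B(3) K(2) by (intro mult_left_mono) (auto simp: divide_le_eq mult.commute)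
        also have "\<dots> = c * (B * r / 2)" by simp
        also have "\<dots> \<le> c * u x" using 2 K(2) by (intro mult_left_mono) auto
        finally have "(u y - u x)\<^sup>2 \<le> K * u x * (norm (x - y))\<^sup>2" by (rule K(3)[OF ux])
        also have "\<dots> \<le> K * (3 * (B * r)) * r\<^sup>2"
          using 2 K(1) ux n by (intro mult_mono power_mono) (auto simp: mult.assoc)
        finally have "(u y - u x)\<^sup>2 / (B * r) \<le> (K * (3 * (B * r)) * r\<^sup>2) / (B * r)"
          using a by (intro divide_right_mono) auto
        also have "\<dots> = 3 * K * r\<^sup>2" using B(1) r(1) by simp
        finally show "\<bar>soft (B * r) (u y) - soft (B * r) (u x) - soft_deriv (B * r) (u x) * (u y - u x)\<bar> \<le> 3 * K * r\<^sup>2"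
          using soft_taylor[OF a, of "u y" "u x"] by linarith
      qed
      moreover have "\<bar>soft_deriv (B * r) (u x) * (smear unif r u x - u x)\<bar> \<le> 1 * (M * r\<^sup>2)"
        unfolding abs_mult
      proof (rule mult_mono)
        show "\<bar>soft_deriv (B * r) (u x)\<bar> \<le> 1" using soft_deriv_bounds[OF a, of "u x"] by simp
        have "smear unif r u x - u x = r\<^sup>2 * smear dome r g x"
          using 2 by (intro equal r inside[OF r]) auto
        then show "\<bar>smear unif r u x - u x\<bar> \<le> M * r\<^sup>2" using Eg[OF r(1)] by simp
      qed auto
      ultimately show ?thesis by (simp add: distrib_right)
    next
      case 3
      have "\<bar>r\<^sup>2 * smear dome r g x\<bar> \<le> M * r\<^sup>2" using Eg r by simp
      also have "\<dots> \<le> (M + 3 * K) * r\<^sup>2" using K by (intro mult_right_mono) auto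
      finally show ?thesis using lin[OF r 3] by simp
    qed
  qed
  show ?thesis
  proof (rule that[of B "M + 3 * K"])
    show "0 < u y" if "0 < r" "r \<le> 1" "B * r < u x" "y \<in> cball x r" for r x y
    proof -
      have "B * r / 2 < u x" using that(3) mult_pos_pos[OF B(1) that(1)] by linarith
      then show ?thesis by (rule inside[OF that(1,2) _ that(4)])
    qed
    show "0 \<le> M + 3 * K" using M(1) K(1) by simp
  qed (fact B(1) bound lin)+
qed

section \<open>Pairing and convergence in mean\<close>

context ball_law begin

text \<open>With two shifts this covers an integrand both before and after a translation in the space variable moves the
shift from one factor to the other.\<close>

lemma product_integrable:
  assumes H: "integrable lborel H" and v: "bdd_borel v"
  shows "integrable (\<mu> \<Otimes>\<^sub>M lborel) (\<lambda>p. H (snd p + c *\<^sub>R fst p) * v (snd p + r *\<^sub>R fst p))"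
proof -
  interpret P: pair_sigma_finite \<mu> lborel ..
  have [measurable]: "H \<in> borel_measurable borel" using H by auto
  have [measurable]: "v \<in> borel_measurable borel" using v by (rule bdd_borel_measurable)
  obtain C where C: "0 \<le> C" "\<And>x. \<bar>v x\<bar> \<le> C" using v by (metis bdd_borel_bound)
  have bnd: "norm (H (x + a) * v (x + b)) \<le> \<bar>H (x + a)\<bar> * C" for x a b
    unfolding real_norm_def abs_mult by (intro mult_left_mono C) simp
  have int: "integrable lborel (\<lambda>x. \<bar>H (x + a)\<bar> * C)" for a
    by (intro integrable_mult_left integrable_abs lborel_integrable_translate H)
  have int': "integrable lborel (\<lambda>x. H (x + a) * v (x + b))" for a b
    by (rule integrable_mult_bdd[OF lborel_integrable_translate[OF H] bdd_borel_translate[OF v]])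
  show ?thesis
  proof (rule P.Fubini_integrable)
    show "(\<lambda>p. H (snd p + c *\<^sub>R fst p) * v (snd p + r *\<^sub>R fst p)) \<in> borel_measurable (\<mu> \<Otimes>\<^sub>M lborel)"
      by measurable
    show "AE y in \<mu>. integrable lborel (\<lambda>x. H (snd (y, x) + c *\<^sub>R fst (y, x)) * v (snd (y, x) + r *\<^sub>R fst (y, x)))"
      using int' by simp
    show "integrable \<mu> (\<lambda>y. \<integral>x. norm (H (snd (y, x) + c *\<^sub>R fst (y, x)) * v (snd (y, x) + r *\<^sub>R fst (y, x))) \<partial>lborel)"
    proof (rule integrable_const_bound[where B="(\<integral>x. \<bar>H x\<bar> \<partial>lborel) * C"])
      show "(\<lambda>y. \<integral>x. norm (H (snd (y, x) + c *\<^sub>R fst (y, x)) * v (snd (y, x) + r *\<^sub>R fst (y, x))) \<partial>lborel) \<in> borel_measurable \<mu>"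
        by (intro lborel.borel_measurable_lebesgue_integral) (simp add: split_beta')
      show "AE y in \<mu>. norm (\<integral>x. norm (H (snd (y, x) + c *\<^sub>R fst (y, x)) * v (snd (y, x) + r *\<^sub>R fst (y, x))) \<partial>lborel) \<le> (\<integral>x. \<bar>H x\<bar> \<partial>lborel) * C"
      proof (rule AE_I2)
        fix y
        have "(\<integral>x. norm (H (x + c *\<^sub>R y) * v (x + r *\<^sub>R y)) \<partial>lborel) \<le> (\<integral>x. \<bar>H (x + c *\<^sub>R y)\<bar> * C \<partial>lborel)"
          by (intro integral_mono integrable_norm int' int bnd)
        also have "\<dots> = (\<integral>x. \<bar>H x\<bar> \<partial>lborel) * C"
          using lborel_integral_translate[of "\<lambda>x. \<bar>H x\<bar>" "c *\<^sub>R y"] by simp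
        finally show "norm (\<integral>x. norm (H (snd (y, x) + c *\<^sub>R fst (y, x)) * v (snd (y, x) + r *\<^sub>R fst (y, x))) \<partial>lborel) \<le> (\<integral>x. \<bar>H x\<bar> \<partial>lborel) * C"
          by simp
      qed
    qed
  qed
qed

text \<open>The adjoint of a convolution is the convolution with the reflected law.\<close>

lemma smear_adjoint:
  assumes H: "integrable lborel H" and v: "bdd_borel v"
  shows "(\<integral>x. H x * smear \<mu> r v x \<partial>lborel) = (\<integral>x. smear \<mu> (- r) H x * v x \<partial>lborel)"
    and "integrable lborel (\<lambda>x. smear \<mu> (- r) H x * v x)"
proof -
  interpret P: pair_sigma_finite \<mu> lborel ..
  have [measurable]: "H \<in> borel_measurable borel" using H by auto
  have [measurable]: "v \<in> borel_measurable borel" using v by (rule bdd_borel_measurable)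
  let ?f = "\<lambda>y x. H x * v (x + r *\<^sub>R y)" and ?g = "\<lambda>y x. H (x + (- r) *\<^sub>R y) * v x"
  have f: "integrable (\<mu> \<Otimes>\<^sub>M lborel) (case_prod ?f)" and g: "integrable (\<mu> \<Otimes>\<^sub>M lborel) (case_prod ?g)"
    using product_integrable[OF H v, of 0 r] product_integrable[OF H v, of "-r" 0]
    by (simp_all add: split_beta')
  have "(\<integral>x. H x * smear \<mu> r v x \<partial>lborel) = (\<integral>x. (\<integral>y. ?f y x \<partial>\<mu>) \<partial>lborel)"
    by (simp add: smear_def)
  also have "\<dots> = (\<integral>y. (\<integral>x. ?f y x \<partial>lborel) \<partial>\<mu>)"
    by (rule P.Fubini_integral[OF f])
  also have "\<dots> = (\<integral>y. (\<integral>x. ?g y x \<partial>lborel) \<partial>\<mu>)"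
  proof (rule Bochner_Integration.integral_cong[OF refl])
    fix y
    show "(\<integral>x. ?f y x \<partial>lborel) = (\<integral>x. ?g y x \<partial>lborel)"
      using lborel_integral_translate[of "?f y" "(- r) *\<^sub>R y"] by simp
  qed
  also have "\<dots> = (\<integral>x. (\<integral>y. ?g y x \<partial>\<mu>) \<partial>lborel)"
    by (rule P.Fubini_integral[OF g, symmetric])
  finally show "(\<integral>x. H x * smear \<mu> r v x \<partial>lborel) = (\<integral>x. smear \<mu> (- r) H x * v x \<partial>lborel)"
    by (simp add: smear_def)
  show "integrable lborel (\<lambda>x. smear \<mu> (- r) H x * v x)"
    using P.integrable_snd[OF g] by (simp add: smear_def)
qed

lemma smear_integral:
  assumes "integrable lborel H"
  shows "integrable lborel (smear \<mu> r H)" "(\<integral>x. smear \<mu> r H x \<partial>lborel) = (\<integral>x. H x \<partial>lborel)"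
  using smear_adjoint[OF assms bdd_borel_const[of 1], of "- r"] by (simp_all add: smear_const)

end

lemma smear_unif_minus:
  assumes [measurable]: "H \<in> borel_measurable borel"
  shows "smear unif (- r) H x = smear unif r H x"
proof -
  have "(\<integral>z. indicator (ball 0 1) z * H (x + r *\<^sub>R z) \<partial>lborel)
      = (\<integral>z. indicator (ball 0 1) (- z) * H (x + r *\<^sub>R (- z)) \<partial>lborel)"
    using lborel_integral_affine[of "\<lambda>z. indicator (ball 0 1) z * H (x + r *\<^sub>R z)" "-1" 0] by simp
  also have "\<dots> = (\<integral>z. indicator (ball 0 1) z * H (x + (- r) *\<^sub>R z) \<partial>lborel)"
    by (intro Bochner_Integration.integral_cong) (auto simp: indicator_def)
  finally show ?thesis
    unfolding smear_def by (subst (1 2) integral_unif) auto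
qed

text \<open>This is the integral of \<open>H\<close> times the Laplacian of \<open>v\<close>, integrated by parts: the ball average is moved from \<open>v\<close>
to \<open>H\<close>, where the sub-mean value inequality applies on the set where \<open>v\<close> is positive.\<close>

lemma submean_pairing_nonneg:
  assumes H: "integrable lborel H" and v: "bdd_borel v" "\<And>x. 0 \<le> v x"
    and sub: "AE x in lborel. 0 < v x \<longrightarrow> H x \<le> smear unif r H x"
  shows "0 \<le> (\<integral>x. H x * (smear unif r v x - v x) \<partial>lborel)"
proof -
  have Hm [measurable]: "H \<in> borel_measurable borel" using H by auto
  have int: "integrable lborel (\<lambda>x. H x * f x)" if "bdd_borel f" for f
    by (rule integrable_mult_bdd[OF H that])
  note adj = unif.smear_adjoint[OF H v(1), of r, unfolded smear_unif_minus[OF Hm]]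
  have "0 \<le> (\<integral>x. smear unif r H x * v x - H x * v x \<partial>lborel)"
  proof (rule integral_nonneg_AE)
    show "AE x in lborel. 0 \<le> smear unif r H x * v x - H x * v x"
      using sub
    proof eventually_elim
      case (elim x)
      then show ?case using v(2)[of x] by (cases "v x = 0") (auto simp: mult_right_mono)
    qed
  qed
  also have "\<dots> = (\<integral>x. smear unif r H x * v x \<partial>lborel) - (\<integral>x. H x * v x \<partial>lborel)"
    by (intro Bochner_Integration.integral_diff adj(2) int v)
  also have "\<dots> = (\<integral>x. H x * smear unif r v x - H x * v x \<partial>lborel)"
    by (subst Bochner_Integration.integral_diff) (auto intro: int v unif.bdd_borel_smear simp: adj(1))
  finally show ?thesis by (simp add: right_diff_distrib)
qed

lemma L1_continuous_approximation:
  fixes w :: "'a::euclidean_space \<Rightarrow> real"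
  assumes w: "bdd_borel w" and e: "0 < e"
  obtains h where "bdd_borel h" "continuous_on UNIV h" "(\<integral>x. indicator (ball 0 R) x * \<bar>w x - h x\<bar> \<partial>lborel) < e"
proof -
  obtain C where C: "0 \<le> C" "\<And>x. \<bar>w x\<bar> \<le> C" using w by (metis bdd_borel_bound)
  have [measurable]: "w \<in> borel_measurable borel" using w by (rule bdd_borel_measurable)
  have "w \<in> borel_measurable lebesgue" by (simp add: measurable_completion)
  then have "w measurable_on UNIV" by (intro lebesgue_measurable_imp_measurable_on) auto
  then obtain N g where N: "negligible N" and g: "\<And>n::nat. continuous_on UNIV (g n)"
    "\<And>x. x \<notin> N \<Longrightarrow> (\<lambda>n. g n x) \<longlonglongrightarrow> w x"
    unfolding measurable_on_def by auto
  define h where "h n x = max (- C) (min C (g n x))" for n x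
  have h_cont: "continuous_on UNIV (h n)" for n
    unfolding h_def by (intro continuous_intros g)
  have h_bd: "\<bar>h n x\<bar> \<le> C" for n x using C(1) by (auto simp: h_def abs_le_iff)
  have bh: "bdd_borel (h n)" for n
    by (rule bdd_borelI[OF borel_measurable_continuous_onI[OF h_cont] h_bd])
  have [measurable]: "h n \<in> borel_measurable borel" for n using bh by (rule bdd_borel_measurable)
  have lim: "(\<lambda>n. h n x) \<longlonglongrightarrow> w x" if "x \<notin> N" for x
  proof -
    have "(\<lambda>n. h n x) \<longlonglongrightarrow> max (- C) (min C (w x))"
      unfolding h_def by (intro tendsto_intros g(2) that)
    moreover have "max (- C) (min C (w x)) = w x" using C(2)[of x] by (auto simp: abs_le_iff)
    ultimately show ?thesis by simp
  qed
  have AE_N: "AE x in lborel. x \<notin> N"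
  proof -
    have "N \<in> null_sets lebesgue" using N by (simp add: negligible_iff_null_sets)
    then have "AE x in lebesgue. x \<notin> N" by (rule AE_not_in)
    then show ?thesis by (simp add: AE_completion_iff)
  qed
  have "(\<lambda>n. \<integral>x. indicator (ball 0 R) x * \<bar>w x - h n x\<bar> \<partial>lborel) \<longlonglongrightarrow> (\<integral>x. (0::real) \<partial>(lborel :: 'a measure))"
  proof (rule integral_dominated_convergence[where w="\<lambda>x. indicator (ball 0 R) x * (2 * C)"])
    show "integrable lborel (\<lambda>x::'a. indicator (ball 0 R) x * (2 * C))"
      by (intro integrable_mult_left integrable_ball_indicator)
    show "AE x in lborel. (\<lambda>n. indicator (ball 0 R) x * \<bar>w x - h n x\<bar>) \<longlonglongrightarrow> 0"
      using AE_N
    proof eventually_elim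
      case (elim x)
      have "(\<lambda>n. indicator (ball 0 R) x * \<bar>w x - h n x\<bar>) \<longlonglongrightarrow> indicator (ball 0 R) x * \<bar>w x - w x\<bar>"
        by (intro tendsto_intros lim elim)
      then show ?case by simp
    qed
    show "AE x in lborel. norm (indicator (ball 0 R) x * \<bar>w x - h n x\<bar>) \<le> indicator (ball 0 R) x * (2 * C)" for n
    proof (rule AE_I2)
      fix x
      have "\<bar>w x - h n x\<bar> \<le> 2 * C" using C(2)[of x] h_bd[of n x] by linarith
      then show "norm (indicator (ball 0 R) x * \<bar>w x - h n x\<bar>) \<le> indicator (ball 0 R) x * (2 * C)"
        by (auto simp: indicator_def)
    qed
  qed measurable
  then have "(\<lambda>n. \<integral>x. indicator (ball 0 R) x * \<bar>w x - h n x\<bar> \<partial>lborel) \<longlonglongrightarrow> 0" by simp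
  from order_tendstoD(2)[OF this e] obtain n where "(\<integral>x. indicator (ball 0 R) x * \<bar>w x - h n x\<bar> \<partial>lborel) < e"
    unfolding eventually_sequentially by blast
  then show ?thesis using that bh h_cont by blast
qed

text \<open>The averages are contractions in mean, so \<open>w\<close> may be replaced by a continuous function that is close to it
in mean, for which the convergence is pointwise and bounded.\<close>

lemma (in ball_law) smear_L1_tendsto:
  assumes w: "bdd_borel w" and supp: "\<And>x. R0 < norm x \<Longrightarrow> w x = 0"
    and t: "t \<longlonglongrightarrow> 0" "\<And>n. 0 < t n" "\<And>n. t n \<le> 1"
  shows "integrable lborel (\<lambda>x. smear \<mu> (t n) w x - w x)"
    and "(\<lambda>n. \<integral>x. norm (smear \<mu> (t n) w x - w x) \<partial>lborel) \<longlonglongrightarrow> 0"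
proof -
  define R where "R = R0 + 2"
  have [measurable]: "w \<in> borel_measurable borel" using w by (rule bdd_borel_measurable)
  have int_ind: "integrable lborel (\<lambda>x. indicator (ball z \<rho>) x * f x)" if "bdd_borel f" for z \<rho> f
    by (rule integrable_mult_bdd[OF integrable_ball_indicator that])
  have w_ind: "(\<lambda>x. indicator (ball 0 R) x * w x) = w"
  proof
    fix x show "indicator (ball 0 R) x * w x = w x"
      using supp[of x] by (cases "norm x < R") (auto simp: R_def)
  qed
  have int_w: "integrable lborel w" using int_ind[OF w, of 0 R] by (simp add: w_ind)
  show "integrable lborel (\<lambda>x. smear \<mu> (t n) w x - w x)" for n
    by (intro Bochner_Integration.integrable_diff smear_integral int_w)
  have out: "smear \<mu> (t n) w x - w x = 0" if "x \<notin> ball 0 R" for n x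
  proof -
    have "smear \<mu> (t n) w x = smear \<mu> (t n) (\<lambda>_. 0) x"
    proof (rule smear_cong[OF w bdd_borel_const])
      fix y assume "y \<in> cball x (t n)"
      then have "R0 < norm y"
        using that t(3)[of n] norm_triangle_ineq2[of x "x - y"] by (simp add: dist_norm R_def)
      then show "w y = 0" by (rule supp)
    qed (use t(2)[of n] in simp)
    moreover have "w x = 0" using that by (intro supp) (simp add: R_def)
    ultimately show ?thesis by (simp add: smear_const)
  qed
  show "(\<lambda>n. \<integral>x. norm (smear \<mu> (t n) w x - w x) \<partial>lborel) \<longlonglongrightarrow> 0"
  proof (rule LIMSEQ_I)
    fix e :: real assume e: "0 < e"
    obtain h where h: "bdd_borel h" "continuous_on UNIV h"
      "(\<integral>x. indicator (ball 0 (R + 2)) x * \<bar>w x - h x\<bar> \<partial>lborel) < e / 4"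
      using L1_continuous_approximation[OF w, of "e / 4" "R + 2"] e by auto
    obtain C where C: "0 \<le> C" "\<And>x. \<bar>h x\<bar> \<le> C" using h(1) by (metis bdd_borel_bound)
    have [measurable]: "h \<in> borel_measurable borel" using h(1) by (rule bdd_borel_measurable)
    let ?F = "\<lambda>x. indicator (ball 0 (R + 2)) x * \<bar>w x - h x\<bar>"
    have bwh: "bdd_borel (\<lambda>x. \<bar>w x - h x\<bar>)"
    proof -
      obtain D where "\<And>x. \<bar>w x - h x\<bar> \<le> D"
        using bdd_borel_diff[OF w h(1)] by (metis bdd_borel_bound)
      then show ?thesis by (intro bdd_borelI[where C=D]) auto
    qed
    have bF: "bdd_borel ?F"
    proof -
      obtain D where D: "0 \<le> D" "\<And>x. \<bar>w x - h x\<bar> \<le> D"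
        by (rule bdd_borel_bound[OF bdd_borel_diff[OF w h(1)]]) (rule that)
      have "\<bar>?F x\<bar> \<le> D" for x
        using D by (cases "x \<in> ball 0 (R + 2)") auto
      moreover have "?F \<in> borel_measurable borel" by measurable
      ultimately show ?thesis by (rule bdd_borelI[rotated])
    qed
    have int_F: "integrable lborel ?F" by (rule int_ind[OF bwh])
    have hlim: "(\<lambda>n. \<integral>x. indicator (ball 0 R) x * \<bar>smear \<mu> (t n) h x - h x\<bar> \<partial>lborel) \<longlonglongrightarrow> (\<integral>x. (0::real) \<partial>(lborel :: 'a measure))"
    proof (rule integral_dominated_convergence[where w="\<lambda>x. indicator (ball 0 R) x * (2 * C)"])
      show "integrable lborel (\<lambda>x::'a. indicator (ball 0 R) x * (2 * C))"
        by (intro integrable_mult_left integrable_ball_indicator)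
      have [measurable]: "smear \<mu> (t n) h \<in> borel_measurable borel" for n
        by (intro bdd_borel_measurable bdd_borel_smear h)
      show "(\<lambda>x. indicator (ball 0 R) x * \<bar>smear \<mu> (t n) h x - h x\<bar>) \<in> borel_measurable lborel" for n
        by measurable
      show "AE x in lborel. (\<lambda>n. indicator (ball 0 R) x * \<bar>smear \<mu> (t n) h x - h x\<bar>) \<longlonglongrightarrow> 0"
      proof (rule AE_I2)
        fix x
        have "(\<lambda>n. smear \<mu> (t n) h x) \<longlonglongrightarrow> h x"
          using h(2) t by (intro smear_tendsto_cont h(1)) (auto simp: continuous_on_eq_continuous_at less_imp_le)
        then have "(\<lambda>n. indicator (ball 0 R) x * \<bar>smear \<mu> (t n) h x - h x\<bar>) \<longlonglongrightarrow> indicator (ball 0 R) x * \<bar>h x - h x\<bar>"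
          by (intro tendsto_intros)
        then show "(\<lambda>n. indicator (ball 0 R) x * \<bar>smear \<mu> (t n) h x - h x\<bar>) \<longlonglongrightarrow> 0" by simp
      qed
      show "AE x in lborel. norm (indicator (ball 0 R) x * \<bar>smear \<mu> (t n) h x - h x\<bar>) \<le> indicator (ball 0 R) x * (2 * C)" for n
      proof (rule AE_I2)
        fix x
        have "\<bar>smear \<mu> (t n) h x\<bar> \<le> C" using t(2)[of n] C by (intro smear_abs_le h(1)) auto
        then have "\<bar>smear \<mu> (t n) h x - h x\<bar> \<le> 2 * C" using C(2)[of x] by linarith
        then show "norm (indicator (ball 0 R) x * \<bar>smear \<mu> (t n) h x - h x\<bar>) \<le> indicator (ball 0 R) x * (2 * C)"
          by (auto simp: indicator_def)
      qed
    qed simp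
    then have "(\<lambda>n. \<integral>x. indicator (ball 0 R) x * \<bar>smear \<mu> (t n) h x - h x\<bar> \<partial>lborel) \<longlonglongrightarrow> 0" by simp
    from order_tendstoD(2)[OF this, of "e / 4"] e obtain N where N:
      "\<And>n. N \<le> n \<Longrightarrow> (\<integral>x. indicator (ball 0 R) x * \<bar>smear \<mu> (t n) h x - h x\<bar> \<partial>lborel) < e / 4"
      unfolding eventually_sequentially by auto
    have "(\<integral>x. norm (smear \<mu> (t n) w x - w x) \<partial>lborel) < e" if n: "N \<le> n" for n
    proof -
      let ?G = "\<lambda>x. indicator (ball 0 R) x * \<bar>smear \<mu> (t n) h x - h x\<bar>"
      have bsh: "bdd_borel (\<lambda>x. \<bar>smear \<mu> (t n) h x - h x\<bar>)"
      proof -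
        obtain D where "\<And>x. \<bar>smear \<mu> (t n) h x - h x\<bar> \<le> D"
          using bdd_borel_diff[OF bdd_borel_smear[OF h(1)] h(1)] by (metis bdd_borel_bound)
        then show ?thesis
          using bdd_borel_measurable[OF bdd_borel_diff[OF bdd_borel_smear[OF h(1)] h(1)]]
          by (intro bdd_borelI[where C=D]) auto
      qed
      have "(\<integral>x. norm (smear \<mu> (t n) w x - w x) \<partial>lborel) \<le> (\<integral>x. smear \<mu> (t n) ?F x + ?G x + ?F x \<partial>lborel)"
      proof (rule integral_mono)
        show "integrable lborel (\<lambda>x. norm (smear \<mu> (t n) w x - w x))"
          by (intro integrable_norm Bochner_Integration.integrable_diff smear_integral int_w)
        show "integrable lborel (\<lambda>x. smear \<mu> (t n) ?F x + ?G x + ?F x)"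
          by (intro Bochner_Integration.integrable_add smear_integral int_F int_ind bsh)
        fix x
        have F0: "0 \<le> ?F y" for y by simp
        have sF0: "0 \<le> smear \<mu> (t n) ?F x" using t(2)[of n] by (intro smear_ge_const bF) auto
        show "norm (smear \<mu> (t n) w x - w x) \<le> smear \<mu> (t n) ?F x + ?G x + ?F x"
        proof (cases "x \<in> ball 0 R")
          case True
          have near: "y \<in> ball 0 (R + 2)" if "y \<in> cball x (t n)" for y
            using that True t(3)[of n] norm_triangle_ineq2[of y x] by (simp add: dist_norm norm_minus_commute)
          have "\<bar>smear \<mu> (t n) w x - smear \<mu> (t n) h x\<bar> \<le> smear \<mu> (t n) ?F x"
          proof -
            have "smear \<mu> (t n) (\<lambda>y. w y - h y) x \<le> smear \<mu> (t n) ?F x"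
              "smear \<mu> (t n) (\<lambda>y. h y - w y) x \<le> smear \<mu> (t n) ?F x"
              using near t(2)[of n] by (intro smear_mono bdd_borel_diff w h(1) bF; simp)+
            then show ?thesis by (simp add: smear_diff w h(1))
          qed
          moreover have "?G x = \<bar>smear \<mu> (t n) h x - h x\<bar>" using True by simp
          moreover have "?F x = \<bar>w x - h x\<bar>" using near[of x] t(2)[of n] by (simp add: less_imp_le)
          ultimately show ?thesis unfolding real_norm_def by linarith
        next
          case False
          then show ?thesis using out[OF False, of n] sF0 F0[of x] by simp
        qed
      qed
      also have "\<dots> = (\<integral>x. ?F x \<partial>lborel) + (\<integral>x. ?G x \<partial>lborel) + (\<integral>x. ?F x \<partial>lborel)"
        using smear_integral[OF int_F, of "t n"] int_F int_ind[OF bsh, of 0 R]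
        by (simp add: Bochner_Integration.integral_add)
      also have "\<dots> < e" using h(3) N[OF n] e by linarith
      finally show ?thesis .
    qed
    then show "\<exists>N. \<forall>n\<ge>N. norm ((\<integral>x. norm (smear \<mu> (t n) w x - w x) \<partial>lborel) - 0) < e"
      by (intro exI[of _ N]) (simp add: integral_nonneg_AE)
  qed
qed

section \<open>Extended-real subharmonic functions\<close>

text \<open>This reduces the extended-real integrals to Bochner integrals of real functions.\<close>

lemma ereal_integral_eq:
  fixes \<phi> :: "'a::euclidean_space \<Rightarrow> ereal"
  assumes F: "integrable lborel F" and S: "S \<in> sets borel"
    and eq: "AE x in lborel. x \<in> S \<longrightarrow> \<phi> x = ereal (F x)"
  shows "ereal_integral S \<phi> = ereal (\<integral>x. indicator S x * F x \<partial>lborel)"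
proof -
  let ?G = "\<lambda>x. indicator S x * F x"
  have int: "integrable lborel ?G"
    using integrable_mult_indicator[of S lborel F] S F by simp
  have Sl: "S \<inter> space lebesgue \<in> sets lebesgue" using S by auto
  have nn: "(\<integral>\<^sup>+x. f x \<partial>lebesgue_on S) = (\<integral>\<^sup>+x. ennreal (g x) \<partial>lborel)"
    if "AE x in lborel. f x * indicator S x = ennreal (g x)" for f :: "'a \<Rightarrow> ennreal" and g :: "'a \<Rightarrow> real"
    unfolding nn_integral_restrict_space[OF Sl] nn_integral_completion
    by (rule nn_integral_cong_AE[OF that])
  have pos: "(\<integral>\<^sup>+x. e2ennreal (\<phi> x) \<partial>lebesgue_on S) = (\<integral>\<^sup>+x. ennreal (?G x) \<partial>lborel)"
    by (rule nn) (use eq in eventually_elim, auto simp: indicator_def)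
  have neg: "(\<integral>\<^sup>+x. e2ennreal (- \<phi> x) \<partial>lebesgue_on S) = (\<integral>\<^sup>+x. ennreal (- ?G x) \<partial>lborel)"
    by (rule nn) (use eq in eventually_elim, auto simp: indicator_def)
  have fin: "(\<integral>\<^sup>+x. ennreal (?G x) \<partial>lborel) \<noteq> \<infinity>" "(\<integral>\<^sup>+x. ennreal (- ?G x) \<partial>lborel) \<noteq> \<infinity>"
    using int unfolding real_integrable_def by auto
  have conv: "enn2ereal a = ereal (enn2real a)" if "a \<noteq> \<infinity>" for a
    using that by (cases a) auto
  show ?thesis
    unfolding ereal_integral_def pos neg real_lebesgue_integral_def[OF int]
    by (simp add: conv[OF fin(1)] conv[OF fin(2)])
qed

lemma cball_enlarge:
  fixes x :: "'a::euclidean_space"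
  assumes "open Q" "cball x R \<subseteq> Q" "0 < R"
  obtains \<eta> where "0 < \<eta>" "cball x (R + \<eta>) \<subseteq> Q"
proof -
  obtain \<eta> where eta: "0 < \<eta>" "(\<Union>y\<in>cball x R. cball y \<eta>) \<subseteq> Q"
    using compact_subset_open_imp_cball_epsilon_subset[OF compact_cball assms(1,2)] by blast
  have "cball x (R + \<eta>) \<subseteq> Q"
  proof
    fix z assume z: "z \<in> cball x (R + \<eta>)"
    define y where "y = x + (R / (R + \<eta>)) *\<^sub>R (z - x)"
    have pos: "0 < R + \<eta>" using assms(3) eta(1) by simp
    have nz: "norm (z - x) \<le> R + \<eta>" using z by (simp add: dist_norm norm_minus_commute)
    have "norm (y - x) = R / (R + \<eta>) * norm (z - x)" using assms(3) pos by (simp add: y_def)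
    also have "\<dots> \<le> R / (R + \<eta>) * (R + \<eta>)" using nz assms(3) pos by (intro mult_left_mono) auto
    finally have "y \<in> cball x R" using pos by (simp add: dist_norm norm_minus_commute)
    moreover have "z - y = (\<eta> / (R + \<eta>)) *\<^sub>R (z - x)"
    proof -
      have "z - y = (1 - R / (R + \<eta>)) *\<^sub>R (z - x)" by (simp add: y_def scaleR_diff_left)
      also have "1 - R / (R + \<eta>) = \<eta> / (R + \<eta>)" using pos by (simp add: field_simps)
      finally show ?thesis .
    qed
    then have "norm (z - y) = \<eta> / (R + \<eta>) * norm (z - x)" using eta(1) pos by simp
    then have "norm (z - y) \<le> \<eta> / (R + \<eta>) * (R + \<eta>)"
      using nz eta(1) pos by (simp only:) (intro mult_left_mono, auto)
    then have "z \<in> cball y \<eta>" using pos by (simp add: dist_norm norm_minus_commute)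
    ultimately show "z \<in> Q" using eta(2) by blast
  qed
  then show ?thesis using that eta(1) by blast
qed

text \<open>For a subharmonic function the points of \<open>Q\<close> with an infinite value form a null set, so the value \<open>0\<close> chosen
there does not affect integrals.\<close>

definition finite_part :: "'a set \<Rightarrow> ('a \<Rightarrow> ereal) \<Rightarrow> 'a \<Rightarrow> real" where
  "finite_part Q h x = (if x \<in> Q then real_of_ereal (h x) else 0)"

text \<open>Upper semicontinuity makes \<open>h\<close> Borel measurable on \<open>Q\<close>, and \<open>h\<close> is nowhere \<open>\<infinity>\<close> because its ball averages
are finite. Around a given ball, the truncation of \<open>h\<close> from below at \<open>- m\<close> is bounded and upper semicontinuous on
a compact neighbourhood and still satisfies the local sub-mean value inequality, hence also the global one; then
\<open>m\<close> tends to infinity.\<close>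

lemma subharmonic_real_representative:
  fixes h :: "'a::euclidean_space \<Rightarrow> ereal"
  assumes sub: "subharmonic_on h Q" and hint: "ereal_integrable_on h Q"
  defines "H \<equiv> finite_part Q h"
  shows "integrable lborel H" "AE x in lborel. x \<in> Q \<longrightarrow> h x = ereal (H x)"
    "\<And>x R. \<lbrakk>x \<in> Q; h x \<noteq> -\<infinity>; 0 < R; cball x R \<subseteq> Q\<rbrakk> \<Longrightarrow> H x \<le> smear unif R H x"
proof -
  have at: "subharmonic_at Q h x" if "x \<in> Q" for x
    using sub that by (auto simp: subharmonic_on_def)
  have oQ: "open Q" using sub by (simp add: subharmonic_on_def)
  have Qb [measurable]: "Q \<in> sets borel" using oQ by simp
  have usc: "\<exists>d>0. \<forall>y\<in>Q. dist y x < d \<longrightarrow> h y < c" if "x \<in> Q" "h x < c" for x c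
  proof -
    have "Limsup (at x within Q) h < c"
      using at[OF that(1)] that(2) by (auto simp: subharmonic_at_def)
    then have "\<forall>\<^sub>F y in at x within Q. h y < c" by (rule Limsup_lessD)
    then obtain d where "d > 0" "\<forall>y\<in>Q. y \<noteq> x \<and> dist y x < d \<longrightarrow> h y < c"
      unfolding eventually_at by blast
    then show ?thesis using that(2) by metis
  qed
  define h' where "h' x = (if x \<in> Q then h x else 0)" for x
  have h'_m [measurable]: "h' \<in> borel_measurable borel"
  proof (rule borel_measurableI_less)
    fix c :: ereal
    have "open {x \<in> Q. h x < c}"
      unfolding open_dist
    proof
      fix x assume "x \<in> {x \<in> Q. h x < c}"
      then obtain d e where "d > 0" "\<forall>y\<in>Q. dist y x < d \<longrightarrow> h y < c" "e > 0" "\<forall>y. dist y x < e \<longrightarrow> y \<in> Q"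
        using usc oQ unfolding open_dist by blast
      then show "\<exists>e>0. \<forall>y. dist y x < e \<longrightarrow> y \<in> {x \<in> Q. h x < c}"
        by (intro exI[of _ "min d e"]) auto
    qed
    then have "{x \<in> Q. h x < c} \<in> sets borel" by simp
    moreover have "- Q \<in> sets borel" by simp
    moreover have "{x. h' x < c} = {x \<in> Q. h x < c} \<union> (if 0 < c then - Q else {})"
      by (auto simp: h'_def)
    ultimately show "{x \<in> space borel. h' x < c} \<in> sets borel" by simp
  qed
  have H_h': "H = (\<lambda>x. real_of_ereal (h' x))" by (auto simp: H_def finite_part_def h'_def fun_eq_iff)
  have Hm [measurable]: "H \<in> borel_measurable borel" unfolding H_h' by measurable
  have Sl: "Q \<inter> space lebesgue \<in> sets lebesgue" using Qb by auto
  have fin: "(\<integral>\<^sup>+x. e2ennreal \<bar>h' x\<bar> * indicator Q x \<partial>lborel) < \<infinity>"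
  proof -
    have "(\<integral>\<^sup>+x. e2ennreal \<bar>h x\<bar> \<partial>lebesgue_on Q) = (\<integral>\<^sup>+x. e2ennreal \<bar>h x\<bar> * indicator Q x \<partial>lborel)"
      unfolding nn_integral_restrict_space[OF Sl] nn_integral_completion ..
    also have "\<dots> = (\<integral>\<^sup>+x. e2ennreal \<bar>h' x\<bar> * indicator Q x \<partial>lborel)"
      by (intro nn_integral_cong) (auto simp: h'_def indicator_def)
    finally show ?thesis using hint by (simp add: ereal_integrable_on_def)
  qed
  have AE_fin: "AE x in lborel. x \<in> Q \<longrightarrow> \<bar>h x\<bar> \<noteq> \<infinity>"
  proof -
    have "AE x in lborel. e2ennreal \<bar>h' x\<bar> * indicator Q x \<noteq> \<infinity>"
      by (rule nn_integral_PInf_AE) (use fin in auto)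
    then show ?thesis by eventually_elim (auto simp: h'_def)
  qed
  then show AE_H: "AE x in lborel. x \<in> Q \<longrightarrow> h x = ereal (H x)"
    by eventually_elim (auto simp: H_def finite_part_def ereal_real')
  show int_H: "integrable lborel H"
  proof (rule integrableI_bounded)
    have "(\<integral>\<^sup>+x. ennreal (norm (H x)) \<partial>lborel) \<le> (\<integral>\<^sup>+x. e2ennreal \<bar>h' x\<bar> * indicator Q x \<partial>lborel)"
    proof (rule nn_integral_mono)
      fix x
      show "ennreal (norm (H x)) \<le> e2ennreal \<bar>h' x\<bar> * indicator Q x"
        by (cases "h x") (auto simp: H_def finite_part_def h'_def)
    qed
    then show "(\<integral>\<^sup>+x. ennreal (norm (H x)) \<partial>lborel) < \<infinity>" using fin by (rule le_less_trans)
  qed simp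
  have avg: "ball_average h x r = ereal (smear unif r H x)" if "0 < r" "cball x r \<subseteq> Q" for x r
  proof -
    have sub: "ball x r \<subseteq> Q" using that(2) ball_subset_cball by blast
    have "AE y in lborel. y \<in> ball x r \<longrightarrow> h y = ereal (H y)"
      using AE_H by eventually_elim (use sub in auto)
    then have "ereal_integral (ball x r) h = ereal (\<integral>y. indicator (ball x r) y * H y \<partial>lborel)"
      by (intro ereal_integral_eq int_H) auto
    moreover have "0 < measure lborel (ball x r)" using that(1) by (simp add: content_ball)
    ultimately show ?thesis
      using that(1) by (simp add: ball_average_def smear_unif[OF Hm] measure_completion)
  qed
  have small: "\<forall>\<^sub>F r in at_right 0. 0 < r \<and> cball x r \<subseteq> S" if "x \<in> interior S" for x and S :: "'a set"
  proof -
    obtain e where e: "e > 0" "cball x e \<subseteq> S" using \<open>x \<in> interior S\<close> by (meson mem_interior_cball)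
    show ?thesis
      unfolding eventually_at_right_field
    proof (intro exI[of _ e] conjI allI impI)
      fix r assume "0 < r" "r < e"
      then have "cball x r \<subseteq> cball x e" by (intro subset_cball) simp
      then show "cball x r \<subseteq> S" using e(2) by blast
    qed (use e in auto)
  qed
  have loc: "\<forall>\<^sub>F r in at_right 0. h x \<le> ereal (smear unif r H x)" if "x \<in> Q" for x
  proof -
    have "\<forall>\<^sub>F r in at_right 0. h x \<le> ball_average h x r"
      using at[OF that] by (simp add: subharmonic_at_def)
    moreover have "\<forall>\<^sub>F r in at_right 0. 0 < r \<and> cball x r \<subseteq> Q"
      using that oQ by (intro small) (simp add: interior_open)
    ultimately show ?thesis by eventually_elim (simp add: avg)
  qed
  have h_top: "h x \<noteq> \<infinity>" if "x \<in> Q" for x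
  proof -
    have "\<exists>r. h x \<le> ereal (smear unif r H x)"
      using eventually_happens'[OF _ loc[OF that]] by (auto simp: trivial_limit_at_right_real)
    then show ?thesis by auto
  qed
  show "H x \<le> smear unif R H x" if x: "x \<in> Q" "h x \<noteq> -\<infinity>" and R: "0 < R" "cball x R \<subseteq> Q" for x R
  proof -
    obtain \<eta> where eta: "0 < \<eta>" "cball x (R + \<eta>) \<subseteq> Q" by (rule cball_enlarge[OF oQ R(2,1)])
    define K where "K = cball x (R + \<eta>)"
    have KQ: "K \<subseteq> Q" and Kc: "compact K" using eta(2) by (auto simp: K_def)
    have KR: "cball x R \<subseteq> interior K" using eta(1) by (auto simp: K_def interior_cball)
    define k where "k m y = (if y \<in> K then real_of_ereal (max (h y) (ereal (- real m))) else 0)" for m :: nat and y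
    have k_eq: "max (h y) (ereal (- real m)) = ereal (k m y)" if "y \<in> K" for m y
      using that h_top[of y] KQ by (cases "h y") (auto simp: k_def max_def)
    have k_H: "k m y = max (H y) (- real m)" if "y \<in> K" "h y = ereal (H y)" for m y
      using k_eq[OF that(1), of m] that(2) by (metis ereal_less_eq(3) ereal.inject max_def)
    have k_ge: "- real m \<le> k m y" for m y
    proof (cases "y \<in> K")
      case True
      have "ereal (- real m) \<le> ereal (k m y)" unfolding k_eq[OF True, symmetric] by simp
      then show ?thesis by simp
    qed (simp add: k_def)
    have k_usc: "usc_on K (k m)" for m
      unfolding usc_on_def
    proof (intro ballI allI impI)
      fix y and e :: real assume y: "y \<in> K" and e: "0 < e"
      have "h y < ereal (k m y + e)" and low: "ereal (- real m) < ereal (k m y + e)"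
      proof -
        have "max (h y) (ereal (- real m)) < ereal (k m y + e)" using e by (simp add: k_eq[OF y])
        then show "h y < ereal (k m y + e)" "ereal (- real m) < ereal (k m y + e)" by auto
      qed
      then obtain d where "d > 0" "\<forall>z\<in>Q. dist z y < d \<longrightarrow> h z < ereal (k m y + e)"
        using usc[of y] y KQ by blast
      moreover have "k m z < k m y + e" if "z \<in> K" "h z < ereal (k m y + e)" for z
        using k_eq[OF that(1), of m] that(2) low by (metis less_ereal.simps(1) max_less_iff_conj)
      ultimately show "\<exists>d>0. \<forall>z\<in>K. dist z y < d \<longrightarrow> k m z < k m y + e" using KQ by blast
    qed
    have bk: "bdd_borel (k m)" for m
    proof -
      have "K \<noteq> {}" using R(1) eta(1) by (auto simp: K_def)
      then obtain y0 where y0: "\<And>y. y \<in> K \<Longrightarrow> k m y \<le> k m y0"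
        using usc_on_attains_max[OF Kc _ k_usc] by blast
      have "\<bar>k m y\<bar> \<le> max (real m) \<bar>k m y0\<bar>" for y
      proof (cases "y \<in> K")
        case True
        then show ?thesis using k_ge[of m y] y0[of y] by linarith
      qed (simp add: k_def)
      moreover have "k m \<in> borel_measurable borel"
      proof -
        have [measurable]: "K \<in> sets borel" by (simp add: K_def)
        have "k m = (\<lambda>y. if y \<in> K then real_of_ereal (max (h' y) (ereal (- real m))) else 0)"
          using KQ by (auto simp: k_def h'_def fun_eq_iff)
        then show ?thesis by simp
      qed
      ultimately show ?thesis by (intro bdd_borelI)
    qed
    have km [measurable]: "k m \<in> borel_measurable borel" for m using bk by (rule bdd_borel_measurable)
    have int_bH: "integrable lborel (\<lambda>y. indicator (ball z r) y * H y)" for z r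
      using integrable_mult_indicator[of "ball z r" lborel H] int_H by simp
    have int_bk: "integrable lborel (\<lambda>y. indicator (ball z r) y * k m y)" for z r m
      by (rule integrable_mult_bdd[OF integrable_ball_indicator bk])
    have H_le_k: "smear unif r H z \<le> smear unif r (k m) z" if "0 < r" "cball z r \<subseteq> K" for r z m
    proof -
      have "(\<integral>y. indicator (ball z r) y * H y \<partial>lborel) \<le> (\<integral>y. indicator (ball z r) y * k m y \<partial>lborel)"
      proof (rule integral_mono_AE[OF int_bH int_bk])
        show "AE y in lborel. indicator (ball z r) y * H y \<le> indicator (ball z r) y * k m y"
          using AE_H
        proof eventually_elim
          case (elim y)
          show ?case
          proof (cases "y \<in> ball z r")
            case True
            then have "y \<in> K" using that(2) ball_subset_cball by blast
            then show ?thesis using k_H[of y m] elim KQ True by auto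
          qed simp
        qed
      qed
      then show ?thesis using that(1) by (simp add: smear_unif divide_right_mono)
    qed
    have sub_k: "\<forall>\<^sub>F r in at_right 0. k m z \<le> smear unif r (k m) z" if "z \<in> interior K" for z m
    proof -
      have zK: "z \<in> K" using that interior_subset by blast
      have "\<forall>\<^sub>F r in at_right 0. h z \<le> ereal (smear unif r H z)" using zK KQ by (intro loc) auto
      with small[OF that] show ?thesis
      proof eventually_elim
        case (elim r)
        have "h z \<le> ereal (smear unif r (k m) z)"
          using elim H_le_k[of r z m] by (auto intro: order_trans)
        moreover have "- real m \<le> smear unif r (k m) z"
          using elim k_ge by (intro unif.smear_ge_const bk) auto
        ultimately have "max (h z) (ereal (- real m)) \<le> ereal (smear unif r (k m) z)" by simp
        then show ?case by (simp add: k_eq[OF zK])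
      qed
    qed
    have main: "k m x \<le> smear unif R (k m) x" for m
      by (rule local_submean_imp_submean[OF bk Kc k_usc sub_k KR R(1)])
    have "(\<lambda>m. \<integral>y. indicator (ball x R) y * k m y \<partial>lborel) \<longlonglongrightarrow> (\<integral>y. indicator (ball x R) y * H y \<partial>lborel)"
    proof (rule integral_dominated_convergence[where w="\<lambda>y. \<bar>indicator (ball x R) y * H y\<bar>"])
      show "integrable lborel (\<lambda>y. \<bar>indicator (ball x R) y * H y\<bar>)"
        by (intro integrable_abs int_bH)
      have inK: "y \<in> K" if "y \<in> ball x R" for y using that KR interior_subset ball_subset_cball by blast
      show "AE y in lborel. (\<lambda>m. indicator (ball x R) y * k m y) \<longlonglongrightarrow> indicator (ball x R) y * H y"
        using AE_H
      proof eventually_elim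
        case (elim y)
        show ?case
        proof (cases "y \<in> ball x R")
          case True
          then have yK: "y \<in> K" and hy: "h y = ereal (H y)" using inK KQ elim by auto
          obtain N :: nat where N: "- H y \<le> real N" using real_arch_simple by blast
          have "\<forall>\<^sub>F m in sequentially. H y = k m y"
            unfolding eventually_sequentially
          proof (intro exI[of _ N] allI impI)
            fix m assume "N \<le> m"
            then have "- H y \<le> real m" using N by (meson order_trans of_nat_mono)
            then show "H y = k m y" using k_H[OF yK hy, of m] by simp
          qed
          then have "(\<lambda>m. k m y) \<longlonglongrightarrow> H y" by (rule Lim_transform_eventually[OF tendsto_const])
          then show ?thesis by (intro tendsto_intros)
        qed simp
      qed
      show "AE y in lborel. norm (indicator (ball x R) y * k m y) \<le> \<bar>indicator (ball x R) y * H y\<bar>" for m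
        using AE_H
      proof eventually_elim
        case (elim y)
        show ?case
        proof (cases "y \<in> ball x R")
          case True
          then have "k m y = max (H y) (- real m)" using inK KQ elim by (intro k_H) auto
          then show ?thesis using True by (auto simp: max_def abs_real_def)
        qed simp
      qed
    qed measurable
    moreover have "measure lborel (ball x R) \<noteq> 0"
    proof -
      have "0 < measure lborel (ball x R)" using R(1) by (simp add: content_ball)
      then show ?thesis by simp
    qed
    ultimately have "(\<lambda>m. smear unif R (k m) x) \<longlonglongrightarrow> smear unif R H x"
      unfolding smear_unif[OF km R(1)] smear_unif[OF Hm R(1)]
      by (intro tendsto_divide tendsto_const)
    moreover have "H x \<le> smear unif R (k m) x" for m
    proof -
      have xK: "x \<in> K" using R(1) eta(1) by (simp add: K_def)
      have "h x = ereal (H x)" using x h_top[OF x(1)] by (cases "h x") (auto simp: H_def finite_part_def)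
      then show ?thesis using k_H[OF xK, of m] main[of m] by simp
    qed
    ultimately show ?thesis by (intro LIMSEQ_le_const) auto
  qed
qed

section \<open>Existence of quadrature domains\<close>

text \<open>The domain is the union of \<open>U\<close> with the set where the obstacle solution \<open>u\<close> is positive. The truncations of \<open>u\<close>
have quotients \<open>\<zeta> n = (A r v - v) / r\<^sup>2\<close> that are bounded, have nonnegative integral against every integrable
subharmonic function on \<open>Q\<close>, and converge almost everywhere on \<open>Q\<close> to \<open>1 - w\<close>.\<close>

theorem quadrature_domain_exists:
  fixes w :: "'a::euclidean_space \<Rightarrow> real"
  assumes weight: "weight_function w" and supported: "properly_supported w"
  shows "\<exists>Q. quadrature_domain w Q"
proof -
  obtain U where U: "open U" "bounded U" "\<And>x. x \<in> U \<Longrightarrow> 1 \<le> w x" "\<And>x. x \<notin> U \<Longrightarrow> w x = 0"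
    using supported unfolding properly_supported_def by blast
  have w_m: "w \<in> borel_measurable lebesgue" and w_bd: "bounded (range w)"
    using weight by (auto simp: weight_function_def)
  obtain C0 where "\<And>x. \<bar>w x\<bar> \<le> C0" using w_bd unfolding bounded_iff by auto
  define C where "C = max 1 C0"
  have C: "1 \<le> C" "w x \<le> C" for x using \<open>\<And>x. \<bar>w x\<bar> \<le> C0\<close>[of x] by (auto simp: C_def abs_le_iff)
  obtain w0 where w0: "w0 \<in> borel_measurable lborel" "AE x in lborel. w x = w0 x"
    using completion_ex_borel_measurable_real[OF w_m] by blast
  \<comment> \<open>A Borel version of \<open>w\<close> that satisfies the bounds \<open>1 \<le> w' \<le> C\<close> at every point of \<open>U\<close>.\<close>
  define w' where "w' x = (if x \<in> U then min C (max 1 (w0 x)) else 0)" for x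
  have w'_m: "w' \<in> borel_measurable borel"
  proof -
    have [measurable]: "U \<in> sets borel" "w0 \<in> borel_measurable borel" using U(1) w0(1) by auto
    show ?thesis unfolding w'_def[abs_def] by measurable
  qed
  have w'_bounds: "0 \<le> w' x" "w' x \<le> C" "x \<in> U \<Longrightarrow> 1 \<le> w' x" "x \<notin> U \<Longrightarrow> w' x = 0" for x
    using C(1) by (auto simp: w'_def)
  have bw': "bdd_borel w'" by (rule bdd_borelI[OF w'_m, of C]) (use w'_bounds in auto)
  have w'_eq: "AE x in lborel. w' x = w x"
    using w0(2)
  proof eventually_elim
    case (elim x)
    then show ?case using U(3)[of x] U(4)[of x] C(2)[of x] by (cases "x \<in> U") (auto simp: w'_def)
  qed
  obtain R0 where R0: "\<And>x. x \<in> U \<Longrightarrow> norm x \<le> R0" using U(2) unfolding bounded_iff by auto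
  have w'_supp: "w' x = 0" if "R0 < norm x" for x using R0[of x] that w'_bounds(4) by force
  define g where "g x = 1 - w' x" for x
  have bg: "bdd_borel g" unfolding g_def[abs_def] by (intro bdd_borel_diff bdd_borel_const bw')
  obtain u L R2 where bu: "bdd_borel u" and u_nonneg: "\<And>x. 0 \<le> u x" and u_supp: "\<And>x. R2 < norm x \<Longrightarrow> u x = 0"
    and L: "0 \<le> L" "\<And>x y. norm (x - y) \<le> 1 \<Longrightarrow> \<bar>u x - u y\<bar> \<le> L * norm (x - y)"
    and upper: "\<And>x r. 0 < r \<Longrightarrow> smear unif r u x - u x \<le> r\<^sup>2 * smear dome r g x"
    and equal: "\<And>x r. 0 < r \<Longrightarrow> (\<And>y. y \<in> cball x r \<Longrightarrow> 0 < u y) \<Longrightarrow>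
       smear unif r u x - u x = r\<^sup>2 * smear dome r g x"
  proof (rule obstacle_solution_exists[OF bw' w'_bounds(1) w'_supp], fold g_def[abs_def])
    fix u L R2
    assume "bdd_borel u" "\<And>x. 0 \<le> u x" "\<And>x. R2 < norm x \<Longrightarrow> u x = 0" "0 \<le> L"
      "\<And>x y. norm (x - y) \<le> 1 \<Longrightarrow> \<bar>u x - u y\<bar> \<le> L * norm (x - y)"
      "\<And>x r. 0 < r \<Longrightarrow> smear unif r u x - u x \<le> r\<^sup>2 * smear dome r g x"
      "\<And>x r. 0 < r \<Longrightarrow> (\<And>y. y \<in> cball x r \<Longrightarrow> 0 < u y) \<Longrightarrow>
         smear unif r u x - u x = r\<^sup>2 * smear dome r g x"
    then show thesis by (rule that)
  qed
  obtain y0 where y0: "u y0 = 0"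
  proof -
    obtain b :: 'a where "b \<in> Basis" using nonempty_Basis by blast
    then have "R2 < norm ((\<bar>R2\<bar> + 1) *\<^sub>R b)" by simp
    then show thesis using u_supp that by blast
  qed
  obtain B M where B: "0 < B" and M: "0 \<le> M"
    and inside: "\<And>r x y. 0 < r \<Longrightarrow> r \<le> 1 \<Longrightarrow> B * r < u x \<Longrightarrow> y \<in> cball x r \<Longrightarrow> 0 < u y"
    and bound: "\<And>r x. 0 < r \<Longrightarrow> r \<le> 1 \<Longrightarrow>
       \<bar>smear unif r (\<lambda>y. soft (B * r) (u y)) x - soft (B * r) (u x)\<bar> \<le> M * r\<^sup>2"
    and lin: "\<And>r x. 0 < r \<Longrightarrow> r \<le> 1 \<Longrightarrow> 3 * B * r < u x \<Longrightarrow>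
       smear unif r (\<lambda>y. soft (B * r) (u y)) x - soft (B * r) (u x) = r\<^sup>2 * smear dome r g x"
  proof (rule truncated_odometer[OF bu u_nonneg L y0 bg upper equal])
    fix B M :: real
    assume "0 < B" "0 \<le> M"
      "\<And>r x y. 0 < r \<Longrightarrow> r \<le> 1 \<Longrightarrow> B * r < u x \<Longrightarrow> y \<in> cball x r \<Longrightarrow> 0 < u y"
      "\<And>r x. 0 < r \<Longrightarrow> r \<le> 1 \<Longrightarrow>
         \<bar>smear unif r (\<lambda>y. soft (B * r) (u y)) x - soft (B * r) (u x)\<bar> \<le> M * r\<^sup>2"
      "\<And>r x. 0 < r \<Longrightarrow> r \<le> 1 \<Longrightarrow> 3 * B * r < u x \<Longrightarrow>
         smear unif r (\<lambda>y. soft (B * r) (u y)) x - soft (B * r) (u x) = r\<^sup>2 * smear dome r g x"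
    then show thesis by (rule that)
  qed
  define Q where "Q = U \<union> {x. 0 < u x}"
  have u_cont: "continuous_on UNIV u" using L by (rule locally_lipschitz_continuous)
  have oQ: "open Q"
    unfolding Q_def using U(1) open_Collect_less[OF continuous_on_const u_cont, of 0] by blast
  have bQ: "bounded Q"
  proof (rule bounded_subset)
    show "bounded (U \<union> cball 0 R2)" using U(2) by simp
    show "Q \<subseteq> U \<union> cball 0 R2" using u_supp unfolding Q_def by force
  qed
  define t where "t j = 1 / real (Suc j)" for j
  have t: "t \<longlonglongrightarrow> 0" "0 < t j" "t j \<le> 1" for j
    using LIMSEQ_inverse_real_of_nat by (auto simp: t_def[abs_def] inverse_eq_divide)
  have "\<exists>j. strict_mono (j :: nat \<Rightarrow> nat) \<and>
      (AE x in lborel. (\<lambda>n. smear dome (t (j n)) w' x - w' x) \<longlonglongrightarrow> 0)"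
  proof (rule tendsto_L1_AE_subseq)
    show "integrable lborel (\<lambda>x. smear dome (t n) w' x - w' x)" for n
      by (rule dome.smear_L1_tendsto(1)[OF bw' w'_supp t])
    show "(\<lambda>n. \<integral>x. norm (smear dome (t n) w' x - w' x) \<partial>lborel) \<longlonglongrightarrow> 0"
      by (rule dome.smear_L1_tendsto(2)[OF bw' w'_supp t])
  qed
  then obtain j where j: "strict_mono (j :: nat \<Rightarrow> nat)"
    and j_lim: "AE x in lborel. (\<lambda>n. smear dome (t (j n)) w' x - w' x) \<longlonglongrightarrow> 0"
    by blast
  define r where "r n = t (j n)" for n
  have r: "r \<longlonglongrightarrow> 0" "0 < r n" "r n \<le> 1" for n
    using LIMSEQ_subseq_LIMSEQ[OF t(1) j] t by (auto simp: r_def[abs_def] o_def)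
  define v where "v n x = soft (B * r n) (u x)" for n x
  have Br: "0 < B * r n" for n using B r(2) by simp
  have v_bounds: "0 \<le> v n x" "v n x \<le> u x" for n x
    by (simp_all add: v_def soft_nonneg soft_le Br u_nonneg)
  have bv: "bdd_borel (v n)" for n
    unfolding v_def[abs_def] by (rule bdd_borel_soft[OF bu u_nonneg Br])
  define \<zeta> where "\<zeta> n x = (smear unif (r n) (v n) x - v n x) / (r n)\<^sup>2" for n x
  have \<zeta>_bound: "\<bar>\<zeta> n x\<bar> \<le> M" for n x
    using bound[OF r(2,3), of n x] r(2)[of n] by (simp add: \<zeta>_def v_def[abs_def] divide_le_eq)
  have \<zeta>_eq: "\<forall>\<^sub>F n in sequentially. smear dome (r n) g x = \<zeta> n x" if "x \<in> Q" for x
  proof (cases "0 < u x")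
    case True
    have "(\<lambda>n. 3 * B * r n) \<longlonglongrightarrow> 3 * B * 0" by (intro tendsto_intros r)
    then have "\<forall>\<^sub>F n in sequentially. 3 * B * r n < u x" using True by (intro order_tendstoD) auto
    then show ?thesis
    proof eventually_elim
      case (elim n)
      then show ?case using lin[OF r(2,3), of n x] r(2)[of n] by (simp add: \<zeta>_def v_def[abs_def])
    qed
  next
    case False
    then have ux: "u x = 0" and "x \<in> U" using u_nonneg[of x] that by (auto simp: Q_def)
    \<comment> \<open>On \<open>U\<close> the source \<open>1 - w'\<close> is nonpositive, so at a zero of the nonnegative function \<open>u\<close>
      both sides of the obstacle inequality vanish.\<close>
    then obtain e where e: "e > 0" "cball x e \<subseteq> U" using U(1) unfolding open_contains_cball by blast
    have "\<forall>\<^sub>F n in sequentially. r n < e" using r(1) e(1) by (rule order_tendstoD)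
    then show ?thesis
    proof eventually_elim
      case (elim n)
      then have sub: "cball x (r n) \<subseteq> U" using e(2) by (meson less_imp_le subset_cball subset_trans)
      have Eg: "smear dome (r n) g x \<le> 0"
        using r(2)[of n] sub w'_bounds(3) by (intro dome.smear_le_const bg) (auto simp: g_def)
      have Au: "0 \<le> smear unif (r n) u x" "smear unif (r n) u x \<le> (r n)\<^sup>2 * smear dome (r n) g x"
        using upper[OF r(2), of n x] ux r(2)[of n] by (auto intro!: unif.smear_ge_const bu simp: u_nonneg less_imp_le)
      have "smear dome (r n) g x = 0"
        using Au Eg r(2)[of n] by (smt (verit) zero_less_power mult_pos_neg)
      then have "smear unif (r n) u x = 0" using Au by simp
      moreover have "0 \<le> smear unif (r n) (v n) x"
        by (intro unif.smear_ge_const bv less_imp_le[OF r(2)] v_bounds)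
      moreover have "smear unif (r n) (v n) x \<le> smear unif (r n) u x"
        by (intro unif.smear_mono bv bu less_imp_le[OF r(2)] v_bounds)
      moreover have "v n x = 0" using v_bounds[of n x] ux by simp
      ultimately show ?case using \<open>smear dome (r n) g x = 0\<close> by (simp add: \<zeta>_def)
    qed
  qed
  have "quadrature_domain w Q"
    unfolding quadrature_domain_def
  proof (intro conjI allI impI oQ bQ, goal_cases)
    case (1 x)
    then show ?case using U(4) by (auto simp: Q_def)
  next
    case (2 h)
    define H where "H = finite_part Q h"
    note rep = subharmonic_real_representative[OF 2[THEN conjunct1] 2[THEN conjunct2], folded H_def]
    have [measurable]: "H \<in> borel_measurable borel" using rep(1) by auto
    have int_Hf: "integrable lborel (\<lambda>x. H x * f x)" if "bdd_borel f" for f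
      by (rule integrable_mult_bdd[OF rep(1) that])
    have b\<zeta>: "bdd_borel (\<zeta> n)" for n
    proof -
      have "bdd_borel (\<lambda>x. (1 / (r n)\<^sup>2) * (smear unif (r n) (v n) x - v n x))"
        by (intro bdd_borel_cmult bdd_borel_diff unif.bdd_borel_smear bv)
      then show ?thesis by (simp add: \<zeta>_def[abs_def])
    qed
    have pairing: "0 \<le> (\<integral>x. H x * \<zeta> n x \<partial>lborel)" for n
    proof -
      have "0 \<le> (\<integral>x. H x * (smear unif (r n) (v n) x - v n x) \<partial>lborel)"
      proof (rule submean_pairing_nonneg[OF rep(1) bv v_bounds(1)])
        show "AE x in lborel. 0 < v n x \<longrightarrow> H x \<le> smear unif (r n) H x"
          using rep(2)
        proof eventually_elim
          case (elim x)
          show ?case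
          proof
            assume "0 < v n x"
            then have Bu: "B * r n < u x"
              using soft_eq_0[OF Br, of "u x" n] unfolding v_def by (cases "u x \<le> B * r n") auto
            then have xQ: "x \<in> Q" using Br[of n] by (simp add: Q_def)
            show "H x \<le> smear unif (r n) H x"
            proof (rule rep(3)[OF xQ _ r(2)])
              show "h x \<noteq> - \<infinity>" using elim xQ by auto
              show "cball x (r n) \<subseteq> Q" using inside[OF r(2,3) Bu] by (auto simp: Q_def)
            qed
          qed
        qed
      qed
      then have "0 \<le> (\<integral>x. H x * (smear unif (r n) (v n) x - v n x) \<partial>lborel) / (r n)\<^sup>2" by simp
      also have "\<dots> = (\<integral>x. H x * \<zeta> n x \<partial>lborel)" by (simp add: \<zeta>_def)
      finally show ?thesis .
    qed
    have [measurable]: "\<zeta> n \<in> borel_measurable borel" "g \<in> borel_measurable borel" for n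
      using b\<zeta> bg by (auto intro: bdd_borel_measurable)
    have "(\<lambda>n. \<integral>x. H x * \<zeta> n x \<partial>lborel) \<longlonglongrightarrow> (\<integral>x. H x * g x \<partial>lborel)"
    proof (rule integral_dominated_convergence[where w="\<lambda>x. \<bar>H x\<bar> * M"])
      show "integrable lborel (\<lambda>x. \<bar>H x\<bar> * M)" by (intro integrable_mult_left integrable_abs rep(1))
      show "AE x in lborel. norm (H x * \<zeta> n x) \<le> \<bar>H x\<bar> * M" for n
        using \<zeta>_bound by (auto simp: abs_mult intro!: mult_left_mono)
      show "AE x in lborel. (\<lambda>n. H x * \<zeta> n x) \<longlonglongrightarrow> H x * g x"
        using j_lim
      proof eventually_elim
        case (elim x)
        show ?case
        proof (cases "x \<in> Q")
          case True
          have "(\<lambda>n. 1 - (w' x + (smear dome (r n) w' x - w' x))) \<longlonglongrightarrow> 1 - (w' x + 0)"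
            using elim unfolding r_def by (intro tendsto_intros)
          moreover have "smear dome (r n) g x = 1 - smear dome (r n) w' x" for n
            unfolding g_def[abs_def] by (simp add: dome.smear_diff dome.smear_const bdd_borel_const bw')
          ultimately have "(\<lambda>n. smear dome (r n) g x) \<longlonglongrightarrow> g x" by (simp add: g_def)
          then have "(\<lambda>n. \<zeta> n x) \<longlonglongrightarrow> g x" by (rule Lim_transform_eventually[OF _ \<zeta>_eq[OF True]])
          then show ?thesis by (intro tendsto_intros)
        qed (simp add: H_def finite_part_def)
      qed
    qed measurable
    then have "0 \<le> (\<integral>x. H x * g x \<partial>lborel)" by (rule LIMSEQ_le_const) (use pairing in auto)
    also have "\<dots> = (\<integral>x. H x - H x * w' x \<partial>lborel)" by (simp add: g_def right_diff_distrib)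
    also have "\<dots> = (\<integral>x. H x \<partial>lborel) - (\<integral>x. H x * w' x \<partial>lborel)"
      by (intro Bochner_Integration.integral_diff rep(1) int_Hf bw')
    finally have ineq: "(\<integral>x. H x * w' x \<partial>lborel) \<le> (\<integral>x. H x \<partial>lborel)" by simp
    have outside: "indicator Q x * H x = H x" "indicator Q x * (H x * w' x) = H x * w' x" for x
      by (auto simp: H_def finite_part_def indicator_def)
    have Qb: "Q \<in> sets borel" using oQ by simp
    have "ereal_integral Q (\<lambda>x. h x * ereal (w x)) = ereal (\<integral>x. indicator Q x * (H x * w' x) \<partial>lborel)"
    proof (rule ereal_integral_eq[OF int_Hf[OF bw'] Qb])
      show "AE x in lborel. x \<in> Q \<longrightarrow> h x * ereal (w x) = ereal (H x * w' x)"
        using rep(2) w'_eq by eventually_elim auto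
    qed
    moreover have "ereal_integral Q h = ereal (\<integral>x. indicator Q x * H x \<partial>lborel)"
      by (rule ereal_integral_eq[OF rep(1) Qb rep(2)])
    ultimately show ?case using ineq by (simp add: outside)
  qed
  then show ?thesis by blast
qed

theorem theorem4p14:
  fixes w :: "real ^ 'd \<Rightarrow> real"
  assumes "weight_function w" and "properly_supported w"
  shows "\<exists>Q. quadrature_domain w Q"
  using assms by (rule quadrature_domain_exists)

end
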